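(* Let $\mathcal X$ and $\mathcal Y$ be infinite dimensional complex Banach spaces and let $A\in L(\mathcal X)$ and $B\in L(\mathcal Y)$ be such that $a$-Browder's theorem (equivalently, generalized $a$-Browder's theorem) holds for $A$ and for $B^*$. Let $\rho\colon L(\mathcal Y,\mathcal X)\to L(\mathcal Y,\mathcal X)$ be the generalized derivation defined by $A$ and $B$, i.e. $\rho(U)=AU-UB$ for $U\in L(\mathcal Y,\mathcal X)$. Then the following statements are equivalent. (i) $a$-Browder's theorem (equivalently, generalized $a$-Browder's theorem) holds for $\rho$. (ii) $(\mathrm{acc}\,\sigma_a(A)-\sigma_a(B^* ))\cup(\sigma_a(A)-\mathrm{acc}\,\sigma_a(B^* ))\subseteq\sigma_{aw}(\rho)$. (iii) $\sigma_{aw}(\rho)=(\sigma_{aw}(A)-\sigma_a(B^* ))\cup(\sigma_a(A)-\sigma_{aw}(B^* ))$. (iv) $(\mathrm{acc}\,\sigma_a(A)-\sigma_a(B^* ))\cup(\sigma_a(A)-\mathrm{acc}\,\sigma_a(B^* ))\subseteq\sigma_{SBF_+^-}(\rho)$. (v) Given $\lambda\in\sigma_a(\rho)\setminus\sigma_{aw}(\rho)$, for all $\mu\in\sigma_a(A)$ and $\nu\in\sigma_a(B^* )$ such that $\lambda=\mu-\nu$, one has $\mu\in\Phi_+(A)$, $\nu\in\Phi_+(B^* )$, $A$ has the SVEP at $\mu$ and $B^*$ has the SVEP at $\nu$.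
   Context: $L(\mathcal Y,\mathcal X)$ is the Banach space of bounded linear maps from $\mathcal Y$ to $\mathcal X$, $L(\mathcal X)=L(\mathcal X,\mathcal X)$, and $B^*\in L(\mathcal Y^* )$ is the (Banach space) adjoint of $B$. For $S,T\subseteq\mathbb C$, $S-T=\{s-t: s\in S,\ t\in T\}$ (empty if $S$ or $T$ is empty). For $K\subseteq\mathbb C$, $\mathrm{acc}\,K$ is the set of limit points of $K$ and $\mathrm{iso}\,K=K\setminus\mathrm{acc}\,K$. For a bounded operator $T$ on a Banach space, $N(T)$ and $R(T)$ are its null space and range, $\alpha(T)=\dim N(T)$, $\beta(T)$ is the codimension of $R(T)$, $\mathrm{ind}(T)=\alpha(T)-\beta(T)$. $T$ is bounded below if $N(T)=0$ and $R(T)$ is closed; $T$ is upper semi-Fredholm if $R(T)$ is closed and $\alpha(T)<\infty$ (its index may be $-\infty$). $T$ is upper semi B-Fredholm if there is $n\in\mathbb N$ such that $R(T^n)$ is closed and the induced operator $T_n=T|_{R(T^n)}\in L(R(T^n))$ is upper semi-Fredholm; its index is $\mathrm{ind}(T)=\mathrm{ind}(T_n)$, independent of such $n$. Then: $\sigma_a(T)=\{\lambda\in\mathbb C: T-\lambda$ is not bounded below$\}$; $\Phi_+(T)=\{\lambda\in\mathbb C: T-\lambda$ is upper semi-Fredholm$\}$; $\sigma_{aw}(T)=\{\lambda\in\sigma_a(T): T-\lambda$ is not upper semi-Fredholm or $0<\mathrm{ind}(T-\lambda)\}$; $\sigma_{SBF_+^-}(T)=\{\lambda\in\mathbb C: T-\lambda$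 is not upper semi B-Fredholm or $0<\mathrm{ind}(T-\lambda)\}$. The ascent $\mathrm{asc}(T)$ is the smallest integer $a\ge0$ with $N(T^a)=N(T^{a+1})$ ($\infty$ if none exists). $\Pi^a(T)=\{\lambda\in\mathrm{iso}\,\sigma_a(T): a=\mathrm{asc}(T-\lambda)<\infty$ and $R((T-\lambda)^{a+1})$ is closed$\}$ and $\Pi_0^a(T)=\{\lambda\in\Pi^a(T):\alpha(T-\lambda)<\infty\}$. $a$-Browder's theorem holds for $T$ if $\sigma_{aw}(T)=\sigma_a(T)\setminus\Pi_0^a(T)$; generalized $a$-Browder's theorem holds for $T$ if $\sigma_{SBF_+^-}(T)=\sigma_a(T)\setminus\Pi^a(T)$. It is known that these two conditions are equivalent. $T$ acting on a Banach space $\mathcal Z$ has the SVEP at $\lambda_0\in\mathbb C$ if for every open disc $D$ centered at $\lambda_0$ the only analytic function $f\colon D\to\mathcal Z$ with $(T-\lambda)f(\lambda)=0$ for all $\lambda\in D$ is $f\equiv0$. *)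

theory Defs
  imports "HOL-Analysis.Analysis" "HOL-Library.Extended_Nat"
begin

section \<open>Complex Banach spaces\<close>

text \<open>Complex normed spaces are real normed spaces with a compatible complex scaling.\<close>

class complex_normed_vector = real_normed_vector +
  fixes scaleC :: "complex \<Rightarrow> 'a \<Rightarrow> 'a"  (infixr "*\<^sub>C" 75)
  assumes scaleC_add_right: "c *\<^sub>C (x + y) = c *\<^sub>C x + c *\<^sub>C y"
    and scaleC_add_left: "(c + d) *\<^sub>C x = c *\<^sub>C x + d *\<^sub>C x"
    and scaleC_scaleC: "c *\<^sub>C (d *\<^sub>C x) = (c * d) *\<^sub>C x"
    and scaleC_one: "1 *\<^sub>C x = x"
    and scaleR_scaleC: "r *\<^sub>R x = complex_of_real r *\<^sub>C x"
    and norm_scaleC: "norm (c *\<^sub>C x) = cmod c * norm x"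

class complex_banach = complex_normed_vector + banach

global_interpretation complex_vector: vector_space "scaleC :: complex \<Rightarrow> 'a \<Rightarrow> 'a::complex_normed_vector"
  defines csubspace = complex_vector.subspace
    and cspan = complex_vector.span
    and cdependent = complex_vector.dependent
    and cdim = complex_vector.dim
  by unfold_locales (simp_all add: scaleC_add_right scaleC_add_left scaleC_scaleC scaleC_one)

lemma bounded_linear_scaleC_right: "bounded_linear (\<lambda>x::'a::complex_normed_vector. c *\<^sub>C x)"
  by (rule bounded_linear_intro[where K = "cmod c"])
    (simp_all add: scaleC_add_right scaleR_scaleC scaleC_scaleC norm_scaleC mult.commute)

lemma scaleC_scaleR_commute: "c *\<^sub>C (r *\<^sub>R x) = r *\<^sub>R (c *\<^sub>C (x::'a::complex_normed_vector))"
  by (simp add: scaleR_scaleC scaleC_scaleC mult.commute)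

instantiation complex :: complex_banach
begin
definition scaleC_complex :: "complex \<Rightarrow> complex \<Rightarrow> complex" where "scaleC_complex = (*)"
instance
  by standard (simp_all add: scaleC_complex_def algebra_simps norm_mult scaleR_conv_of_real)
end


section \<open>Bounded complex-linear maps\<close>

text \<open>The space \<open>L(\<Y>, \<X>)\<close> is a subtype of the bounded real-linear maps and inherits its operator norm.\<close>

typedef (overloaded) ('a, 'b) cblinfun ("(_ \<Rightarrow>\<^sub>C\<^sub>L /_)" [22, 21] 21) =
  "{f :: 'a::complex_normed_vector \<Rightarrow>\<^sub>L 'b::complex_normed_vector.
      \<forall>c x. blinfun_apply f (c *\<^sub>C x) = c *\<^sub>C blinfun_apply f x}"
  morphisms blinfun_of_cblinfun Cblinfun
  by (rule exI[of _ 0]) simp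

setup_lifting type_definition_cblinfun

lift_definition cblinfun_apply :: "('a::complex_normed_vector \<Rightarrow>\<^sub>C\<^sub>L 'b::complex_normed_vector) \<Rightarrow> 'a \<Rightarrow> 'b"
  is blinfun_apply .

declare [[coercion cblinfun_apply]]

lemma cblinfun_eqI: "(\<And>x. cblinfun_apply f x = cblinfun_apply g x) \<Longrightarrow> f = g"
  by transfer (rule blinfun_eqI)

lemma cblinfun_apply_scaleC: "cblinfun_apply f (c *\<^sub>C x) = c *\<^sub>C cblinfun_apply f x"
  by transfer blast

lemma bounded_linear_cblinfun_apply: "bounded_linear (cblinfun_apply f)"
  by transfer (rule blinfun.bounded_linear_right)

lemma blinfun_apply_scaleC_Blinfun:
  fixes f :: "'a::complex_normed_vector \<Rightarrow>\<^sub>L 'b::complex_normed_vector"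
  shows "blinfun_apply (Blinfun (\<lambda>x. c *\<^sub>C blinfun_apply f x)) x = c *\<^sub>C blinfun_apply f x"
  by (subst bounded_linear_Blinfun_apply)
    (intro bounded_linear_compose[OF bounded_linear_scaleC_right] blinfun.bounded_linear_right refl)+

instantiation cblinfun :: (complex_normed_vector, complex_normed_vector) complex_normed_vector
begin

lift_definition norm_cblinfun :: "'a \<Rightarrow>\<^sub>C\<^sub>L 'b \<Rightarrow> real" is norm .

lift_definition minus_cblinfun :: "'a \<Rightarrow>\<^sub>C\<^sub>L 'b \<Rightarrow> 'a \<Rightarrow>\<^sub>C\<^sub>L 'b \<Rightarrow> 'a \<Rightarrow>\<^sub>C\<^sub>L 'b" is "(-)"
  by (simp add: blinfun.diff_left complex_vector.scale_right_diff_distrib)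

lift_definition plus_cblinfun :: "'a \<Rightarrow>\<^sub>C\<^sub>L 'b \<Rightarrow> 'a \<Rightarrow>\<^sub>C\<^sub>L 'b \<Rightarrow> 'a \<Rightarrow>\<^sub>C\<^sub>L 'b" is "(+)"
  by (simp add: blinfun.add_left scaleC_add_right)

lift_definition uminus_cblinfun :: "'a \<Rightarrow>\<^sub>C\<^sub>L 'b \<Rightarrow> 'a \<Rightarrow>\<^sub>C\<^sub>L 'b" is "uminus"
  by (simp add: blinfun.minus_left)

lift_definition zero_cblinfun :: "'a \<Rightarrow>\<^sub>C\<^sub>L 'b" is 0
  by simp

lift_definition scaleR_cblinfun :: "real \<Rightarrow> 'a \<Rightarrow>\<^sub>C\<^sub>L 'b \<Rightarrow> 'a \<Rightarrow>\<^sub>C\<^sub>L 'b" is "(*\<^sub>R)"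
  by (simp add: blinfun.scaleR_left scaleC_scaleR_commute)

lift_definition scaleC_cblinfun :: "complex \<Rightarrow> 'a \<Rightarrow>\<^sub>C\<^sub>L 'b \<Rightarrow> 'a \<Rightarrow>\<^sub>C\<^sub>L 'b"
  is "\<lambda>c f. Blinfun (\<lambda>x. c *\<^sub>C blinfun_apply f x)"
  by (simp add: blinfun_apply_scaleC_Blinfun scaleC_scaleC mult.commute)

definition sgn_cblinfun :: "'a \<Rightarrow>\<^sub>C\<^sub>L 'b \<Rightarrow> 'a \<Rightarrow>\<^sub>C\<^sub>L 'b"
  where "sgn_cblinfun f = inverse (norm f) *\<^sub>R f"

definition dist_cblinfun :: "'a \<Rightarrow>\<^sub>C\<^sub>L 'b \<Rightarrow> 'a \<Rightarrow>\<^sub>C\<^sub>L 'b \<Rightarrow> real"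
  where "dist_cblinfun f g = norm (f - g)"

definition [code del]:
  "(uniformity :: (('a \<Rightarrow>\<^sub>C\<^sub>L 'b) \<times> ('a \<Rightarrow>\<^sub>C\<^sub>L 'b)) filter) = (INF e\<in>{0 <..}. principal {(x, y). dist x y < e})"

definition open_cblinfun :: "('a \<Rightarrow>\<^sub>C\<^sub>L 'b) set \<Rightarrow> bool"
  where [code del]: "open_cblinfun S = (\<forall>x\<in>S. \<forall>\<^sub>F (x', y) in uniformity. x' = x \<longrightarrow> y \<in> S)"

lemma cblinfun_apply_plus: "cblinfun_apply (f + g) x = cblinfun_apply f x + cblinfun_apply g x"
  by transfer (rule blinfun.add_left)

lemma cblinfun_apply_minus: "cblinfun_apply (f - g) x = cblinfun_apply f x - cblinfun_apply g x"
  by transfer (rule blinfun.diff_left)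

lemma cblinfun_apply_zero: "cblinfun_apply 0 x = 0"
  by transfer simp

lemma cblinfun_apply_scaleR: "cblinfun_apply (r *\<^sub>R f) x = r *\<^sub>R cblinfun_apply f x"
  by transfer (rule blinfun.scaleR_left)

lemma scaleC_cblinfun_apply: "cblinfun_apply (c *\<^sub>C f) x = c *\<^sub>C cblinfun_apply f x"
  by transfer (rule blinfun_apply_scaleC_Blinfun)

lemma norm_cblinfun_le: "norm (cblinfun_apply f x) \<le> norm f * norm x"
  by transfer (rule norm_blinfun)

lemma norm_cblinfun_bound:
  "0 \<le> b \<Longrightarrow> (\<And>x. norm (cblinfun_apply f x) \<le> b * norm x) \<Longrightarrow> norm f \<le> b"
  by transfer (rule norm_blinfun_bound)

lemma norm_scaleC_cblinfun_le: "norm (c *\<^sub>C f) \<le> cmod c * norm (f :: 'a \<Rightarrow>\<^sub>C\<^sub>L 'b)"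
proof (rule norm_cblinfun_bound)
  have "0 \<le> norm f" by transfer simp
  then show "0 \<le> cmod c * norm f" by simp
  show "norm (cblinfun_apply (c *\<^sub>C f) x) \<le> cmod c * norm f * norm x" for x
    using mult_left_mono[OF norm_cblinfun_le norm_ge_zero]
    by (simp add: scaleC_cblinfun_apply norm_scaleC mult.assoc)
qed

instance
proof
  fix f g h :: "'a \<Rightarrow>\<^sub>C\<^sub>L 'b" and a b :: real and c d :: complex
  show "f + g + h = f + (g + h)" by transfer (simp add: add.assoc)
  show "0 + f = f" by transfer simp
  show "f + g = g + f" by transfer (simp add: add.commute)
  show "- f + f = 0" by transfer simp
  show "f - g = f + - g" by transfer simp
  show "a *\<^sub>R (f + g) = a *\<^sub>R f + a *\<^sub>R g" by transfer (simp add: scaleR_add_right)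
  show "(a + b) *\<^sub>R f = a *\<^sub>R f + b *\<^sub>R f" by transfer (simp add: scaleR_add_left)
  show "a *\<^sub>R b *\<^sub>R f = (a * b) *\<^sub>R f" by transfer simp
  show "1 *\<^sub>R f = f" by transfer simp
  show "dist f g = norm (f - g)" by (rule dist_cblinfun_def)
  show "sgn f = inverse (norm f) *\<^sub>R f" by (rule sgn_cblinfun_def)
  show "(uniformity :: (('a \<Rightarrow>\<^sub>C\<^sub>L 'b) \<times> ('a \<Rightarrow>\<^sub>C\<^sub>L 'b)) filter) = (INF e\<in>{0 <..}. principal {(x, y). dist x y < e})"
    by (rule uniformity_cblinfun_def)
  show "open S = (\<forall>x\<in>S. \<forall>\<^sub>F (x', y) in uniformity. x' = x \<longrightarrow> y \<in> S)" for S :: "('a \<Rightarrow>\<^sub>C\<^sub>L 'b) set"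
    by (rule open_cblinfun_def)
  show "(norm f = 0) = (f = 0)" by transfer simp
  show "norm (f + g) \<le> norm f + norm g" by transfer (rule norm_triangle_ineq)
  show "norm (a *\<^sub>R f) = \<bar>a\<bar> * norm f" by transfer simp
  show "c *\<^sub>C (f + g) = c *\<^sub>C f + c *\<^sub>C g"
    by (rule cblinfun_eqI) (simp add: scaleC_cblinfun_apply cblinfun_apply_plus scaleC_add_right)
  show "(c + d) *\<^sub>C f = c *\<^sub>C f + d *\<^sub>C f"
    by (rule cblinfun_eqI) (simp add: scaleC_cblinfun_apply cblinfun_apply_plus scaleC_add_left)
  show "c *\<^sub>C (d *\<^sub>C f) = (c * d) *\<^sub>C f"
    by (rule cblinfun_eqI) (simp add: scaleC_cblinfun_apply scaleC_scaleC)
  show one: "1 *\<^sub>C f = f" for f :: "'a \<Rightarrow>\<^sub>C\<^sub>L 'b"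
    by (rule cblinfun_eqI) (simp add: scaleC_cblinfun_apply scaleC_one)
  show "a *\<^sub>R f = complex_of_real a *\<^sub>C f"
    by (rule cblinfun_eqI) (simp add: scaleC_cblinfun_apply cblinfun_apply_scaleR scaleR_scaleC)
  show "norm (c *\<^sub>C f) = cmod c * norm f"
  proof (cases "c = 0")
    case True
    have "0 *\<^sub>C f = 0"
      by (rule cblinfun_eqI) (simp add: scaleC_cblinfun_apply cblinfun_apply_zero)
    moreover have "norm (0 :: 'a \<Rightarrow>\<^sub>C\<^sub>L 'b) = 0" by transfer simp
    ultimately show ?thesis using True by simp
  next
    case False
    have "inverse c *\<^sub>C (c *\<^sub>C f) = f"
      by (rule cblinfun_eqI) (simp add: scaleC_cblinfun_apply scaleC_scaleC scaleC_one False)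
    then have "norm f \<le> cmod (inverse c) * norm (c *\<^sub>C f)"
      using norm_scaleC_cblinfun_le[of "inverse c" "c *\<^sub>C f"] by simp
    then have "cmod c * norm f \<le> norm (c *\<^sub>C f)"
      using False by (simp add: norm_inverse norm_divide field_simps)
    then show ?thesis using norm_scaleC_cblinfun_le[of c f] by simp
  qed
qed

end

instance cblinfun :: (complex_normed_vector, complex_banach) complex_banach
proof
  fix X :: "nat \<Rightarrow> 'a \<Rightarrow>\<^sub>C\<^sub>L 'b"
  assume X: "Cauchy X"
  let ?Y = "\<lambda>n. blinfun_of_cblinfun (X n)"
  have dist_eq: "dist f g = dist (blinfun_of_cblinfun f) (blinfun_of_cblinfun g)"
    for f g :: "'a \<Rightarrow>\<^sub>C\<^sub>L 'b"
    unfolding dist_norm by (simp add: norm_cblinfun.rep_eq minus_cblinfun.rep_eq)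
  have "Cauchy ?Y"
    using X unfolding Cauchy_def dist_eq .
  then obtain L where L: "?Y \<longlonglongrightarrow> L"
    using Cauchy_convergent convergent_def by blast
  have lim: "(\<lambda>n. blinfun_apply (?Y n) x) \<longlonglongrightarrow> blinfun_apply L x" for x
    using L by (intro blinfun.tendsto) auto
  have "blinfun_apply L (c *\<^sub>C x) = c *\<^sub>C blinfun_apply L x" for c x
  proof (rule LIMSEQ_unique[OF lim])
    have "(\<lambda>n. c *\<^sub>C blinfun_apply (?Y n) x) \<longlonglongrightarrow> c *\<^sub>C blinfun_apply L x"
      by (rule bounded_linear.tendsto[OF bounded_linear_scaleC_right lim])
    then show "(\<lambda>n. blinfun_apply (?Y n) (c *\<^sub>C x)) \<longlonglongrightarrow> c *\<^sub>C blinfun_apply L x"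
      by (simp add: cblinfun_apply_scaleC flip: cblinfun_apply.rep_eq)
  qed
  then have "blinfun_of_cblinfun (Cblinfun L) = L"
    by (simp add: Cblinfun_inverse)
  then have "X \<longlonglongrightarrow> Cblinfun L"
    using L unfolding lim_sequentially dist_eq by simp
  then show "convergent X" by (auto simp: convergent_def)
qed

lift_definition cblinfun_id :: "'a::complex_normed_vector \<Rightarrow>\<^sub>C\<^sub>L 'a" is id_blinfun
  by simp

lift_definition cblinfun_compose ::
  "('b::complex_normed_vector \<Rightarrow>\<^sub>C\<^sub>L 'c::complex_normed_vector) \<Rightarrow>
    ('a::complex_normed_vector \<Rightarrow>\<^sub>C\<^sub>L 'b) \<Rightarrow> 'a \<Rightarrow>\<^sub>C\<^sub>L 'c"  (infixl "o\<^sub>C\<^sub>L" 55)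
  is "(o\<^sub>L)"
  by simp

lemma cblinfun_apply_compose: "cblinfun_apply (f o\<^sub>C\<^sub>L g) x = cblinfun_apply f (cblinfun_apply g x)"
  by transfer simp

lemma norm_cblinfun_compose: "norm (f o\<^sub>C\<^sub>L g) \<le> norm f * norm g"
  by transfer (rule norm_blinfun_compose)

lemma cblinfun_of_bounded:
  fixes F :: "'a::complex_normed_vector \<Rightarrow> 'b::complex_normed_vector"
  assumes "\<And>x y. F (x + y) = F x + F y" and "\<And>c x. F (c *\<^sub>C x) = c *\<^sub>C F x"
    and "\<And>x. norm (F x) \<le> norm x * K"
  shows "cblinfun_apply (Cblinfun (Blinfun F)) x = F x"
proof -
  have "bounded_linear F"
    using assms by (intro bounded_linear_intro[where K = K]) (auto simp: scaleR_scaleC)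
  then show ?thesis
    using assms(2) by (simp add: cblinfun_apply.rep_eq Cblinfun_inverse bounded_linear_Blinfun_apply)
qed

definition adjoint_op ::
  "('a::complex_normed_vector \<Rightarrow>\<^sub>C\<^sub>L 'b::complex_normed_vector) \<Rightarrow> ('b \<Rightarrow>\<^sub>C\<^sub>L complex) \<Rightarrow>\<^sub>C\<^sub>L ('a \<Rightarrow>\<^sub>C\<^sub>L complex)"
  where "adjoint_op B = Cblinfun (Blinfun (\<lambda>f. f o\<^sub>C\<^sub>L B))"

lemma adjoint_op_apply: "adjoint_op B f = f o\<^sub>C\<^sub>L B"
  unfolding adjoint_op_def
  by (rule cblinfun_of_bounded[where K = "norm B"])
    (auto intro!: cblinfun_eqI norm_cblinfun_compose
      simp: cblinfun_apply_compose cblinfun_apply_plus scaleC_cblinfun_apply)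

definition gen_derivation ::
  "('x::complex_normed_vector \<Rightarrow>\<^sub>C\<^sub>L 'x) \<Rightarrow> ('y::complex_normed_vector \<Rightarrow>\<^sub>C\<^sub>L 'y) \<Rightarrow>
    ('y \<Rightarrow>\<^sub>C\<^sub>L 'x) \<Rightarrow>\<^sub>C\<^sub>L ('y \<Rightarrow>\<^sub>C\<^sub>L 'x)"
  where "gen_derivation A B = Cblinfun (Blinfun (\<lambda>U. (A o\<^sub>C\<^sub>L U) - (U o\<^sub>C\<^sub>L B)))"

lemma gen_derivation_apply: "gen_derivation A B U = (A o\<^sub>C\<^sub>L U) - (U o\<^sub>C\<^sub>L B)"
  unfolding gen_derivation_def
proof (rule cblinfun_of_bounded[where K = "norm A + norm B"])
  fix U :: "'a \<Rightarrow>\<^sub>C\<^sub>L 'b"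
  have "norm ((A o\<^sub>C\<^sub>L U) - (U o\<^sub>C\<^sub>L B)) \<le> norm A * norm U + norm U * norm B"
    by (rule order_trans[OF norm_triangle_ineq4 add_mono]) (rule norm_cblinfun_compose)+
  then show "norm ((A o\<^sub>C\<^sub>L U) - (U o\<^sub>C\<^sub>L B)) \<le> norm U * (norm A + norm B)"
    by (simp add: algebra_simps)
qed (auto intro!: cblinfun_eqI
    simp: cblinfun_apply_compose cblinfun_apply_plus cblinfun_apply_minus scaleC_cblinfun_apply
      cblinfun_apply_scaleC complex_vector.scale_right_diff_distrib
      linear_add[OF bounded_linear.linear[OF bounded_linear_cblinfun_apply]])


section \<open>Dimension and codimension\<close>

definition cfinite_dim :: "'a::complex_normed_vector set \<Rightarrow> bool"
  where "cfinite_dim S \<longleftrightarrow> (\<exists>B. finite B \<and> S \<subseteq> cspan B)"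

definition ecdim :: "'a::complex_normed_vector set \<Rightarrow> enat"
  where "ecdim S = (if cfinite_dim S then enat (cdim S) else \<infinity>)"

text \<open>
  The codimension of \<open>N\<close> in \<open>M\<close> is the dimension of the quotient \<open>M/N\<close>, i.e. the least number of
  vectors of \<open>M\<close> that span \<open>M\<close> modulo \<open>N\<close> (and \<open>\<infinity>\<close>, the infimum of the empty set, if no finite
  number of vectors does).
\<close>

definition ecodim :: "'a::complex_normed_vector set \<Rightarrow> 'a set \<Rightarrow> enat"
  where "ecodim N M = Inf {enat (card B) | B. finite B \<and> B \<subseteq> M \<and> M \<subseteq> cspan (N \<union> B)}"

lemma ecodim_eq_ecdim_complement:
  assumes N: "csubspace N" and W: "csubspace W" and NW: "N \<inter> W = {0}"
    and M: "M = {n + w | n w. n \<in> N \<and> w \<in> W}"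
  shows "ecodim N M = ecdim W"
proof (rule antisym)
  have "W \<subseteq> M"
  proof
    fix w assume "w \<in> W"
    then show "w \<in> M"
      unfolding M using complex_vector.subspace_0[OF N]
      by (intro CollectI exI[of _ 0] exI[of _ w]) simp
  qed
  show "ecodim N M \<le> ecdim W"
  proof (cases "cfinite_dim W")
    case True
    then obtain C where "finite C" "W \<subseteq> cspan C" unfolding cfinite_dim_def by blast
    obtain B where B: "B \<subseteq> W" "\<not> cdependent B" "W \<subseteq> cspan B" "card B = cdim W"
      by (rule complex_vector.basis_exists)
    have "finite B"
      using complex_vector.independent_span_bound[OF \<open>finite C\<close> B(2)] B(1) \<open>W \<subseteq> cspan C\<close> by blast
    have "M \<subseteq> cspan (N \<union> B)"
    proof
      fix x assume "x \<in> M"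
      then obtain n w where "x = n + w" "n \<in> N" "w \<in> W" unfolding M by blast
      moreover have "w \<in> cspan (N \<union> B)"
        using B(3) \<open>w \<in> W\<close> complex_vector.span_mono[of B "N \<union> B"] by blast
      ultimately show "x \<in> cspan (N \<union> B)"
        by (simp add: complex_vector.span_add complex_vector.span_base)
    qed
    then have "ecodim N M \<le> enat (card B)"
      unfolding ecodim_def using \<open>finite B\<close> B(1) \<open>W \<subseteq> M\<close> by (intro Inf_lower) blast
    then show ?thesis using True B(4) by (simp add: ecdim_def)
  qed (simp add: ecdim_def)
next
  have "W \<subseteq> M"
  proof
    fix w assume "w \<in> W"
    then show "w \<in> M"
      unfolding M using complex_vector.subspace_0[OF N]
      by (intro CollectI exI[of _ 0] exI[of _ w]) simp
  qed
  show "ecdim W \<le> ecodim N M"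
    unfolding ecodim_def
  proof (rule Inf_greatest, clarify)
    fix B assume B: "finite B" "B \<subseteq> M" "M \<subseteq> cspan (N \<union> B)"
    have "\<forall>b\<in>B. \<exists>w\<in>W. b - w \<in> N"
    proof
      fix b assume "b \<in> B"
      then obtain n w where "b = n + w" "n \<in> N" "w \<in> W" using B(2) unfolding M by blast
      then show "\<exists>w\<in>W. b - w \<in> N" by (intro bexI[of _ w]) simp_all
    qed
    then obtain p where p: "\<And>b. b \<in> B \<Longrightarrow> p b \<in> W \<and> b - p b \<in> N" by metis
    have "csubspace {n + v | n v. n \<in> N \<and> v \<in> cspan (p ` B)}"
      by (rule complex_vector.subspace_sums[OF N complex_vector.subspace_span])
    moreover have "N \<union> B \<subseteq> {n + v | n v. n \<in> N \<and> v \<in> cspan (p ` B)}"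
    proof
      fix x assume "x \<in> N \<union> B"
      then show "x \<in> {n + v | n v. n \<in> N \<and> v \<in> cspan (p ` B)}"
      proof
        assume "x \<in> N"
        then show ?thesis
          by (intro CollectI exI[of _ x] exI[of _ 0]) (simp add: complex_vector.span_zero)
      next
        assume "x \<in> B"
        then have "x - p x \<in> N" "p x \<in> cspan (p ` B)"
          using p by (simp_all add: complex_vector.span_base)
        then show ?thesis by (intro CollectI exI[of _ "x - p x"] exI[of _ "p x"]) simp
      qed
    qed
    ultimately have *: "cspan (N \<union> B) \<subseteq> {n + v | n v. n \<in> N \<and> v \<in> cspan (p ` B)}"
      using complex_vector.span_minimal by blast
    have sub: "W \<subseteq> cspan (p ` B)"
    proof
      fix w assume "w \<in> W"
      then obtain n v where w: "w = n + v" "n \<in> N" "v \<in> cspan (p ` B)"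
        using subsetD[OF *] subsetD[OF B(3)] subsetD[OF \<open>W \<subseteq> M\<close>] by blast
      have "cspan (p ` B) \<subseteq> W"
        using p W by (intro complex_vector.span_minimal) auto
      then have "n \<in> W"
        using complex_vector.subspace_diff[OF W \<open>w \<in> W\<close>, of v] w(3) unfolding w(1) by auto
      then have "n = 0" using NW w(2) by blast
      then show "w \<in> cspan (p ` B)" using w by simp
    qed
    have "cdim W \<le> card (p ` B)"
      using complex_vector.dim_le_card[OF sub] B(1) by simp
    also have "\<dots> \<le> card B" by (rule card_image_le[OF B(1)])
    finally have "cdim W \<le> card B" .
    moreover have "cfinite_dim W"
      unfolding cfinite_dim_def using sub B(1) by blast
    ultimately show "ecdim W \<le> enat (card B)"
      by (simp add: ecdim_def)
  qed
qed


section \<open>Fredholm-type classes of operators\<close>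

definition null_space :: "('a::complex_normed_vector \<Rightarrow> 'b::complex_normed_vector) \<Rightarrow> 'a set"
  where "null_space T = {x. T x = 0}"

definition bounded_below :: "('a::complex_banach \<Rightarrow>\<^sub>C\<^sub>L 'a) \<Rightarrow> bool"
  where "bounded_below T \<longleftrightarrow> null_space T = {0} \<and> closed (range T)"

text \<open>
  The following two notions concern the restriction of \<open>T\<close> to a closed \<open>T\<close>-invariant subspace \<open>M\<close>,
  regarded as an operator on the Banach space \<open>M\<close>; as \<open>M\<close> is closed, a subset of \<open>M\<close> is closed in
  \<open>M\<close> iff it is closed.
\<close>

definition upper_semi_fredholm_on :: "'a::complex_banach set \<Rightarrow> ('a \<Rightarrow>\<^sub>C\<^sub>L 'a) \<Rightarrow> bool"
  where "upper_semi_fredholm_on M T \<longleftrightarrow> closed (T ` M) \<and> ecdim (null_space T \<inter> M) < \<infinity>"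

definition index_on :: "'a::complex_banach set \<Rightarrow> ('a \<Rightarrow>\<^sub>C\<^sub>L 'a) \<Rightarrow> ereal"
  where "index_on M T = ereal_of_enat (ecdim (null_space T \<inter> M)) - ereal_of_enat (ecodim (T ` M) M)"

abbreviation upper_semi_fredholm :: "('a::complex_banach \<Rightarrow>\<^sub>C\<^sub>L 'a) \<Rightarrow> bool"
  where "upper_semi_fredholm T \<equiv> upper_semi_fredholm_on UNIV T"

abbreviation fredholm_index :: "('a::complex_banach \<Rightarrow>\<^sub>C\<^sub>L 'a) \<Rightarrow> ereal"
  where "fredholm_index T \<equiv> index_on UNIV T"

definition range_power :: "('a::complex_banach \<Rightarrow>\<^sub>C\<^sub>L 'a) \<Rightarrow> nat \<Rightarrow> 'a set"
  where "range_power T n = range (cblinfun_apply T ^^ n)"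

definition upper_semi_b_fredholm_at :: "('a::complex_banach \<Rightarrow>\<^sub>C\<^sub>L 'a) \<Rightarrow> nat \<Rightarrow> bool"
  where "upper_semi_b_fredholm_at T n \<longleftrightarrow>
    closed (range_power T n) \<and> upper_semi_fredholm_on (range_power T n) T"

definition upper_semi_b_fredholm :: "('a::complex_banach \<Rightarrow>\<^sub>C\<^sub>L 'a) \<Rightarrow> bool"
  where "upper_semi_b_fredholm T \<longleftrightarrow> (\<exists>n. upper_semi_b_fredholm_at T n)"

text \<open>
  The index of an upper semi B-Fredholm operator does not depend on the chosen \<open>n\<close>; the least one
  is used.
\<close>

definition b_fredholm_index :: "('a::complex_banach \<Rightarrow>\<^sub>C\<^sub>L 'a) \<Rightarrow> ereal"
  where "b_fredholm_index T = index_on (range_power T (LEAST n. upper_semi_b_fredholm_at T n)) T"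

definition ascent :: "('a::complex_banach \<Rightarrow>\<^sub>C\<^sub>L 'a) \<Rightarrow> enat"
  where "ascent T =
    Inf {enat a | a. null_space (cblinfun_apply T ^^ a) = null_space (cblinfun_apply T ^^ Suc a)}"


section \<open>Spectra\<close>

definition acc :: "complex set \<Rightarrow> complex set"
  where "acc K = {z. z islimpt K}"

definition iso :: "complex set \<Rightarrow> complex set"
  where "iso K = K - acc K"

definition set_diff :: "complex set \<Rightarrow> complex set \<Rightarrow> complex set"  (infixl "\<ominus>" 65)
  where "S \<ominus> T = {s - t | s t. s \<in> S \<and> t \<in> T}"

abbreviation shift :: "('a::complex_banach \<Rightarrow>\<^sub>C\<^sub>L 'a) \<Rightarrow> complex \<Rightarrow> 'a \<Rightarrow>\<^sub>C\<^sub>L 'a"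
  where "shift T z \<equiv> T - z *\<^sub>C cblinfun_id"

definition sigma_a :: "('a::complex_banach \<Rightarrow>\<^sub>C\<^sub>L 'a) \<Rightarrow> complex set"
  where "sigma_a T = {z. \<not> bounded_below (shift T z)}"

definition Phi_plus :: "('a::complex_banach \<Rightarrow>\<^sub>C\<^sub>L 'a) \<Rightarrow> complex set"
  where "Phi_plus T = {z. upper_semi_fredholm (shift T z)}"

definition sigma_aw :: "('a::complex_banach \<Rightarrow>\<^sub>C\<^sub>L 'a) \<Rightarrow> complex set"
  where "sigma_aw T = {z\<in>sigma_a T.
    \<not> upper_semi_fredholm (shift T z) \<or> 0 < fredholm_index (shift T z)}"

definition sigma_SBF :: "('a::complex_banach \<Rightarrow>\<^sub>C\<^sub>L 'a) \<Rightarrow> complex set"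
  where "sigma_SBF T = {z.
    \<not> upper_semi_b_fredholm (shift T z) \<or> 0 < b_fredholm_index (shift T z)}"

definition left_poles :: "('a::complex_banach \<Rightarrow>\<^sub>C\<^sub>L 'a) \<Rightarrow> complex set"
  where "left_poles T = {z\<in>iso (sigma_a T).
    \<exists>a. ascent (shift T z) = enat a \<and> closed (range_power (shift T z) (a + 1))}"

definition left_poles_finite :: "('a::complex_banach \<Rightarrow>\<^sub>C\<^sub>L 'a) \<Rightarrow> complex set"
  where "left_poles_finite T = {z\<in>left_poles T. ecdim (null_space (shift T z)) < \<infinity>}"

definition a_browder :: "('a::complex_banach \<Rightarrow>\<^sub>C\<^sub>L 'a) \<Rightarrow> bool"
  where "a_browder T \<longleftrightarrow> sigma_aw T = sigma_a T - left_poles_finite T"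

definition generalized_a_browder :: "('a::complex_banach \<Rightarrow>\<^sub>C\<^sub>L 'a) \<Rightarrow> bool"
  where "generalized_a_browder T \<longleftrightarrow> sigma_SBF T = sigma_a T - left_poles T"


section \<open>The single-valued extension property\<close>

text \<open>Analyticity on an open set is complex differentiability there.\<close>

definition vector_analytic_on :: "(complex \<Rightarrow> 'a::complex_banach) \<Rightarrow> complex set \<Rightarrow> bool"
  where "vector_analytic_on f D \<longleftrightarrow>
    (\<forall>z\<in>D. \<exists>d. (f has_derivative (\<lambda>h. h *\<^sub>C d)) (at z))"

definition svep_at :: "('a::complex_banach \<Rightarrow>\<^sub>C\<^sub>L 'a) \<Rightarrow> complex \<Rightarrow> bool"
  where "svep_at T z0 \<longleftrightarrow>
    (\<forall>r>0. \<forall>f. vector_analytic_on f (ball z0 r) \<and> (\<forall>z\<in>ball z0 r. shift T z (f z) = 0)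
      \<longrightarrow> (\<forall>z\<in>ball z0 r. f z = 0))"

end

theory Submission
  imports Defs "HOL-Complex_Analysis.Complex_Analysis"
begin

text \<open>
  Upper semi-Fredholm operators are characterised by an a priori estimate up to finitely many bounded
  functionals. For an operator \<open>T\<close>, a Kato-type dichotomy then says that at a point where \<open>T - z\<close> is
  upper semi B-Fredholm, either \<open>z\<close> is no accumulation point of the approximate point spectrum and
  \<open>T - z\<close> has finite ascent, or a whole disc around \<open>z\<close> consists of eigenvalues with an analytic choice
  of eigenvectors. Together with the stability of a nonpositive index this reduces both forms of
  a-Browder's theorem to the inclusion of the accumulation points of \<open>\<sigma>\<^sub>a(T)\<close> in the respective Weyl-type
  spectrum.

  For the generalized derivation \<open>\<rho>\<close>, the a priori estimates of \<open>A - \<mu>\<close> and \<open>B\<^sup>* - \<nu>\<close> combine to joint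
  estimates for the commuting operators \<open>U \<mapsto> (A - \<mu>)U\<close> and \<open>\<rho> - (\<mu> - \<nu>)\<close>. A Liouville argument for
  seminorms on polynomials removes the first operator once such an estimate holds for all \<open>\<mu>\<close>, while
  rank one operators yield the converse. Hence \<open>\<sigma>\<^sub>a(\<rho>) = \<sigma>\<^sub>a(A) - \<sigma>\<^sub>a(B\<^sup>*)\<close>, and likewise for the
  upper semi-Fredholm points.
\<close>

text \<open>The index of \<open>gen_derivation A B\<close> is never computed. At a semi-Fredholm
  point that is no accumulation point of the approximate point spectrum, the null space meets some
  iterated range trivially, which already forces a nonpositive index; so only semi-Fredholmness and
  accumulation points have to be followed through the difference of the two spectra. The obstacle is
  the inclusion of the spectrum of the derivation in that difference: for fixed l the pairs (\<mu>,
  \<mu> - l) run over all \<mu>, and what is at hand is one joint estimate for each \<mu>. Were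
  there no estimate for \<open>shift (gen_derivation A B) l\<close> alone, left multiplication by
  \<open>A\<close> would act on its singular sequences with empty approximate point spectrum. Such
  sequences form a Banach space only after passing to a quotient of a sequence space; the
  contradiction is drawn from a seminorm on polynomials instead.\<close>

section \<open>The Hahn-Banach theorem\<close>

text \<open>
  A dominated real-linear functional is represented by its graph; domination makes a subspace of
  \<open>V \<times> \<real>\<close> single-valued, so Zorn's lemma applies to such subspaces ordered by inclusion.
\<close>

definition dominated_graph ::
  "(complex \<Rightarrow> 'v::ab_group_add \<Rightarrow> 'v) \<Rightarrow> ('v \<Rightarrow> real) \<Rightarrow> ('v \<times> real) set \<Rightarrow> bool"
  where "dominated_graph s p G \<longleftrightarrow>
    (\<forall>x a y b. (x, a) \<in> G \<longrightarrow> (y, b) \<in> G \<longrightarrow> (x + y, a + b) \<in> G) \<and>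
    (\<forall>x a t. (x, a) \<in> G \<longrightarrow> (s (complex_of_real t) x, t * a) \<in> G) \<and>
    (\<forall>x a. (x, a) \<in> G \<longrightarrow> a \<le> p x) \<and> (0, 0) \<in> G"

text \<open>Scalar multiplication is a parameter because the Hahn-Banach theorem is needed for
  \<open>scaleC\<close> on normed spaces as well as for \<open>smult\<close> on complex
  polynomials.\<close>

locale complex_seminorm = vector_space s
  for s :: "complex \<Rightarrow> 'v::ab_group_add \<Rightarrow> 'v" +
  fixes p :: "'v \<Rightarrow> real"
  assumes p_add: "p (x + y) \<le> p x + p y"
    and p_scale: "p (s c x) = cmod c * p x"
begin

lemma p_zero: "p 0 = 0"
  using p_scale[of 0 0] by simp

lemma p_minus: "p (- x) = p x"
  using p_scale[of "-1" x] by simp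

lemma p_nonneg: "0 \<le> p x"
  using p_add[of x "- x"] by (simp add: p_zero p_minus)

lemma p_diff: "p (x - y) \<le> p x + p y"
  using p_add[of x "- y"] by (simp add: p_minus)

lemma p_minus_commute: "p (x - y) = p (y - x)"
  using p_minus[of "x - y"] by simp

lemma dominated_graphD:
  assumes "dominated_graph s p G"
  shows "(x, a) \<in> G \<Longrightarrow> (y, b) \<in> G \<Longrightarrow> (x + y, a + b) \<in> G"
    and "(x, a) \<in> G \<Longrightarrow> (s (complex_of_real t) x, t * a) \<in> G"
    and "(x, a) \<in> G \<Longrightarrow> a \<le> p x"
    and "(0, 0) \<in> G"
  using assms unfolding dominated_graph_def by blast+

lemma dominated_graph_unique:
  assumes G: "dominated_graph s p G" and a: "(x, a) \<in> G" and b: "(x, b) \<in> G"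
  shows "a = b"
proof (rule ccontr)
  assume "a \<noteq> b"
  have "(s (complex_of_real (-1)) x, (-1) * b) \<in> G"
    by (rule dominated_graphD(2)[OF G b])
  then have "(x + s (complex_of_real (-1)) x, a + (-1) * b) \<in> G"
    by (rule dominated_graphD(1)[OF G a])
  then have "(0, a - b) \<in> G" by simp
  from dominated_graphD(2)[OF G this, of "1 / (a - b)"] \<open>a \<noteq> b\<close>
  have "(0, 1) \<in> G" by simp
  from dominated_graphD(3)[OF G this] show False by (simp add: p_zero)
qed

text \<open>By \<open>key\<close>, every lower bound \<open>a - p (y - x)\<close> for a value at
  \<open>x\<close> lies below every upper bound \<open>p (y + x) - a\<close>, so there is a value
  between them. Positive homogeneity reduces domination along the new line to the coefficients 1 and
  -1.\<close>

lemma dominated_graph_extend: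
  assumes G: "dominated_graph s p G"
  shows "\<exists>G' c. dominated_graph s p G' \<and> G \<subseteq> G' \<and> (x, c) \<in> G'"
proof -
  have key: "a - p (y - x) \<le> p (y' + x) - a'" if "(y, a) \<in> G" "(y', a') \<in> G" for y a y' a'
  proof -
    have "a + a' \<le> p (y + y')"
      using dominated_graphD(1,3)[OF G] that by blast
    also have "\<dots> = p ((y - x) + (y' + x))" by (simp add: algebra_simps)
    also have "\<dots> \<le> p (y - x) + p (y' + x)" by (rule p_add)
    finally show ?thesis by simp
  qed
  define c where "c = Sup {a - p (y - x) | y a. (y, a) \<in> G}"
  have ne: "{a - p (y - x) | y a. (y, a) \<in> G} \<noteq> {}"
    using dominated_graphD(4)[OF G] by blast
  have bdd: "bdd_above {a - p (y - x) | y a. (y, a) \<in> G}"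
    using key[OF _ dominated_graphD(4)[OF G]] by (intro bdd_aboveI[of _ "p (0 + x) - 0"]) blast
  have c1: "a - p (y - x) \<le> c" if "(y, a) \<in> G" for y a
    unfolding c_def using that by (intro cSup_upper bdd) blast
  have c2: "c \<le> p (y + x) - a" if "(y, a) \<in> G" for y a
    unfolding c_def using key[OF _ that] by (intro cSup_least ne) blast
  define G' where "G' = {(y + s (complex_of_real t) x, a + t * c) | y a t. (y, a) \<in> G}"
  have dom: "a + t * c \<le> p (y + s (complex_of_real t) x)" if ya: "(y, a) \<in> G" for y a t
  proof (cases t "0 :: real" rule: linorder_cases)
    case equal
    then show ?thesis using dominated_graphD(3)[OF G ya] by simp
  next
    case greater
    have "c \<le> p (s (complex_of_real (1/t)) y + x) - 1/t * a"
      by (rule c2[OF dominated_graphD(2)[OF G ya]])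
    then have "t * c \<le> t * (p (s (complex_of_real (1/t)) y + x) - 1/t * a)"
      using greater by (intro mult_left_mono) auto
    also have "\<dots> = cmod (complex_of_real t) * p (s (complex_of_real (1/t)) y + x) - a"
      using greater by (simp add: right_diff_distrib)
    also have "cmod (complex_of_real t) * p (s (complex_of_real (1/t)) y + x)
      = p (y + s (complex_of_real t) x)"
      unfolding p_scale[symmetric] using greater by (simp add: scale_right_distrib flip: of_real_mult)
    finally show ?thesis by simp
  next
    case less
    have "1/(-t) * a - p (s (complex_of_real (1/(-t))) y - x) \<le> c"
      by (rule c1[OF dominated_graphD(2)[OF G ya]])
    then have "(-t) * (1/(-t) * a - p (s (complex_of_real (1/(-t))) y - x)) \<le> (-t) * c"
      using less by (intro mult_left_mono) auto
    moreover have "(-t) * (1/(-t) * a - p (s (complex_of_real (1/(-t))) y - x))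
      = a - cmod (complex_of_real (-t)) * p (s (complex_of_real (1/(-t))) y - x)"
      using less by (simp add: right_diff_distrib)
    moreover have "cmod (complex_of_real (-t)) * p (s (complex_of_real (1/(-t))) y - x)
      = p (y + s (complex_of_real t) x)"
      unfolding p_scale[symmetric] using less by (simp add: scale_right_diff_distrib)
    ultimately show ?thesis by simp
  qed
  have "dominated_graph s p G'"
    unfolding dominated_graph_def
  proof (intro conjI allI impI)
    fix y a z b assume "(y, a) \<in> G'" "(z, b) \<in> G'"
    then obtain y' a' t z' b' u where *: "y = y' + s (complex_of_real t) x" "a = a' + t * c"
      "(y', a') \<in> G" "z = z' + s (complex_of_real u) x" "b = b' + u * c" "(z', b') \<in> G"
      unfolding G'_def by auto
    then show "(y + z, a + b) \<in> G'"
      unfolding G'_def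
      by (intro CollectI exI[of _ "y' + z'"] exI[of _ "a' + b'"] exI[of _ "t + u"])
        (auto simp: dominated_graphD(1)[OF G] scale_left_distrib distrib_right)
  next
    fix y a r assume "(y, a) \<in> G'"
    then obtain y' a' t where *: "y = y' + s (complex_of_real t) x" "a = a' + t * c" "(y', a') \<in> G"
      unfolding G'_def by auto
    then show "(s (complex_of_real r) y, r * a) \<in> G'"
      unfolding G'_def
      by (intro CollectI exI[of _ "s (complex_of_real r) y'"] exI[of _ "r * a'"] exI[of _ "r * t"])
        (auto simp: dominated_graphD(2)[OF G] scale_right_distrib distrib_left mult.assoc)
  next
    fix y a assume "(y, a) \<in> G'"
    then show "a \<le> p y" unfolding G'_def using dom by auto
  next
    show "(0, 0) \<in> G'"
      unfolding G'_def using dominated_graphD(4)[OF G]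
      by (intro CollectI exI[of _ 0]) auto
  qed
  moreover have "G \<subseteq> G'"
  proof (clarify)
    fix y a assume "(y, a) \<in> G"
    then show "(y, a) \<in> G'"
      unfolding G'_def by (intro CollectI exI[of _ y] exI[of _ a] exI[of _ 0]) auto
  qed
  moreover have "(x, c) \<in> G'"
    unfolding G'_def using dominated_graphD(4)[OF G]
    by (intro CollectI exI[of _ 0] exI[of _ 0] exI[of _ 1]) auto
  ultimately show ?thesis by blast
qed

lemma dominated_graph_total:
  assumes G0: "dominated_graph s p G0"
  shows "\<exists>G. dominated_graph s p G \<and> G0 \<subseteq> G \<and> (\<forall>x. \<exists>a. (x, a) \<in> G)"
proof -
  define \<F> where "\<F> = {G. dominated_graph s p G \<and> G0 \<subseteq> G}"
  have "\<exists>M\<in>\<F>. \<forall>X\<in>\<F>. M \<subseteq> X \<longrightarrow> X = M"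
  proof (rule subset_Zorn_nonempty)
    show "\<F> \<noteq> {}" using G0 unfolding \<F>_def by blast
    fix C assume ne: "C \<noteq> {}" and C: "subset.chain \<F> C"
    have dg: "dominated_graph s p G" "G0 \<subseteq> G" if "G \<in> C" for G
      using C that unfolding subset_chain_def \<F>_def by blast+
    have "dominated_graph s p (\<Union>C)"
      unfolding dominated_graph_def
    proof (intro conjI allI impI)
      fix x a y b assume "(x, a) \<in> \<Union>C" "(y, b) \<in> \<Union>C"
      then obtain G H where GH: "G \<in> C" "H \<in> C" "(x, a) \<in> G" "(y, b) \<in> H" by blast
      then have "G \<subseteq> H \<or> H \<subseteq> G" using C unfolding subset_chain_def by blast
      then show "(x + y, a + b) \<in> \<Union>C"
        using GH dominated_graphD(1)[OF dg(1)] by blast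
    next
      fix x a t assume "(x, a) \<in> \<Union>C"
      then show "(s (complex_of_real t) x, t * a) \<in> \<Union>C"
        using dominated_graphD(2)[OF dg(1)] by blast
    next
      fix x a assume "(x, a) \<in> \<Union>C"
      then show "a \<le> p x" using dominated_graphD(3)[OF dg(1)] by blast
    next
      show "(0, 0) \<in> \<Union>C" using ne dominated_graphD(4)[OF dg(1)] by blast
    qed
    moreover have "G0 \<subseteq> \<Union>C"
      using ne dg(2) by (meson Union_upper all_not_in_conv subset_trans)
    ultimately show "\<Union>C \<in> \<F>" by (simp add: \<F>_def)
  qed
  then obtain M where M\<F>: "M \<in> \<F>" and maxM: "\<forall>X\<in>\<F>. M \<subseteq> X \<longrightarrow> X = M"
    by (rule bexE)
  have M: "dominated_graph s p M" "G0 \<subseteq> M"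
    using M\<F> by (simp_all add: \<F>_def)
  have "\<exists>a. (x, a) \<in> M" for x
  proof -
    obtain G' c where G': "dominated_graph s p G'" "M \<subseteq> G'" "(x, c) \<in> G'"
      using dominated_graph_extend[OF M(1), of x] by (elim exE conjE)
    then have "G' \<in> \<F>" using M(2) by (auto simp: \<F>_def)
    then show ?thesis using maxM G'(2,3) by auto
  qed
  then show ?thesis using M by blast
qed

theorem hahn_banach:
  assumes M: "subspace M"
    and add: "\<And>x y. x \<in> M \<Longrightarrow> y \<in> M \<Longrightarrow> f (x + y) = f x + f y"
    and scale: "\<And>c x. x \<in> M \<Longrightarrow> f (s c x) = c * f x"
    and dom: "\<And>x. x \<in> M \<Longrightarrow> cmod (f x) \<le> p x"
  obtains g where "\<And>x y. g (x + y) = g x + g y" "\<And>c x. g (s c x) = c * g x"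
    "\<And>x. x \<in> M \<Longrightarrow> g x = f x" "\<And>x. cmod (g x) \<le> p x"
proof -
  define G0 where "G0 = {(x, Re (f x)) | x. x \<in> M}"
  have f0: "f 0 = 0" using scale[OF subspace_0[OF M], of 0] by simp
  have "dominated_graph s p G0"
    unfolding dominated_graph_def G0_def
    using subspace_add[OF M] subspace_scale[OF M] subspace_0[OF M]
    by (auto simp: add scale f0 intro: order_trans[OF complex_Re_le_cmod dom])
  from dominated_graph_total[OF this] obtain G where G: "dominated_graph s p G" "G0 \<subseteq> G"
    and tot: "\<And>x. \<exists>a. (x, a) \<in> G" by blast
  from tot obtain h where h: "\<And>x. (x, h x) \<in> G" by metis
  have hI: "h x = a" if "(x, a) \<in> G" for x a
    by (rule dominated_graph_unique[OF G(1) h that])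
  have h_add: "h (x + y) = h x + h y" for x y
    by (rule hI[OF dominated_graphD(1)[OF G(1) h h]])
  have h_scale: "h (s (complex_of_real t) x) = t * h x" for t x
    by (rule hI[OF dominated_graphD(2)[OF G(1) h]])
  have h_minus: "h (- x) = - h x" for x
    using h_scale[of "-1" x] by simp
  have h_M: "h x = Re (f x)" if "x \<in> M" for x
    using G(2) that by (intro hI) (auto simp: G0_def)
  \<comment> \<open>A complex-linear functional with real part \<open>h\<close> must have the
    negative of \<open>h\<close> at i x as imaginary part.\<close>
  define g where "g x = complex_of_real (h x) - \<i> * complex_of_real (h (s \<i> x))" for x
  have g_add: "g (x + y) = g x + g y" for x y
    by (simp add: g_def h_add scale_right_distrib algebra_simps)
  have g_real: "g (s (complex_of_real t) x) = complex_of_real t * g x" for t x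
    using h_scale[of t "s \<i> x"] by (simp add: g_def h_scale mult.commute algebra_simps)
  have g_i: "g (s \<i> x) = \<i> * g x" for x
    by (simp add: g_def h_minus algebra_simps)
  have g_scale: "g (s c x) = c * g x" for c x
  proof -
    have "s c x = s (complex_of_real (Re c)) x + s \<i> (s (complex_of_real (Im c)) x)"
      by (subst complex_eq[of c]) (simp add: scale_left_distrib)
    then have "g (s c x) = complex_of_real (Re c) * g x + \<i> * (complex_of_real (Im c) * g x)"
      by (simp only: g_add g_real g_i)
    also have "\<dots> = c * g x"
      by (subst (3) complex_eq[of c]) (simp add: algebra_simps)
    finally show ?thesis .
  qed
  have g_M: "g x = f x" if "x \<in> M" for x
    using subspace_scale[OF M that, of \<i>] that
    by (simp add: g_def h_M scale complex_eq_iff)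
  have g_dom: "cmod (g x) \<le> p x" for x
  proof (cases "g x = 0")
    case True
    then show ?thesis by (simp add: p_nonneg)
  next
    case False
    \<comment> \<open>Rotating \<open>x\<close> by this unimodular number makes the value of
      \<open>g\<close> real and nonnegative, so the bound for \<open>h\<close> becomes one for the
      modulus of \<open>g\<close>.\<close>
    define c where "c = complex_of_real (cmod (g x)) / g x"
    have c: "cmod c = 1" using False by (simp add: c_def norm_divide)
    have "g (s c x) = complex_of_real (cmod (g x))"
      using False by (simp add: g_scale c_def)
    then have "cmod (g x) = Re (g (s c x))" by simp
    also have "\<dots> = h (s c x)" by (simp add: g_def)
    also have "\<dots> \<le> p (s c x)" by (rule dominated_graphD(3)[OF G(1) h])
    also have "\<dots> = p x" by (simp add: p_scale c)
    finally show ?thesis .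
  qed
  show ?thesis by (rule that[OF g_add g_scale g_M g_dom])
qed

text \<open>Hahn-Banach from the line through \<open>x0\<close>. With the norm it gives norming
  functionals, with the distance from a subspace separating ones, and for a seminorm on polynomials
  the functional to which the Liouville argument is applied.\<close>

lemma norming_functional:
  obtains g where "\<And>x y. g (x + y) = g x + g y" "\<And>c x. g (s c x) = c * g x"
    "\<And>x. cmod (g x) \<le> p x" "g x0 = complex_of_real (p x0)"
proof (cases "p x0 = 0")
  case True
  show ?thesis by (rule that[of "\<lambda>_. 0"]) (auto simp: True p_nonneg)
next
  case False
  then have "x0 \<noteq> 0" by (auto simp: p_zero)
  define f where "f x = (THE c. x = s c x0) * complex_of_real (p x0)" for x
  have f: "f (s c x0) = c * complex_of_real (p x0)" for c
    unfolding f_def using \<open>x0 \<noteq> 0\<close> by simp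
  have M: "\<exists>c. x = s c x0" if "x \<in> span {x0}" for x
    using that by (auto simp: span_singleton)
  show ?thesis
  proof (rule hahn_banach[of "span {x0}" f])
    show "f (x + y) = f x + f y" if xy: "x \<in> span {x0}" "y \<in> span {x0}" for x y
      using M[OF xy(1)] M[OF xy(2)] by (auto simp: f distrib_right simp flip: scale_left_distrib)
    show "f (s c x) = c * f x" if "x \<in> span {x0}" for c x
      using M[OF that] by (auto simp: f)
    show "cmod (f x) \<le> p x" if "x \<in> span {x0}" for x
      using M[OF that] by (auto simp: f norm_mult p_scale p_nonneg)
    fix g assume g: "\<And>x y. g (x + y) = g x + g y" "\<And>c x. g (s c x) = c * g x"
      "\<And>x. x \<in> span {x0} \<Longrightarrow> g x = f x" "\<And>x. cmod (g x) \<le> p x"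
    show thesis
      using f[of 1] by (intro that[OF g(1,2,4)]) (auto simp: g(3) span_base)
  qed simp
qed

end

lemmas cblinfun_linear_simps =
  linear_simps[OF bounded_linear_cblinfun_apply] cblinfun_apply_scaleC
  cblinfun_apply_plus cblinfun_apply_minus cblinfun_apply_zero scaleC_cblinfun_apply

lemma cblinfun_apply_sum: "cblinfun_apply f (sum g S) = (\<Sum>i\<in>S. cblinfun_apply f (g i))"
  by (rule linear_sum[OF bounded_linear.linear[OF bounded_linear_cblinfun_apply]])

lemma scaleC_complex_eq [simp]: "c *\<^sub>C (z::complex) = c * z"
  by (simp add: scaleC_complex_def)

lemma linear_cblinfun_apply: "Vector_Spaces.linear scaleC scaleC (cblinfun_apply f)"
  by unfold_locales (simp_all add: cblinfun_linear_simps scaleC_add_right scaleC_add_left scaleC_scaleC scaleC_one)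

interpretation complex_vector_pair:
  vector_space_pair "scaleC :: complex \<Rightarrow> 'a \<Rightarrow> 'a::complex_normed_vector"
    "scaleC :: complex \<Rightarrow> 'b \<Rightarrow> 'b::complex_normed_vector" ..

lemma cblinfun_tendsto: "(x \<longlongrightarrow> l) F \<Longrightarrow> ((\<lambda>n. cblinfun_apply f (x n)) \<longlongrightarrow> cblinfun_apply f l) F"
  by (rule bounded_linear.tendsto[OF bounded_linear_cblinfun_apply])

lemma cblinfun_bound_pos:
  obtains K where "K > 0" "\<And>x. norm (cblinfun_apply f x) \<le> K * norm x"
  using bounded_linear.pos_bounded[OF bounded_linear_cblinfun_apply, of f]
  by (auto simp: mult.commute)

lemma tendsto_scaleC:
  assumes "(c \<longlongrightarrow> k) F" "(x \<longlongrightarrow> l) F"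
  shows "((\<lambda>n. c n *\<^sub>C (x n :: 'a::complex_normed_vector)) \<longlongrightarrow> k *\<^sub>C l) F"
proof -
  have "bounded_bilinear (scaleC :: complex \<Rightarrow> 'a \<Rightarrow> 'a)"
  proof
    show "\<exists>K. \<forall>a b. norm (a *\<^sub>C (b::'a)) \<le> norm a * norm b * K"
      by (rule exI[of _ 1]) (simp add: norm_scaleC)
  qed (simp_all add: scaleC_add_right scaleC_add_left scaleR_scaleC scaleC_scaleC scaleR_conv_of_real mult.commute)
  from bounded_bilinear.tendsto[OF this assms] show ?thesis .
qed


section \<open>Finite-dimensional subspaces\<close>

lemma closed_csubspaceI:
  fixes S :: "'a::complex_normed_vector set"
  assumes "\<And>x. (\<And>n. x n \<in> S) \<Longrightarrow> bounded (range x) \<Longrightarrow> \<exists>l\<in>S. \<exists>r::nat\<Rightarrow>nat. strict_mono r \<and> (x \<circ> r) \<longlonglongrightarrow> l"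
  shows "closed S"
  unfolding closed_sequential_limits
proof (intro allI impI, elim conjE)
  fix x l assume x: "\<forall>n. x n \<in> S" "x \<longlonglongrightarrow> l"
  then obtain l' r where "l' \<in> S" "strict_mono (r::nat\<Rightarrow>nat)" "(x \<circ> r) \<longlonglongrightarrow> l'"
    using assms[of x] convergent_imp_bounded by blast
  then show "l \<in> S"
    using LIMSEQ_subseq_LIMSEQ[OF x(2)] LIMSEQ_unique by blast
qed

text \<open>After division by \<open>c\<close> the vector \<open>e\<close> differs from an element
  of \<open>S\<close> by x / c. This bounds the coefficient of a new basis vector in terms of
  \<open>norm x\<close>.\<close>

lemma infdist_scaleC_span:
  fixes e :: "'a::complex_normed_vector"
  assumes S: "csubspace S" and y: "x - c *\<^sub>C e \<in> S"
  shows "cmod c * infdist e S \<le> norm x"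
proof (cases "c = 0")
  case False
  have "- inverse c *\<^sub>C (x - c *\<^sub>C e) \<in> S"
    using complex_vector.subspace_scale[OF S y] .
  then have "infdist e S \<le> dist e (- inverse c *\<^sub>C (x - c *\<^sub>C e))"
    by (rule infdist_le)
  also have "\<dots> = norm (inverse c *\<^sub>C x)"
    using False by (simp add: dist_norm complex_vector.scale_right_diff_distrib scaleC_scaleC scaleC_one)
  also have "\<dots> = norm x / cmod c"
    by (simp add: norm_scaleC norm_inverse divide_inverse_commute)
  finally show ?thesis using False by (simp add: field_simps)
qed simp

text \<open>Bolzano-Weierstrass by induction on the spanning set. The induction hypothesis makes the
  smaller span closed, so a new vector has positive distance from it and its coefficients stay
  bounded.\<close>

lemma cspan_finite_subsequence:
  fixes b :: "'a::complex_normed_vector set"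
  assumes "finite b" "\<And>n. x n \<in> cspan b" "bounded (range x)"
  shows "\<exists>l\<in>cspan b. \<exists>r::nat\<Rightarrow>nat. strict_mono r \<and> (x \<circ> r) \<longlonglongrightarrow> l"
  using assms
proof (induction b arbitrary: x rule: finite_induct)
  case empty
  then have "x = (\<lambda>_. 0)" by auto
  then show ?case
    by (intro bexI[of _ 0] exI[of _ id]) (auto simp: strict_mono_def)
next
  case (insert e b)
  show ?case
  proof (cases "e \<in> cspan b")
    case True
    then have "cspan (insert e b) = cspan b" by (rule complex_vector.span_redundant)
    then show ?thesis using insert.IH[of x] insert.prems by simp
  next
    case False
    have "closed (cspan b)"
      using insert.IH by (rule closed_csubspaceI)
    then have d: "infdist e (cspan b) > 0"
      using False by (intro infdist_pos_not_in_closed) (auto intro: complex_vector.span_zero)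
    have "\<forall>n. \<exists>k. x n - k *\<^sub>C e \<in> cspan b"
      using insert.prems(1) by (simp add: complex_vector.span_breakdown_eq)
    then obtain c where c: "\<And>n. x n - c n *\<^sub>C e \<in> cspan b" by metis
    obtain K where K: "\<And>n. norm (x n) \<le> K"
      using insert.prems(2) by (auto simp: bounded_iff)
    have cb: "cmod (c n) \<le> K / infdist e (cspan b)" for n
      using infdist_scaleC_span[OF complex_vector.subspace_span c, of n] K[of n] d
      by (simp add: field_simps)
    then have "bounded (range c)" by (auto simp: bounded_iff)
    then obtain k r where r: "strict_mono (r::nat\<Rightarrow>nat)" "(c \<circ> r) \<longlonglongrightarrow> k"
      using bounded_imp_convergent_subsequence by blast
    define y where "y n = x (r n) - c (r n) *\<^sub>C e" for n
    have "norm (y n) \<le> K + K / infdist e (cspan b) * norm e" for n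
    proof -
      have "norm (y n) \<le> norm (x (r n)) + cmod (c (r n)) * norm e"
        unfolding y_def by (rule order_trans[OF norm_triangle_ineq4]) (simp add: norm_scaleC)
      also have "\<dots> \<le> K + K / infdist e (cspan b) * norm e"
        by (intro add_mono K mult_right_mono cb) auto
      finally show ?thesis .
    qed
    then have "bounded (range y)" by (auto simp: bounded_iff)
    moreover have "y n \<in> cspan b" for n unfolding y_def by (rule c)
    ultimately obtain l q where l: "l \<in> cspan b" "strict_mono (q::nat\<Rightarrow>nat)" "(y \<circ> q) \<longlonglongrightarrow> l"
      using insert.IH[of y] by blast
    have "(\<lambda>n. (y \<circ> q) n + ((c \<circ> r) \<circ> q) n *\<^sub>C e) \<longlonglongrightarrow> l + k *\<^sub>C e"
      by (intro tendsto_add tendsto_scaleC tendsto_const l LIMSEQ_subseq_LIMSEQ r)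
    then have "(x \<circ> (r \<circ> q)) \<longlonglongrightarrow> l + k *\<^sub>C e"
      by (simp add: y_def o_def)
    moreover have "l + k *\<^sub>C e \<in> cspan (insert e b)"
      using l(1) by (simp add: complex_vector.span_breakdown_eq)
        (metis add_diff_cancel_right')
    ultimately show ?thesis
      using strict_mono_o[OF r(1) l(2)] by blast
  qed
qed

lemma cfinite_dim_basis:
  fixes S :: "'a::complex_normed_vector set"
  assumes "cfinite_dim S"
  obtains b where "finite b" "b \<subseteq> S" "\<not> cdependent b" "S \<subseteq> cspan b" "card b = cdim S"
proof -
  obtain C where C: "finite C" "S \<subseteq> cspan C"
    using assms unfolding cfinite_dim_def by blast
  obtain b where b: "b \<subseteq> S" "\<not> cdependent b" "S \<subseteq> cspan b" "card b = cdim S"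
    by (rule complex_vector.basis_exists)
  have "finite b"
    using complex_vector.independent_span_bound[OF C(1) b(2)] b(1) C(2) by blast
  then show thesis using that b by blast
qed

lemma cspan_basis_eq:
  assumes "csubspace S" "b \<subseteq> S" "S \<subseteq> cspan b"
  shows "cspan b = S"
  using assms complex_vector.span_minimal by blast

lemma cfinite_dim_subset: "cfinite_dim T \<Longrightarrow> S \<subseteq> T \<Longrightarrow> cfinite_dim S"
  unfolding cfinite_dim_def by blast

lemma cfinite_dim_cspan: "finite b \<Longrightarrow> cfinite_dim (cspan b)"
  unfolding cfinite_dim_def by blast

lemma cfinite_dim_subsequence:
  fixes S :: "'a::complex_normed_vector set"
  assumes "csubspace S" "cfinite_dim S" "\<And>n. x n \<in> S" "bounded (range x)"
  shows "\<exists>l\<in>S. \<exists>r::nat\<Rightarrow>nat. strict_mono r \<and> (x \<circ> r) \<longlonglongrightarrow> l"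
proof -
  obtain b where b: "finite b" "b \<subseteq> S" "S \<subseteq> cspan b"
    using cfinite_dim_basis[OF assms(2)] by metis
  show ?thesis
    using cspan_finite_subsequence[OF b(1), of x] assms(3,4)
    unfolding cspan_basis_eq[OF assms(1) b(2,3)] by blast
qed

lemma closed_cfinite_dim:
  assumes "csubspace S" "cfinite_dim S"
  shows "closed S"
  by (rule closed_csubspaceI) (rule cfinite_dim_subsequence[OF assms])

lemma closed_cspan_finite: "finite b \<Longrightarrow> closed (cspan b)"
  by (rule closed_cfinite_dim[OF complex_vector.subspace_span cfinite_dim_cspan])

lemma infdist_csubspace_less:
  fixes S :: "'a::complex_normed_vector set"
  assumes "csubspace S" "infdist x S < c"
  shows "\<exists>z\<in>S. norm (x - z) < c"
proof -
  have ne: "S \<noteq> {}" using complex_vector.subspace_0[OF assms(1)] by blast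
  show ?thesis
  proof (rule ccontr)
    assume "\<not> ?thesis"
    then have "c \<le> infdist x S"
      unfolding infdist_notempty[OF ne, of x] by (intro cINF_greatest ne) (auto simp: dist_norm)
    then show False using assms(2) by simp
  qed
qed

text \<open>Riesz's lemma: normalize \<open>x - z\<close> for a point \<open>z\<close> of
  \<open>Z\<close> that is within a factor 2 of being nearest to \<open>x\<close>, whence the
  constant 1/2.\<close>

lemma exists_far_point:
  fixes S :: "'a::complex_normed_vector set"
  assumes S: "csubspace S" and Z: "csubspace Z" "closed Z" "Z \<subseteq> S" and x: "x \<in> S" "x \<notin> Z"
  shows "\<exists>u\<in>S. norm u = 1 \<and> (\<forall>z\<in>Z. norm (u - z) \<ge> 1 / 2)"
proof -
  have ne: "Z \<noteq> {}" using complex_vector.subspace_0[OF Z(1)] by blast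
  have d: "infdist x Z > 0"
    using x(2) Z(2) ne by (rule infdist_pos_not_in_closed[rotated 2])
  then obtain z where z: "z \<in> Z" "norm (x - z) < 2 * infdist x Z"
    using infdist_csubspace_less[OF Z(1), of x "2 * infdist x Z"] by auto
  define t where "t = norm (x - z)"
  have t: "t > 0" using x(2) z(1) unfolding t_def by auto
  define u where "u = complex_of_real (1 / t) *\<^sub>C (x - z)"
  have tu: "complex_of_real t *\<^sub>C u = x - z"
    using t by (simp add: u_def scaleC_scaleC scaleC_one)
  have "u \<in> S"
    unfolding u_def using x(1) z(1) Z(3)
    by (intro complex_vector.subspace_scale[OF S] complex_vector.subspace_diff[OF S]) auto
  moreover have "norm u = 1" using t by (simp add: u_def norm_scaleC t_def norm_divide)
  moreover have "norm (u - w) \<ge> 1 / 2" if w: "w \<in> Z" for w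
  proof -
    have "z + complex_of_real t *\<^sub>C w \<in> Z"
      using w z(1) by (intro complex_vector.subspace_add[OF Z(1)] complex_vector.subspace_scale[OF Z(1)])
    then have "infdist x Z \<le> dist x (z + complex_of_real t *\<^sub>C w)"
      by (rule infdist_le)
    also have "\<dots> = norm (complex_of_real t *\<^sub>C (u - w))"
      unfolding dist_norm complex_vector.scale_right_diff_distrib tu by (simp add: diff_diff_eq)
    also have "\<dots> = t * norm (u - w)" using t by (simp add: norm_scaleC)
    finally have "infdist x Z \<le> t * norm (u - w)" .
    then have "t / 2 \<le> t * norm (u - w)" using z(2) unfolding t_def by simp
    then show ?thesis using t by simp
  qed
  ultimately show ?thesis by blast
qed

lemma cfinite_dim_if_subsequences:
  fixes S :: "'a::complex_normed_vector set"
  assumes S: "csubspace S"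
    and sub: "\<And>x. (\<And>n. x n \<in> S) \<Longrightarrow> bounded (range x) \<Longrightarrow> \<exists>r::nat\<Rightarrow>nat. strict_mono r \<and> convergent (x \<circ> r)"
  shows "cfinite_dim S"
proof (rule ccontr)
  assume inf: "\<not> cfinite_dim S"
  have step: "\<exists>u\<in>S. norm u = 1 \<and> (\<forall>z\<in>cspan b. norm (u - z) \<ge> 1 / 2)" if b: "finite b" "b \<subseteq> S" for b
  proof -
    have "\<not> S \<subseteq> cspan b" using inf b(1) unfolding cfinite_dim_def by blast
    then obtain x where "x \<in> S" "x \<notin> cspan b" by blast
    then show ?thesis
      using b by (intro exists_far_point[OF S complex_vector.subspace_span closed_cspan_finite]
          complex_vector.span_minimal S) auto
  qed
  then obtain F where F: "\<And>b. finite b \<Longrightarrow> b \<subseteq> S \<Longrightarrow> F b \<in> S \<and> norm (F b) = 1 \<and> (\<forall>z\<in>cspan b. norm (F b - z) \<ge> 1 / 2)"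
    by metis
  \<comment> \<open>Greedy construction: each new unit vector keeps distance 1/2 from the span of
    the earlier ones, so that no subsequence is Cauchy.\<close>
  define L where "L = rec_nat {} (\<lambda>_ b. insert (F b) b)"
  have L: "finite (L n) \<and> L n \<subseteq> S" for n
    by (induction n) (auto simp: L_def F)
  define x where "x n = F (L n)" for n
  have LS: "L (Suc n) = insert (x n) (L n)" for n by (simp add: L_def x_def)
  have mono: "L m \<subseteq> L n" if "m \<le> n" for m n
    using that by (rule lift_Suc_mono_le[rotated]) (auto simp: LS)
  have sep: "norm (x n - x m) \<ge> 1 / 2" if "m < n" for m n
  proof -
    have "x m \<in> L n" using mono[of "Suc m" n] that LS[of m] by auto
    then show ?thesis
      using F[of "L n"] L[of n] complex_vector.span_base unfolding x_def by blast
  qed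
  have "bounded (range x)" "\<And>n. x n \<in> S"
    using F L by (auto simp: bounded_iff x_def intro!: exI[of _ 1])
  then obtain r where r: "strict_mono (r::nat\<Rightarrow>nat)" "convergent (x \<circ> r)"
    using sub by blast
  then have "Cauchy (x \<circ> r)" by (auto simp: convergent_def LIMSEQ_imp_Cauchy)
  then obtain M where "\<And>m n. m \<ge> M \<Longrightarrow> n \<ge> M \<Longrightarrow> norm (x (r m) - x (r n)) < 1 / 2"
    unfolding Cauchy_def dist_norm o_def by (metis half_gt_zero zero_less_one)
  from this[of "Suc M" M] sep[of "r M" "r (Suc M)"] r(1) show False
    by (simp add: strict_mono_Suc_iff)
qed


section \<open>Bounded functionals\<close>

lemma cblinfun_functional:
  fixes g :: "'a::complex_normed_vector \<Rightarrow> complex"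
  assumes "\<And>x y. g (x + y) = g x + g y" "\<And>c x. g (c *\<^sub>C x) = c * g x"
    and "\<And>x. cmod (g x) \<le> K * norm x"
  obtains \<phi> :: "'a \<Rightarrow>\<^sub>C\<^sub>L complex" where "\<And>x. cblinfun_apply \<phi> x = g x"
  by (rule that[OF cblinfun_of_bounded[of g K]]) (use assms in \<open>simp_all add: mult.commute\<close>)

lemma complex_seminorm_norm: "complex_seminorm scaleC (norm :: 'a::complex_normed_vector \<Rightarrow> real)"
  by unfold_locales (simp_all add: norm_triangle_ineq norm_scaleC)

text \<open>This is the quotient seminorm modulo \<open>S\<close>. Approximation within
  \<open>e\<close> replaces nearest points, which need not exist.\<close>

lemma complex_seminorm_infdist:
  fixes S :: "'a::complex_normed_vector set"
  assumes S: "csubspace S"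
  shows "complex_seminorm scaleC (\<lambda>x. infdist x S)"
proof (intro complex_seminorm.intro complex_seminorm_axioms.intro complex_vector.vector_space_axioms)
  note sub = complex_vector.subspace_scale[OF S] complex_vector.subspace_add[OF S]
  fix x y :: 'a
  show "infdist (x + y) S \<le> infdist x S + infdist y S"
  proof (rule field_le_epsilon)
    fix e :: real assume "e > 0"
    then obtain z w where z: "z \<in> S" "norm (x - z) < infdist x S + e / 2"
      and w: "w \<in> S" "norm (y - w) < infdist y S + e / 2"
      using infdist_csubspace_less[OF S, of x "infdist x S + e / 2"]
        infdist_csubspace_less[OF S, of y "infdist y S + e / 2"] by auto
    have "infdist (x + y) S \<le> dist (x + y) (z + w)"
      by (intro infdist_le sub z w)
    also have "\<dots> \<le> norm (x - z) + norm (y - w)"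
      unfolding dist_norm by (rule norm_diff_triangle_ineq)
    finally show "infdist (x + y) S \<le> infdist x S + infdist y S + e" using z w by simp
  qed
  have le: "infdist (c *\<^sub>C x) S \<le> cmod c * infdist x S" for c x
  proof (cases "c = 0")
    case True
    then show ?thesis using complex_vector.subspace_0[OF S] by simp
  next
    case False
    show ?thesis
    proof (rule field_le_epsilon)
      fix e :: real assume "e > 0"
      then obtain z where z: "z \<in> S" "norm (x - z) < infdist x S + e / cmod c"
        using infdist_csubspace_less[OF S, of x "infdist x S + e / cmod c"] False by auto
      have "infdist (c *\<^sub>C x) S \<le> dist (c *\<^sub>C x) (c *\<^sub>C z)"
        by (intro infdist_le sub z)
      also have "\<dots> = cmod c * norm (x - z)"
        by (simp add: dist_norm norm_scaleC flip: complex_vector.scale_right_diff_distrib)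
      also have "\<dots> \<le> cmod c * (infdist x S + e / cmod c)"
        using z by (intro mult_left_mono) auto
      finally show "infdist (c *\<^sub>C x) S \<le> cmod c * infdist x S + e"
        using False by (simp add: distrib_left)
    qed
  qed
  fix c
  show "infdist (c *\<^sub>C x) S = cmod c * infdist x S"
  proof (cases "c = 0")
    case True
    then show ?thesis using complex_vector.subspace_0[OF S] by simp
  next
    case False
    have "infdist (inverse c *\<^sub>C (c *\<^sub>C x)) S \<le> cmod (inverse c) * infdist (c *\<^sub>C x) S"
      by (rule le)
    then have "cmod c * infdist x S \<le> infdist (c *\<^sub>C x) S"
      using False by (simp add: scaleC_scaleC scaleC_one norm_inverse norm_divide field_simps)
    then show ?thesis using le[of c x] by simp
  qed
qed

lemma exists_norming_functional:
  fixes x :: "'a::complex_normed_vector"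
  obtains \<phi> :: "'a \<Rightarrow>\<^sub>C\<^sub>L complex" where "\<phi> x = complex_of_real (norm x)" "norm \<phi> \<le> 1"
proof -
  obtain g where g: "\<And>x y. g (x + y) = g x + g y" "\<And>c x. g (c *\<^sub>C x) = c * g x"
    "\<And>x. cmod (g x) \<le> norm (x::'a)" "g x = complex_of_real (norm x)"
    by (rule complex_seminorm.norming_functional[OF complex_seminorm_norm, where ?x0.0 = x]) (rule that)
  obtain \<phi> :: "'a \<Rightarrow>\<^sub>C\<^sub>L complex" where \<phi>: "\<And>x. cblinfun_apply \<phi> x = g x"
    by (rule cblinfun_functional[of g 1]) (use g in auto)
  show thesis
    by (rule that[of \<phi>]) (auto simp: \<phi> g intro: norm_cblinfun_bound)
qed

lemma exists_separating_functional:
  fixes x :: "'a::complex_normed_vector"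
  assumes S: "csubspace S" "closed S" and x: "x \<notin> S"
  obtains \<phi> :: "'a \<Rightarrow>\<^sub>C\<^sub>L complex" where "\<phi> x = 1" "\<And>z. z \<in> S \<Longrightarrow> \<phi> z = 0"
proof -
  have ne: "S \<noteq> {}" using complex_vector.subspace_0[OF S(1)] by blast
  have d: "infdist x S > 0"
    using x S(2) ne by (rule infdist_pos_not_in_closed[rotated 2])
  obtain g where g: "\<And>x y. g (x + y) = g x + g y" "\<And>c x. g (c *\<^sub>C x) = c * g x"
    "\<And>x. cmod (g x) \<le> infdist x S" "g x = complex_of_real (infdist x S)"
    by (rule complex_seminorm.norming_functional[OF complex_seminorm_infdist[OF S(1)], where ?x0.0 = x]) (rule that)
  have b: "cmod (g y) \<le> 1 * norm y" for y
    using g(3)[of y] infdist_le[OF complex_vector.subspace_0[OF S(1)], of y] by simp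
  obtain \<phi> :: "'a \<Rightarrow>\<^sub>C\<^sub>L complex" where \<phi>: "\<And>x. cblinfun_apply \<phi> x = g x"
    by (rule cblinfun_functional[of g, OF g(1,2) b]) (rule that)
  show thesis
  proof (rule that[of "inverse (complex_of_real (infdist x S)) *\<^sub>C \<phi>"])
    show "(inverse (complex_of_real (infdist x S)) *\<^sub>C \<phi>) x = 1"
      using d by (simp add: cblinfun_linear_simps \<phi> g)
    show "(inverse (complex_of_real (infdist x S)) *\<^sub>C \<phi>) z = 0" if "z \<in> S" for z
      using g(3)[of z] that by (simp add: cblinfun_linear_simps \<phi>)
  qed
qed

lemma exists_biorthogonal_functionals:
  fixes b :: "'a::complex_normed_vector set"
  assumes "finite b" "\<not> cdependent b"
  obtains \<phi> :: "'a \<Rightarrow> 'a \<Rightarrow>\<^sub>C\<^sub>L complex"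
  where "\<And>e e'. e \<in> b \<Longrightarrow> e' \<in> b \<Longrightarrow> \<phi> e e' = (if e = e' then 1 else 0)"
proof -
  have "\<exists>\<phi> :: 'a \<Rightarrow>\<^sub>C\<^sub>L complex. \<phi> e = 1 \<and> (\<forall>z\<in>cspan (b - {e}). \<phi> z = 0)" if "e \<in> b" for e
  proof -
    have "e \<notin> cspan (b - {e})"
      using assms(2) that by (auto simp: complex_vector.dependent_def)
    then show ?thesis
      using exists_separating_functional[OF complex_vector.subspace_span closed_cspan_finite] assms(1)
      by (metis finite_Diff)
  qed
  then obtain \<phi> :: "'a \<Rightarrow> 'a \<Rightarrow>\<^sub>C\<^sub>L complex"
    where \<phi>: "\<And>e. e \<in> b \<Longrightarrow> \<phi> e e = 1 \<and> (\<forall>z\<in>cspan (b - {e}). \<phi> e z = 0)" by metis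
  show thesis
  proof (rule that[of \<phi>])
    fix e e' assume "e \<in> b" "e' \<in> b"
    then show "\<phi> e e' = (if e = e' then 1 else 0)"
      using \<phi>[of e] complex_vector.span_base[of e' "b - {e}"] by auto
  qed
qed

lemma biorthogonal_expansion:
  fixes b :: "'a::complex_normed_vector set" and \<phi> :: "'a \<Rightarrow> 'a \<Rightarrow>\<^sub>C\<^sub>L complex"
  assumes b: "finite b" and \<phi>: "\<And>e e'. e \<in> b \<Longrightarrow> e' \<in> b \<Longrightarrow> \<phi> e e' = (if e = e' then 1 else 0)"
    and x: "x \<in> cspan b"
  shows "(\<Sum>e\<in>b. \<phi> e x *\<^sub>C e) = x"
proof -
  let ?S = "{x. (\<Sum>e\<in>b. \<phi> e x *\<^sub>C e) = x}"
  have "csubspace ?S"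
  proof (rule complex_vector.subspaceI)
    show "0 \<in> ?S" by (simp add: cblinfun_linear_simps)
    show "x + y \<in> ?S" if "x \<in> ?S" "y \<in> ?S" for x y
      using that by (simp add: cblinfun_linear_simps scaleC_add_left sum.distrib)
    show "c *\<^sub>C x \<in> ?S" if "x \<in> ?S" for c x
    proof -
      have "(\<Sum>e\<in>b. \<phi> e (c *\<^sub>C x) *\<^sub>C e) = c *\<^sub>C (\<Sum>e\<in>b. \<phi> e x *\<^sub>C e)"
        by (simp add: cblinfun_apply_scaleC complex_vector.scale_sum_right)
      then show ?thesis using that by simp
    qed
  qed
  moreover have "b \<subseteq> ?S"
  proof
    fix e' assume e': "e' \<in> b"
    have "(\<Sum>e\<in>b. \<phi> e e' *\<^sub>C e) = (\<Sum>e\<in>b. if e = e' then e else 0)"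
      by (rule sum.cong) (auto simp: \<phi> e' scaleC_one)
    then show "e' \<in> ?S" using e' b by simp
  qed
  ultimately have "cspan b \<subseteq> ?S" by (rule complex_vector.span_minimal[rotated])
  then show ?thesis using x by blast
qed

text \<open>The sum is a bounded projection onto the span along the common kernel of the
  functionals; it serves to split off the null space of a semi-Fredholm operator.\<close>

lemma biorthogonal_projection:
  fixes b :: "'a::complex_normed_vector set" and \<phi> :: "'a \<Rightarrow> 'a \<Rightarrow>\<^sub>C\<^sub>L complex"
  assumes b: "finite b" and \<phi>: "\<And>e e'. e \<in> b \<Longrightarrow> e' \<in> b \<Longrightarrow> \<phi> e e' = (if e = e' then 1 else 0)"
  shows "(\<Sum>e\<in>b. \<phi> e x *\<^sub>C e) \<in> cspan b"
    and "e \<in> b \<Longrightarrow> \<phi> e (x - (\<Sum>e\<in>b. \<phi> e x *\<^sub>C e)) = 0"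
proof -
  show "(\<Sum>e\<in>b. \<phi> e x *\<^sub>C e) \<in> cspan b"
    by (intro complex_vector.span_sum complex_vector.span_scale complex_vector.span_base)
  assume e: "e \<in> b"
  have "\<phi> e (\<Sum>e\<in>b. \<phi> e x *\<^sub>C e) = (\<Sum>e'\<in>b. if e' = e then \<phi> e' x else 0)"
    unfolding cblinfun_apply_sum by (rule sum.cong) (auto simp: cblinfun_linear_simps \<phi> e)
  then show "\<phi> e (x - (\<Sum>e\<in>b. \<phi> e x *\<^sub>C e)) = 0"
    using e b by (simp add: cblinfun_linear_simps)
qed

section \<open>Complements and dimension counting\<close>

lemma csubspace_cblinfun_image: "csubspace Y \<Longrightarrow> csubspace (cblinfun_apply T ` Y)"
  by (rule complex_vector_pair.linear_subspace_image[OF linear_cblinfun_apply])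

lemma csubspace_null_space: "csubspace (null_space (cblinfun_apply T))"
  unfolding null_space_def
  by (rule complex_vector.subspaceI) (auto simp: cblinfun_linear_simps)

text \<open>Purely algebraic. With \<open>P\<close> a projection onto \<open>V\<close>, the map
  \<open>Q\<close>, the identity minus \<open>P\<close>, kills \<open>V\<close> and is injective on
  \<open>W\<close>; a linear left inverse of \<open>Q\<close> on \<open>W\<close>, composed with
  \<open>Q\<close>, is the map sought.\<close>

lemma exists_projection_along:
  fixes V W :: "'a::complex_normed_vector set"
  assumes V: "csubspace V" and W: "csubspace W" and VW: "V \<inter> W \<subseteq> {0}"
  obtains L :: "'a \<Rightarrow> 'a" where "Vector_Spaces.linear scaleC scaleC L"
    "\<And>x. L x \<in> W" "\<And>v. v \<in> V \<Longrightarrow> L v = 0" "\<And>w. w \<in> W \<Longrightarrow> L w = w"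
proof -
  obtain b where b: "b \<subseteq> V" "\<not> cdependent b" "V \<subseteq> cspan b"
    using complex_vector.basis_exists by metis
  obtain P :: "'a \<Rightarrow> 'a" where P: "Vector_Spaces.linear scaleC scaleC P" "\<forall>x\<in>b. P x = id x" "range P = cspan (id ` b)"
    using complex_vector_pair.linear_independent_extend_subspace[OF b(2), of id] by auto
  have PV: "P x \<in> V" for x
    using P(3) cspan_basis_eq[OF V b(1,3)] by auto
  have Pid: "P v = v" if "v \<in> V" for v
  proof -
    have "P v = id v"
      by (rule complex_vector_pair.linear_eq_on[OF P(1), of id v b])
        (use P(2) b(3) that in \<open>auto simp: complex_vector.linear_id\<close>)
    then show ?thesis by simp
  qed
  define Q where "Q x = x - P x" for x
  interpret P: Vector_Spaces.linear scaleC scaleC P by (rule P(1))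
  have Q: "Vector_Spaces.linear scaleC scaleC Q"
    by unfold_locales (simp_all add: Q_def P.add P.scale complex_vector.scale_right_diff_distrib)
  have "inj_on Q W"
  proof (rule inj_onI)
    fix x y assume xy: "x \<in> W" "y \<in> W" "Q x = Q y"
    then have "x - y = P (x - y)" by (simp add: Q_def P.diff algebra_simps)
    then have "x - y \<in> V" using PV by metis
    then show "x = y" using VW complex_vector.subspace_diff[OF W xy(1,2)] by auto
  qed
  from complex_vector_pair.linear_exists_left_inverse_on[OF Q W this]
  obtain g :: "'a \<Rightarrow> 'a" where g: "range g \<subseteq> W" "Vector_Spaces.linear scaleC scaleC g" "\<forall>v\<in>W. g (Q v) = v"
    by blast
  interpret g: Vector_Spaces.linear scaleC scaleC g by (rule g(2))
  show thesis
  proof (rule that[of "g \<circ> Q"])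
    show "Vector_Spaces.linear scaleC scaleC (g \<circ> Q)"
      by (rule Vector_Spaces.linear_compose[OF Q g(2)])
  qed (use g Pid in \<open>auto simp: Q_def\<close>)
qed

lemma exists_complement:
  fixes N M :: "'a::complex_normed_vector set"
  assumes N: "csubspace N" and M: "csubspace M" and NM: "N \<subseteq> M"
  obtains C where "csubspace C" "C \<subseteq> M" "N \<inter> C = {0}" "M = {n + w | n w. n \<in> N \<and> w \<in> C}"
proof -
  obtain L :: "'a \<Rightarrow> 'a" where L: "Vector_Spaces.linear scaleC scaleC L"
    "\<And>x. L x \<in> N" "\<And>v. v \<in> N \<Longrightarrow> L v = v"
    by (rule exists_projection_along[OF complex_vector.subspace_single_0 N]) (auto intro: that)
  interpret L: Vector_Spaces.linear scaleC scaleC L by (rule L(1))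
  define C where "C = {x \<in> M. L x = 0}"
  show thesis
  proof (rule that[of C])
    show "csubspace C"
      unfolding C_def using complex_vector.subspace_0[OF M] complex_vector.subspace_add[OF M]
        complex_vector.subspace_scale[OF M]
      by (intro complex_vector.subspaceI) (auto simp: L.zero L.add L.scale)
    show "C \<subseteq> M" by (auto simp: C_def)
    show "N \<inter> C = {0}"
      using complex_vector.subspace_0[OF N] complex_vector.subspace_0[OF M] L(3)
      by (auto simp: C_def L.zero)
    show "M = {n + w | n w. n \<in> N \<and> w \<in> C}"
    proof (intro equalityI subsetI)
      fix x assume x: "x \<in> M"
      have "x - L x \<in> C"
        unfolding C_def using x L(2)[of x] NM
        by (auto simp: L.diff L(3)[OF L(2)] intro: complex_vector.subspace_diff[OF M])
      then show "x \<in> {n + w | n w. n \<in> N \<and> w \<in> C}"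
        using L(2)[of x] by (intro CollectI exI[of _ "L x"] exI[of _ "x - L x"]) auto
    next
      fix x assume "x \<in> {n + w | n w. n \<in> N \<and> w \<in> C}"
      then show "x \<in> M" using NM by (auto simp: C_def intro: complex_vector.subspace_add[OF M])
    qed
  qed
qed

text \<open>A projection onto \<open>W\<close> along \<open>V\<close> sends the spanning set
  \<open>V \<union> B\<close> to 0 and at most \<open>card B\<close> further vectors.\<close>

lemma cdim_le_modulo:
  fixes V W :: "'a::complex_normed_vector set"
  assumes V: "csubspace V" and W: "csubspace W" and VW: "V \<inter> W \<subseteq> {0}"
    and B: "finite B" "W \<subseteq> cspan (V \<union> B)"
  shows "cfinite_dim W" "cdim W \<le> card B"
proof -
  obtain L :: "'a \<Rightarrow> 'a" where L: "Vector_Spaces.linear scaleC scaleC L"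
    "\<And>v. v \<in> V \<Longrightarrow> L v = 0" "\<And>w. w \<in> W \<Longrightarrow> L w = w"
    using exists_projection_along[OF V W VW] by metis
  have "W \<subseteq> cspan (L ` B)"
  proof
    fix w assume w: "w \<in> W"
    then have "L w \<in> L ` cspan (V \<union> B)" using B(2) by blast
    also have "\<dots> = cspan (L ` (V \<union> B))"
      by (rule complex_vector_pair.linear_span_image[OF L(1), symmetric])
    also have "\<dots> \<subseteq> cspan (insert 0 (L ` B))"
      by (rule complex_vector.span_mono) (use L(2) in auto)
    finally show "w \<in> cspan (L ` B)" using L(3)[OF w] by simp
  qed
  moreover have "finite (L ` B)" using B(1) by simp
  ultimately show "cfinite_dim W" "cdim W \<le> card B"
    using complex_vector.dim_le_card[of W "L ` B"] card_image_le[OF B(1), of L]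
    unfolding cfinite_dim_def by (auto intro: order_trans)
qed

lemma cdim_image_le:
  fixes F :: "'a::complex_normed_vector \<Rightarrow> 'b::complex_normed_vector"
  assumes F: "Vector_Spaces.linear scaleC scaleC F" and W: "cfinite_dim W"
  shows "cfinite_dim (F ` W)" "cdim (F ` W) \<le> cdim W"
proof -
  obtain b where b: "finite b" "b \<subseteq> W" "\<not> cdependent b" "W \<subseteq> cspan b" "card b = cdim W"
    by (rule cfinite_dim_basis[OF W])
  have "F ` W \<subseteq> cspan (F ` b)"
    using b(4) unfolding complex_vector_pair.linear_span_image[OF F] by blast
  then show "cfinite_dim (F ` W)" "cdim (F ` W) \<le> cdim W"
    using complex_vector.dim_le_card[of "F ` W" "F ` b"] card_image_le[OF b(1), of F] b(1,5)
    unfolding cfinite_dim_def by (auto intro: order_trans)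
qed

lemma cdim_eq_imp_eq:
  fixes V W :: "'a::complex_normed_vector set"
  assumes V: "csubspace V" "V \<subseteq> W" and W: "cfinite_dim W" "csubspace W" and d: "cdim W \<le> cdim V"
  shows "V = W"
proof (rule ccontr)
  assume "V \<noteq> W"
  then obtain x where x: "x \<in> W" "x \<notin> V" using V(2) by blast
  obtain b where b: "finite b" "b \<subseteq> V" "\<not> cdependent b" "V \<subseteq> cspan b" "card b = cdim V"
    by (rule cfinite_dim_basis[OF cfinite_dim_subset[OF W(1) V(2)]])
  have "x \<notin> cspan b" using x(2) cspan_basis_eq[OF V(1) b(2,4)] by simp
  then have "\<not> cdependent (insert x b)" "x \<notin> b"
    using b(3) complex_vector.independent_insertI complex_vector.span_base by blast+
  moreover obtain c where c: "finite c" "W \<subseteq> cspan c" "card c = cdim W"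
    using cfinite_dim_basis[OF W(1)] by metis
  moreover have "insert x b \<subseteq> cspan c" using x(1) b(2) V(2) c(2) by blast
  ultimately have "card (insert x b) \<le> card c"
    using complex_vector.independent_span_bound[OF c(1)] by blast
  then show False using \<open>x \<notin> b\<close> b(1,5) c(3) d by simp
qed

text \<open>Rank-nullity modulo \<open>Y0\<close>. A linear lift \<open>W2\<close> of the image of
  \<open>Y\<close> meets \<open>N\<close> trivially, and their sum \<open>W\<close> meets
  \<open>Y0\<close> trivially, because \<open>F\<close> kills \<open>Y0\<close> and \<open>N\<close>
  but is injective on \<open>W2\<close>. Hence the dimension of \<open>W\<close> is at most that of
  \<open>Y\<close> modulo \<open>Y0\<close>.\<close>

lemma cdim_kernel_plus_image_le:
  fixes F :: "'a::complex_normed_vector \<Rightarrow> 'b::complex_normed_vector"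
  assumes F: "Vector_Spaces.linear scaleC scaleC F"
    and Y: "csubspace Y" and Y0: "csubspace Y0" and N: "csubspace N" "N \<subseteq> Y" "Y0 \<inter> N \<subseteq> {0}"
    and c: "finite c" "Y \<subseteq> cspan (Y0 \<union> c)"
    and F0: "\<And>x. x \<in> Y0 \<Longrightarrow> F x = 0" "\<And>x. x \<in> N \<Longrightarrow> F x = 0"
  shows "cfinite_dim (F ` Y)" "cdim N + cdim (F ` Y) \<le> card c"
proof -
  interpret F: Vector_Spaces.linear scaleC scaleC F by (rule F)
  obtain g :: "'b \<Rightarrow> 'a" where g: "range g \<subseteq> Y" "Vector_Spaces.linear scaleC scaleC g"
    "\<And>v. v \<in> F ` Y \<Longrightarrow> F (g v) = v"
    using complex_vector_pair.linear_exists_right_inverse_on[OF F Y] by blast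
  interpret g: Vector_Spaces.linear scaleC scaleC g by (rule g(2))
  define W2 where "W2 = g ` (F ` Y)"
  define W where "W = {n + w | n w. n \<in> N \<and> w \<in> W2}"
  have FY: "csubspace (F ` Y)" by (rule complex_vector_pair.linear_subspace_image[OF F Y])
  have W2: "csubspace W2" unfolding W2_def by (rule complex_vector_pair.linear_subspace_image[OF g(2) FY])
  have W: "csubspace W" unfolding W_def by (rule complex_vector.subspace_sums[OF N(1) W2])
  have "W \<subseteq> Y"
    unfolding W_def W2_def using N(2) g(1) by (auto intro!: complex_vector.subspace_add[OF Y])
  have NW2: "w = 0" if "w \<in> W2" "F w = 0" for w
    using that g(3) unfolding W2_def by (auto simp: g.zero)
  have "Y0 \<inter> W \<subseteq> {0}"
  proof clarify
    fix x assume x: "x \<in> Y0" "x \<in> W"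
    then obtain n w where nw: "x = n + w" "n \<in> N" "w \<in> W2" unfolding W_def by blast
    have "F w = 0" using F0(1)[OF x(1)] F0(2)[OF nw(2)] by (simp add: nw(1) F.add)
    then have "w = 0" by (rule NW2[OF nw(3)])
    then have "x \<in> Y0 \<inter> N" using nw x(1) by simp
    then show "x = 0" using N(3) by blast
  qed
  moreover have "W \<subseteq> cspan (Y0 \<union> c)" using c(2) \<open>W \<subseteq> Y\<close> by blast
  ultimately have dW: "cfinite_dim W" "cdim W \<le> card c"
    using cdim_le_modulo[OF Y0 W _ c(1)] by auto
  have sub: "N \<subseteq> W" "W2 \<subseteq> W"
    unfolding W_def using complex_vector.subspace_0[OF N(1)] complex_vector.subspace_0[OF W2]
    by force+
  obtain bN where bN: "finite bN" "bN \<subseteq> N" "\<not> cdependent bN" "N \<subseteq> cspan bN" "card bN = cdim N"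
    by (rule cfinite_dim_basis[OF cfinite_dim_subset[OF dW(1) sub(1)]])
  obtain bW where bW: "bN \<subseteq> bW" "bW \<subseteq> W" "\<not> cdependent bW" "W \<subseteq> cspan bW"
    by (rule complex_vector.maximal_independent_subset_extend[of bN W]) (use bN sub in auto)
  obtain e where e: "finite e" "W \<subseteq> cspan e" using dW(1) unfolding cfinite_dim_def by blast
  have cbW: "card bW = cdim W" "finite bW"
    using complex_vector.basis_card_eq_dim[OF bW(2,4,3)]
      complex_vector.independent_span_bound[OF e(1) bW(3)] bW(2) e(2) by auto
  have "W2 \<subseteq> cspan (N \<union> (bW - bN))"
  proof -
    have "bW \<subseteq> N \<union> (bW - bN)" using bN(2) by blast
    then show ?thesis using sub(2) bW(4) complex_vector.span_mono by blast
  qed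
  moreover have "N \<inter> W2 \<subseteq> {0}" using NW2 F0(2) by blast
  moreover have "finite (bW - bN)" using cbW(2) by simp
  ultimately have dW2: "cfinite_dim W2" "cdim W2 \<le> card (bW - bN)"
    using cdim_le_modulo[OF N(1) W2] by auto
  have "F ` W2 = F ` Y"
    using g(3) unfolding W2_def image_image by (intro image_cong) auto
  then have "cfinite_dim (F ` Y)" "cdim (F ` Y) \<le> cdim W2"
    using cdim_image_le[OF F dW2(1)] by simp_all
  moreover have "card (bW - bN) = card bW - card bN"
    by (rule card_Diff_subset[OF bN(1) bW(1)])
  moreover have "card bN \<le> card bW" by (rule card_mono[OF cbW(2) bW(1)])
  ultimately show "cfinite_dim (F ` Y)" "cdim N + cdim (F ` Y) \<le> card c"
    using dW(2) dW2(2) bN(5) cbW(1) by linarith+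
qed

text \<open>
  The algebraic core of all index estimates below: if \<open>W\<close> is independent of \<open>G(Y\<^sub>0)\<close> and at least as
  large as the codimension of \<open>Y\<^sub>0\<close>, then \<open>G\<close> has nonpositive index on \<open>Y\<close>.
\<close>

lemma cdim_null_space_le:
  fixes G :: "'a::complex_normed_vector \<Rightarrow>\<^sub>C\<^sub>L 'a"
  assumes Y: "csubspace Y" and Y0: "csubspace Y0" and c: "finite c" "Y \<subseteq> cspan (Y0 \<union> c)"
    and inj: "\<And>x. x \<in> Y0 \<Longrightarrow> G x = 0 \<Longrightarrow> x = 0"
    and W: "csubspace W" "W \<subseteq> Y" "card c \<le> cdim W" "G ` Y0 \<inter> W \<subseteq> {0}"
    and B: "finite B" "Y \<subseteq> cspan (G ` Y \<union> B)"
  shows "cdim (null_space G \<inter> Y) \<le> card B"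
proof -
  obtain L :: "'a \<Rightarrow> 'a" where L: "Vector_Spaces.linear scaleC scaleC L"
    "\<And>v. v \<in> G ` Y0 \<Longrightarrow> L v = 0" "\<And>w. w \<in> W \<Longrightarrow> L w = w"
    using exists_projection_along[OF csubspace_cblinfun_image[OF Y0] W(1,4)] by metis
  \<comment> \<open>\<open>F\<close> kills \<open>Y0\<close> and the null space of \<open>G\<close>,
    and its image together with that of \<open>B\<close> under \<open>L\<close> spans
    \<open>W\<close>. So the nullity of \<open>G\<close> on \<open>Y\<close> plus the rank of
    \<open>F\<close> is at most \<open>card c\<close>, hence at most \<open>cdim W\<close>, hence at
    most the rank of \<open>F\<close> plus \<open>card B\<close>.\<close>
  define F where "F = L \<circ> G"
  have F: "Vector_Spaces.linear scaleC scaleC F"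
    unfolding F_def by (rule Vector_Spaces.linear_compose[OF linear_cblinfun_apply L(1)])
  interpret L: Vector_Spaces.linear scaleC scaleC L by (rule L(1))
  have N: "csubspace (null_space G \<inter> Y)"
    by (rule complex_vector.subspace_inter[OF csubspace_null_space Y])
  have N0: "Y0 \<inter> (null_space G \<inter> Y) \<subseteq> {0}" using inj by (auto simp: null_space_def)
  have F0: "F x = 0" if "x \<in> Y0" for x using L(2) that by (simp add: F_def)
  have F1: "F x = 0" if "x \<in> null_space G \<inter> Y" for x
    using that by (simp add: F_def null_space_def L.zero)
  note * = cdim_kernel_plus_image_le[OF F Y Y0 N Int_lower2 N0 c F0 F1]
  obtain d where d: "finite d" "F ` Y \<subseteq> cspan d" "card d = cdim (F ` Y)"
    using cfinite_dim_basis[OF *(1)] by metis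
  have "W \<subseteq> cspan (d \<union> L ` B)"
  proof
    fix w assume w: "w \<in> W"
    then have "L w \<in> L ` cspan (G ` Y \<union> B)" using B(2) W(2) by blast
    also have "\<dots> = cspan (L ` (G ` Y \<union> B))"
      by (rule complex_vector_pair.linear_span_image[OF L(1), symmetric])
    also have "\<dots> = cspan (F ` Y \<union> L ` B)"
      by (simp add: image_Un F_def image_image o_def)
    also have "\<dots> \<subseteq> cspan (d \<union> L ` B)"
    proof (rule complex_vector.span_minimal[OF _ complex_vector.subspace_span])
      show "F ` Y \<union> L ` B \<subseteq> cspan (d \<union> L ` B)"
        using d(2) complex_vector.span_mono[of d "d \<union> L ` B"]
          complex_vector.span_superset[of "d \<union> L ` B"] by blast
    qed
    finally show "w \<in> cspan (d \<union> L ` B)" using L(3)[OF w] by simp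
  qed
  then have "cdim W \<le> card (d \<union> L ` B)"
    using d(1) B(1) by (intro complex_vector.dim_le_card) auto
  moreover have "card (d \<union> L ` B) \<le> card d + card (L ` B)" by (rule card_Un_le)
  moreover have "card (L ` B) \<le> card B" by (rule card_image_le[OF B(1)])
  ultimately show ?thesis using *(2) W(3) d(3) by linarith
qed

lemma cfinite_dim_preimage:
  fixes T :: "'a::complex_normed_vector \<Rightarrow>\<^sub>C\<^sub>L 'b::complex_normed_vector"
  assumes Y: "csubspace Y" and N: "cfinite_dim (null_space T \<inter> Y)" and Z: "csubspace Z" "cfinite_dim Z"
  shows "cfinite_dim {x \<in> Y. T x \<in> Z}"
proof -
  define Y' where "Y' = {x \<in> Y. T x \<in> Z}"
  from complex_vector_pair.linear_exists_right_inverse_on[OF linear_cblinfun_apply Y, of T]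
  obtain g :: "'b \<Rightarrow> 'a" where g: "range g \<subseteq> Y" "Vector_Spaces.linear scaleC scaleC g"
    "\<forall>v\<in>T ` Y. T (g v) = v" by (elim exE conjE)
  obtain b where b: "finite b" "null_space T \<inter> Y \<subseteq> cspan b" using N unfolding cfinite_dim_def by blast
  obtain d where d: "finite d" "Z \<subseteq> cspan d" using Z(2) unfolding cfinite_dim_def by blast
  have "Y' \<subseteq> cspan (b \<union> g ` d)"
  proof
    fix x assume x: "x \<in> Y'"
    have "T (g (T x)) = T x" using x g(3) by (auto simp: Y'_def)
    then have "x - g (T x) \<in> null_space T \<inter> Y"
      using x g(1) unfolding null_space_def Y'_def
      by (auto simp: cblinfun_linear_simps intro: complex_vector.subspace_diff[OF Y])
    then have 1: "x - g (T x) \<in> cspan (b \<union> g ` d)"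
      using b(2) complex_vector.span_mono[of b "b \<union> g ` d"] by blast
    have "T x \<in> cspan d" using x d(2) by (auto simp: Y'_def)
    then have "g (T x) \<in> cspan (g ` d)"
      unfolding complex_vector_pair.linear_span_image[OF g(2)] by blast
    then have 2: "g (T x) \<in> cspan (b \<union> g ` d)"
      using complex_vector.span_mono[of "g ` d" "b \<union> g ` d"] by blast
    show "x \<in> cspan (b \<union> g ` d)"
      using complex_vector.span_add[OF 1 2] by simp
  qed
  moreover have "finite (b \<union> g ` d)" using b(1) d(1) by simp
  ultimately show ?thesis unfolding cfinite_dim_def Y'_def by (intro exI conjI)
qed

section \<open>Operators with closed range\<close>

lemma halving_sequence:
  assumes z: "z \<in> Z" and step: "\<And>z. z \<in> Z \<Longrightarrow> norm (z - T (s z)) \<le> norm z / 2 \<and> z - T (s z) \<in> Z"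
  shows "((\<lambda>z. z - T (s z)) ^^ n) z \<in> Z"
    "norm (((\<lambda>z. z - T (s z)) ^^ n) (z :: 'b::real_normed_vector)) \<le> norm z * (1/2) ^ n"
proof -
  have "((\<lambda>z. z - T (s z)) ^^ n) z \<in> Z \<and>
    norm (((\<lambda>z. z - T (s z)) ^^ n) z) \<le> norm z * (1/2) ^ n"
  proof (induction n)
    case (Suc n)
    then show ?case using step[of "((\<lambda>z. z - T (s z)) ^^ n) z"] by auto
  qed (simp add: z)
  then show "((\<lambda>z. z - T (s z)) ^^ n) z \<in> Z"
    "norm (((\<lambda>z. z - T (s z)) ^^ n) z) \<le> norm z * (1/2) ^ n" by blast+
qed

text \<open>Successive approximation: the residuals shrink geometrically and the corrections form an
  absolutely convergent series in the closed subspace \<open>Y\<close>. The set \<open>Z\<close> of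
  admissible residuals is kept free; it is the closure of the range in the closed range criterion
  and the range itself in the open mapping theorem.\<close>

lemma solve_by_halving:
  fixes T :: "'a::complex_banach \<Rightarrow>\<^sub>C\<^sub>L 'b::complex_normed_vector"
  assumes Y: "csubspace Y" "closed Y" and C: "0 \<le> C"
    and step: "\<And>z. z \<in> Z \<Longrightarrow> \<exists>x\<in>Y. norm x \<le> C * norm z \<and> norm (z - T x) \<le> norm z / 2 \<and> z - T x \<in> Z"
    and z: "z \<in> Z"
  shows "\<exists>x\<in>Y. T x = z \<and> norm x \<le> 2 * C * norm z"
proof -
  obtain s where s: "\<And>z. z \<in> Z \<Longrightarrow>
      s z \<in> Y \<and> norm (s z) \<le> C * norm z \<and> norm (z - T (s z)) \<le> norm z / 2 \<and> z - T (s z) \<in> Z"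
    using step by metis
  define r where "r n = ((\<lambda>z. z - T (s z)) ^^ n) z" for n
  have r: "r n \<in> Z" "norm (r n) \<le> norm z * (1/2) ^ n" for n
    unfolding r_def using halving_sequence[of z Z "cblinfun_apply T" s n] z s by auto
  have r0: "r 0 = z" and rS: "r (Suc n) = r n - T (s (r n))" for n by (simp_all add: r_def)
  have sb: "norm (s (r n)) \<le> C * norm z * (1/2) ^ n" for n
    using s[OF r(1)[of n]] mult_left_mono[OF r(2)[of n] C] by (simp add: mult.assoc)
  have geo: "(\<lambda>n. C * norm z * (1/2) ^ n) sums (C * norm z * 2)"
    using geometric_sums[of "1/2::real"] by (intro sums_mult) simp
  have summ: "summable (\<lambda>n. s (r n))"
    by (rule summable_comparison_test'[OF sums_summable[OF geo], of 0]) (use sb in auto)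
  define x where "x = (\<Sum>n. s (r n))"
  have x: "(\<lambda>n. s (r n)) sums x" unfolding x_def by (rule summable_sums[OF summ])
  have nsum: "summable (\<lambda>n. norm (s (r n)))"
    by (rule summable_comparison_test'[OF sums_summable[OF geo], of 0]) (use sb in auto)
  have part: "(\<Sum>i<n. s (r i)) \<in> Y" for n
    using s r(1) by (intro complex_vector.subspace_sum[OF Y(1)]) auto
  have "x \<in> Y"
    by (rule closed_sequentially[OF Y(2) part]) (use x in \<open>simp add: sums_def\<close>)
  moreover have "norm x \<le> 2 * C * norm z"
  proof -
    have "norm x \<le> (\<Sum>n. norm (s (r n)))"
      unfolding x_def by (rule summable_norm[OF nsum])
    also have "\<dots> \<le> (\<Sum>n. C * norm z * (1/2) ^ n)"
      by (rule suminf_le[OF sb nsum sums_summable[OF geo]])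
    also have "\<dots> = 2 * C * norm z" using sums_unique[OF geo] by simp
    finally show ?thesis .
  qed
  moreover have "T x = z"
  proof -
    have "T (\<Sum>i<n. s (r i)) = z - r n" for n
      by (induction n) (simp_all add: r0 rS cblinfun_linear_simps)
    moreover have "(\<lambda>n. T (\<Sum>i<n. s (r i))) \<longlonglongrightarrow> T x"
      using x unfolding sums_def by (rule cblinfun_tendsto)
    ultimately have "(\<lambda>n. z - r n) \<longlonglongrightarrow> T x" by simp
    moreover have "(\<lambda>n. z - r n) \<longlonglongrightarrow> z - 0"
    proof (rule tendsto_diff[OF tendsto_const], rule Lim_null_comparison[OF always_eventually])
      show "\<forall>n. norm (r n) \<le> norm z * (1/2) ^ n" using r(2) by blast
      show "(\<lambda>n. norm z * (1/2) ^ n) \<longlonglongrightarrow> 0"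
        by (intro tendsto_mult_right_zero LIMSEQ_realpow_zero) auto
    qed
    ultimately have "T x = z - 0" by (rule LIMSEQ_unique)
    then show ?thesis by simp
  qed
  ultimately show ?thesis by blast
qed

lemma closed_range_if_bounded_preimages:
  fixes T :: "'a::complex_banach \<Rightarrow>\<^sub>C\<^sub>L 'b::complex_normed_vector"
  assumes Y: "csubspace Y" "closed Y"
    and pre: "\<And>x. x \<in> Y \<Longrightarrow> \<exists>x'\<in>Y. T x' = T x \<and> norm x' \<le> C * norm (T x)"
  shows "closed (T ` Y)"
proof -
  have TY: "csubspace (T ` Y)" by (rule csubspace_cblinfun_image[OF Y(1)])
  define Z where "Z = closure (T ` Y)"
  \<comment> \<open>\<open>z\<close> is approximated by some \<open>T y\<close> of norm at most
    \<open>2 * norm z\<close>, and \<open>pre\<close> exchanges \<open>y\<close> for a preimage of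
    controlled norm. This gives the factor 2, while the modulus allows for a negative
    \<open>C\<close>.\<close>
  have step: "\<exists>x\<in>Y. norm x \<le> (2 * \<bar>C\<bar>) * norm z \<and> norm (z - T x) \<le> norm z / 2 \<and> z - T x \<in> Z"
    if z: "z \<in> Z" for z
  proof (cases "z = 0")
    case True
    then show ?thesis using z complex_vector.subspace_0[OF Y(1)]
      by (intro bexI[of _ 0]) (auto simp: cblinfun_linear_simps)
  next
    case False
    then obtain y where y: "y \<in> Y" "dist (T y) z < norm z / 2"
      using z closure_approachable[of z "T ` Y"] unfolding Z_def by (auto dest: spec[of _ "norm z / 2"])
    obtain x where x: "x \<in> Y" "T x = T y" "norm x \<le> C * norm (T y)"
      using pre[OF y(1)] by blast
    have d: "norm (z - T x) < norm z / 2" using y(2) by (simp add: dist_norm norm_minus_commute x(2))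
    have "norm (T y) \<le> norm z + norm (z - T x)"
      using norm_triangle_ineq4[of z "z - T x"] x(2) by simp
    then have "norm (T y) \<le> 2 * norm z" using d norm_ge_zero[of z] by linarith
    then have "C * norm (T y) \<le> \<bar>C\<bar> * (2 * norm z)"
      by (intro mult_mono) auto
    moreover have "z - T x \<in> Z"
    proof -
      obtain w where w: "\<And>n. w n \<in> T ` Y" "w \<longlonglongrightarrow> z"
        using z unfolding Z_def closure_sequential by blast
      have "(\<lambda>n. w n - T x) \<longlonglongrightarrow> z - T x" by (intro tendsto_diff w tendsto_const)
      moreover have "w n - T x \<in> T ` Y" for n
        using w(1) x(1) by (intro complex_vector.subspace_diff[OF TY]) auto
      ultimately show ?thesis unfolding Z_def closure_sequential by (intro exI conjI allI)
    qed
    ultimately show ?thesis using x(1,3) d by (intro bexI[of _ x]) auto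
  qed
  have "\<exists>x\<in>Y. T x = z \<and> norm x \<le> 2 * (2 * \<bar>C\<bar>) * norm z" if "z \<in> Z" for z
    by (rule solve_by_halving[OF Y _ step that]) auto
  then have "Z \<subseteq> T ` Y" by blast
  then show ?thesis unfolding Z_def by (metis closure_subset_eq)
qed

text \<open>Closedness makes \<open>Z\<close> complete in its own metric, so Baire's theorem applies
  relative to \<open>Z\<close>, which may have empty interior in the whole space.\<close>

lemma baire_closed:
  fixes Z :: "'a::{complete_space} set"
  assumes Z: "closed Z" "Z \<noteq> {}" and F: "\<And>n::nat. closed (F n)" and cov: "Z \<subseteq> (\<Union>n. F n)"
  shows "\<exists>n. \<exists>z\<in>Z. \<exists>e>0. \<forall>w\<in>Z. dist z w < e \<longrightarrow> w \<in> F n"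
proof -
  interpret S: Submetric UNIV dist Z by unfold_locales simp
  have top: "S.sub.mtopology = top_of_set Z" using S.mtopology_submetric by simp
  have mc: "S.sub.mcomplete"
    by (rule S.closedin_mcomplete_imp_mcomplete) (use Z in \<open>auto simp: complete_UNIV\<close>)
  have "\<exists>n. S.sub.mtopology interior_of (Z \<inter> F n) \<noteq> {}"
  proof (rule ccontr)
    assume "\<not> ?thesis"
    then have "S.sub.mtopology interior_of \<Union>(range (\<lambda>n. Z \<inter> F n)) = {}"
      by (intro S.sub.metric_Baire_category_alt mc) (auto simp: top intro!: closedin_closed_Int F)
    moreover have "\<Union>(range (\<lambda>n. Z \<inter> F n)) = topspace (top_of_set Z)" using cov by auto
    ultimately show False using Z(2) by (metis interior_of_topspace top topspace_euclidean_subtopology)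
  qed
  then obtain n z where z: "z \<in> top_of_set Z interior_of (Z \<inter> F n)" unfolding top by blast
  then obtain U where U: "openin (top_of_set Z) U" "z \<in> U" "U \<subseteq> Z \<inter> F n"
    unfolding interior_of_def by blast
  then obtain e where "e > 0" "\<forall>w\<in>Z. dist w z < e \<longrightarrow> w \<in> U"
    unfolding openin_euclidean_subtopology_iff by blast
  then show ?thesis using U by (metis IntD1 IntD2 dist_commute subsetD)
qed

lemma open_mapping:
  fixes T :: "'a::complex_banach \<Rightarrow>\<^sub>C\<^sub>L 'b::complex_banach"
  assumes Y: "csubspace Y" "closed Y" and cl: "closed (T ` Y)"
  obtains C where "C > 0" "\<And>z. z \<in> T ` Y \<Longrightarrow> \<exists>x\<in>Y. T x = z \<and> norm x \<le> C * norm z"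
proof -
  have TY: "csubspace (T ` Y)" by (rule csubspace_cblinfun_image[OF Y(1)])
  define F where "F n = closure (T ` {x\<in>Y. norm x \<le> real n})" for n :: nat
  have cov: "T ` Y \<subseteq> (\<Union>n. F n)"
  proof
    fix z assume "z \<in> T ` Y"
    then obtain x where x: "x \<in> Y" "z = T x" by blast
    obtain n where "norm x \<le> real n" using real_arch_simple by blast
    then have "z \<in> T ` {x\<in>Y. norm x \<le> real n}" using x by blast
    then show "z \<in> (\<Union>n. F n)" unfolding F_def by (intro UN_I[of n] subsetD[OF closure_subset]) auto
  qed
  have ne: "T ` Y \<noteq> {}" using complex_vector.subspace_0[OF Y(1)] by blast
  have "closed (F n)" for n by (simp add: F_def)
  from baire_closed[OF cl ne this cov]
  obtain n z0 e where e: "z0 \<in> T ` Y" "e > 0" "\<And>w. w \<in> T ` Y \<Longrightarrow> dist z0 w < e \<Longrightarrow> w \<in> F n"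
    by blast
  \<comment> \<open>A residual \<open>z\<close> is scaled to norm \<open>e / 2\<close>, approximated
    by the image of a vector of norm at most \<open>2 * n\<close>, and scaled back by
    \<open>2 * norm z / e\<close>. Replacing \<open>n\<close> by \<open>n + 1\<close> keeps
    \<open>C\<close> positive when \<open>n = 0\<close>; the accuracy \<open>e / 4\<close> used
    below turns into \<open>norm z / 2\<close>.\<close>
  define C where "C = 4 * (real n + 1) / e"
  have C: "C > 0" using e(2) by (simp add: C_def)
  have approx: "\<exists>x\<in>Y. norm x \<le> 2 * real n \<and> norm (z - T x) < d"
    if z: "z \<in> T ` Y" "norm z < e" and d: "d > 0" for z d
  proof -
    \<comment> \<open>Both \<open>z0\<close> and \<open>z0 + z\<close> are limits of images of
      vectors of norm at most \<open>n\<close>; subtracting approximants moves the centre of the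
      ball to 0.\<close>
    have "z0 + z \<in> F n"
      using e(1) z by (intro e(3) complex_vector.subspace_add[OF TY]) (auto simp: dist_norm)
    moreover have "z0 \<in> F n" using e by (intro e(3)) auto
    ultimately have "\<exists>v\<in>T ` {x\<in>Y. norm x \<le> real n}. dist v (z0 + z) < d / 2"
      and "\<exists>v\<in>T ` {x\<in>Y. norm x \<le> real n}. dist v z0 < d / 2"
      using half_gt_zero[OF d] unfolding F_def closure_approachable by blast+
    then obtain x y where x: "x \<in> Y" "norm x \<le> real n" "dist (T x) (z0 + z) < d / 2"
      and y: "y \<in> Y" "norm y \<le> real n" "dist (T y) z0 < d / 2"
      by auto
    show ?thesis
    proof (intro bexI conjI)
      show "x - y \<in> Y" by (rule complex_vector.subspace_diff[OF Y(1) x(1) y(1)])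
      show "norm (x - y) \<le> 2 * real n" using norm_triangle_ineq4[of x y] x(2) y(2) by simp
      have "norm (z - T (x - y)) = norm ((z0 + z - T x) - (z0 - T y))"
        by (simp add: cblinfun_linear_simps algebra_simps)
      also have "\<dots> \<le> norm (z0 + z - T x) + norm (z0 - T y)" by (rule norm_triangle_ineq4)
      also have "\<dots> < d" using x(3) y(3) by (simp add: dist_norm norm_minus_commute)
      finally show "norm (z - T (x - y)) < d" .
    qed
  qed
  have step: "\<exists>x\<in>Y. norm x \<le> C * norm z \<and> norm (z - T x) \<le> norm z / 2 \<and> z - T x \<in> T ` Y"
    if z: "z \<in> T ` Y" for z
  proof (cases "z = 0")
    case True
    then show ?thesis using z complex_vector.subspace_0[OF Y(1)]
      by (intro bexI[of _ 0]) (auto simp: cblinfun_linear_simps)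
  next
    case False
    define t where "t = e / (2 * norm z)"
    have t: "t > 0" using False e(2) by (simp add: t_def)
    have "complex_of_real t *\<^sub>C z \<in> T ` Y" by (rule complex_vector.subspace_scale[OF TY z])
    moreover have "norm (complex_of_real t *\<^sub>C z) < e"
    proof -
      have "norm (complex_of_real t *\<^sub>C z) = t * norm z" using t by (simp add: norm_scaleC)
      also have "\<dots> < e" using False e(2) by (simp add: t_def)
      finally show ?thesis .
    qed
    moreover have "e / 4 > 0" using e(2) by simp
    ultimately obtain x where x: "x \<in> Y" "norm x \<le> 2 * real n" "norm (complex_of_real t *\<^sub>C z - T x) < e / 4"
      using approx by blast
    define u where "u = complex_of_real (inverse t) *\<^sub>C x"
    have u: "u \<in> Y" unfolding u_def by (rule complex_vector.subspace_scale[OF Y(1) x(1)])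
    have "norm u \<le> inverse t * (2 * real n)"
      using x(2) t by (simp add: u_def norm_scaleC norm_inverse norm_divide mult_left_mono divide_right_mono)
    also have "\<dots> \<le> C * norm z"
      using e(2) False by (simp add: C_def t_def field_simps)
    finally have 1: "norm u \<le> C * norm z" .
    have "z - T u = complex_of_real (inverse t) *\<^sub>C (complex_of_real t *\<^sub>C z - T x)"
      using t by (simp add: u_def complex_vector.scale_right_diff_distrib cblinfun_linear_simps)
    then have "norm (z - T u) = inverse t * norm (complex_of_real t *\<^sub>C z - T x)"
      using t by (simp add: norm_scaleC norm_inverse norm_divide divide_inverse_commute)
    also have "\<dots> \<le> inverse t * (e / 4)" using x(3) t by (intro mult_left_mono) auto
    also have "\<dots> = norm z / 2" using False e(2) by (simp add: t_def field_simps)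
    finally have 2: "norm (z - T u) \<le> norm z / 2" .
    show ?thesis
      using u 1 2 complex_vector.subspace_diff[OF TY z] by (intro bexI[of _ u]) auto
  qed
  show thesis
  proof (rule that[of "2 * C"])
    show "2 * C > 0" using C by simp
    show "\<exists>x\<in>Y. T x = z \<and> norm x \<le> 2 * C * norm z" if "z \<in> T ` Y" for z
      by (rule solve_by_halving[OF Y less_imp_le[OF C] step that])
  qed
qed

lemma cblinfun_id_apply: "cblinfun_apply cblinfun_id x = x"
  by transfer simp

lemma shift_apply: "shift T w x = T x - w *\<^sub>C x"
  by (simp add: cblinfun_linear_simps cblinfun_id_apply)

section \<open>Upper semi-Fredholm operators and a priori estimates\<close>

text \<open>
  On a closed subspace, being upper semi-Fredholm amounts to an a priori estimate up to finitely many
  functionals. This turns perturbation, restriction and spectral inclusion statements into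
  manipulations of inequalities.
\<close>

definition lower_estimate ::
  "'a::complex_normed_vector set \<Rightarrow> ('a \<Rightarrow>\<^sub>C\<^sub>L 'b::complex_normed_vector) \<Rightarrow> ('a \<Rightarrow>\<^sub>C\<^sub>L complex) set \<Rightarrow> real \<Rightarrow> bool"
  where "lower_estimate Y T \<Phi> C \<longleftrightarrow>
    finite \<Phi> \<and> (\<forall>x\<in>Y. norm x \<le> C * (norm (T x) + (\<Sum>\<phi>\<in>\<Phi>. cmod (cblinfun_apply \<phi> x))))"

lemma lower_estimate_subset: "lower_estimate Y T \<Phi> C \<Longrightarrow> Z \<subseteq> Y \<Longrightarrow> lower_estimate Z T \<Phi> C"
  by (auto simp: lower_estimate_def)

lemma lower_estimate_mono:
  assumes est: "lower_estimate Y T \<Phi> C" and CD: "C \<le> D"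
  shows "lower_estimate Y T \<Phi> D"
  unfolding lower_estimate_def
proof (intro conjI ballI)
  show "finite \<Phi>" using est by (simp add: lower_estimate_def)
  fix x assume "x \<in> Y"
  then have "norm x \<le> C * (norm (T x) + (\<Sum>\<phi>\<in>\<Phi>. cmod (cblinfun_apply \<phi> x)))"
    using est by (simp add: lower_estimate_def)
  also have "\<dots> \<le> D * (norm (T x) + (\<Sum>\<phi>\<in>\<Phi>. cmod (cblinfun_apply \<phi> x)))"
    using CD by (intro mult_right_mono add_nonneg_nonneg sum_nonneg) auto
  finally show "norm x \<le> D * (norm (T x) + (\<Sum>\<phi>\<in>\<Phi>. cmod (cblinfun_apply \<phi> x)))" .
qed

lemma lower_estimate_pos:
  assumes "lower_estimate Y T \<Phi> C"
  obtains D where "D > 0" "lower_estimate Y T \<Phi> D"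
  by (rule that[of "max C 1"]) (auto intro: lower_estimate_mono[OF assms])

text \<open>Half of \<open>norm x\<close> absorbs the perturbation
  \<open>C * cmod w * norm x\<close>, at the price of doubling the constant; the functionals do not
  change.\<close>

lemma lower_estimate_shift:
  assumes est: "lower_estimate Y T \<Phi> C" and C: "C > 0" and w: "C * cmod w \<le> 1 / 2"
  shows "lower_estimate Y (shift T w) \<Phi> (2 * C)"
  unfolding lower_estimate_def
proof (intro conjI ballI)
  show "finite \<Phi>" using est by (simp add: lower_estimate_def)
  fix x assume x: "x \<in> Y"
  let ?S = "\<Sum>\<phi>\<in>\<Phi>. cmod (cblinfun_apply \<phi> x)"
  have Tx: "norm (T x) \<le> norm (shift T w x) + cmod w * norm x"
  proof -
    have "T x = shift T w x + w *\<^sub>C x" by (simp add: shift_apply)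
    then show ?thesis using norm_triangle_ineq[of "shift T w x" "w *\<^sub>C x"] by (simp add: norm_scaleC)
  qed
  have "norm x \<le> C * (norm (T x) + ?S)" using est x by (simp add: lower_estimate_def)
  also have "\<dots> \<le> C * (norm (shift T w x) + cmod w * norm x + ?S)"
    using Tx C by (intro mult_left_mono) auto
  also have "\<dots> = C * (norm (shift T w x) + ?S) + (C * cmod w) * norm x" by (simp add: algebra_simps)
  also have "\<dots> \<le> C * (norm (shift T w x) + ?S) + (1 / 2) * norm x"
    using w by (intro add_left_mono mult_right_mono) auto
  finally show "norm x \<le> 2 * C * (norm (shift T w x) + ?S)" by simp
qed

lemma Cauchy_eventually:
  fixes X :: "nat \<Rightarrow> 'a::metric_space"
  assumes "Cauchy X" "e > 0"
  shows "\<forall>\<^sub>F M in sequentially. \<forall>m\<ge>M. \<forall>n\<ge>M. dist (X m) (X n) < e"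
proof -
  obtain M where "\<forall>m\<ge>M. \<forall>n\<ge>M. dist (X m) (X n) < e"
    using assms unfolding Cauchy_def by blast
  then show ?thesis unfolding eventually_sequentially by (metis order_trans)
qed

lemma common_subsequence:
  fixes x :: "nat \<Rightarrow> 'a::complex_normed_vector" and \<Phi> :: "('a \<Rightarrow>\<^sub>C\<^sub>L complex) set"
  assumes "finite \<Phi>" "bounded (range x)"
  shows "\<exists>r::nat\<Rightarrow>nat. strict_mono r \<and> (\<forall>\<phi>\<in>\<Phi>. Cauchy (\<lambda>n. cblinfun_apply \<phi> (x (r n))))"
  using assms(1)
proof (induction \<Phi> rule: finite_induct)
  case empty
  show ?case by (intro exI[of _ id]) (simp add: strict_mono_def)
next
  case (insert \<psi> \<Phi>)
  then obtain r where r: "strict_mono (r::nat\<Rightarrow>nat)" "\<And>\<phi>. \<phi> \<in> \<Phi> \<Longrightarrow> Cauchy (\<lambda>n. cblinfun_apply \<phi> (x (r n)))" by blast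
  obtain K where K: "\<And>n. norm (x n) \<le> K" using assms(2) by (auto simp: bounded_iff)
  obtain D where D: "D > 0" "\<And>y. cmod (\<psi> y) \<le> D * norm y" by (rule cblinfun_bound_pos[of \<psi>]) (rule that)
  have "cmod (\<psi> (x (r n))) \<le> D * K" for n
    by (rule order_trans[OF D(2) mult_left_mono[OF K]]) (use D(1) in simp)
  then have "bounded (range (\<lambda>n. \<psi> (x (r n))))" by (auto simp: bounded_iff)
  then obtain l q where q: "strict_mono (q::nat\<Rightarrow>nat)" "((\<lambda>n. \<psi> (x (r n))) \<circ> q) \<longlonglongrightarrow> l"
    using bounded_imp_convergent_subsequence by blast
  have "Cauchy (\<lambda>n. \<psi> (x ((r \<circ> q) n)))"
    using LIMSEQ_imp_Cauchy[OF q(2)] by (simp add: o_def)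
  moreover have "Cauchy (\<lambda>n. cblinfun_apply \<phi> (x ((r \<circ> q) n)))" if "\<phi> \<in> \<Phi>" for \<phi>
    using Cauchy_subseq_Cauchy[OF r(2)[OF that] q(1)] by (simp add: o_def)
  ultimately show ?case
    by (intro exI[of _ "r \<circ> q"] conjI strict_mono_o[OF r(1) q(1)]) auto
qed

lemma lower_estimate_subsequence:
  fixes T :: "'a::complex_banach \<Rightarrow>\<^sub>C\<^sub>L 'b::complex_normed_vector"
  assumes est: "lower_estimate Y T \<Phi> C" and Y: "csubspace Y"
    and x: "\<And>n. x n \<in> Y" "bounded (range x)" "Cauchy (\<lambda>n. T (x n))"
  shows "\<exists>r::nat\<Rightarrow>nat. strict_mono r \<and> convergent (x \<circ> r)"
proof -
  obtain D where D: "D > 0" "lower_estimate Y T \<Phi> D" by (rule lower_estimate_pos[OF est])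
  have fin: "finite \<Phi>" using est by (simp add: lower_estimate_def)
  obtain r where r: "strict_mono (r::nat\<Rightarrow>nat)" "\<And>\<phi>. \<phi> \<in> \<Phi> \<Longrightarrow> Cauchy (\<lambda>n. cblinfun_apply \<phi> (x (r n)))"
    using common_subsequence[OF fin x(2)] by blast
  have Tr: "Cauchy (\<lambda>n. T (x (r n)))"
    using Cauchy_subseq_Cauchy[OF x(3) r(1)] by (simp add: o_def)
  have "Cauchy (x \<circ> r)"
    unfolding Cauchy_def
  proof (intro allI impI)
    fix e :: real assume e: "e > 0"
    \<comment> \<open>The estimate involves \<open>card \<Phi> + 1\<close> terms of size at most
      \<open>d\<close>; the additional unit makes the final inequality strict.\<close>
    define d where "d = e / (D * (real (card \<Phi>) + 2))"
    have d: "d > 0" using e D(1) by (simp add: d_def)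
    have "\<forall>\<^sub>F M in sequentially. (\<forall>m\<ge>M. \<forall>n\<ge>M. dist (T (x (r m))) (T (x (r n))) < d) \<and>
        (\<forall>\<phi>\<in>\<Phi>. \<forall>m\<ge>M. \<forall>n\<ge>M. dist (cblinfun_apply \<phi> (x (r m))) (cblinfun_apply \<phi> (x (r n))) < d)"
      using Cauchy_eventually[OF Tr d] Cauchy_eventually[OF r(2) d] fin
      by (intro eventually_conj eventually_ball_finite) auto
    then obtain M where M: "\<And>m n. m \<ge> M \<Longrightarrow> n \<ge> M \<Longrightarrow> dist (T (x (r m))) (T (x (r n))) < d"
      "\<And>\<phi> m n. \<phi> \<in> \<Phi> \<Longrightarrow> m \<ge> M \<Longrightarrow> n \<ge> M \<Longrightarrow> dist (cblinfun_apply \<phi> (x (r m))) (cblinfun_apply \<phi> (x (r n))) < d"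
      using eventually_happens'[OF sequentially_bot] by blast
    have "dist ((x \<circ> r) m) ((x \<circ> r) n) < e" if mn: "m \<ge> M" "n \<ge> M" for m n
    proof -
      let ?y = "x (r m) - x (r n)"
      have "?y \<in> Y" by (rule complex_vector.subspace_diff[OF Y x(1) x(1)])
      then have "norm ?y \<le> D * (norm (T ?y) + (\<Sum>\<phi>\<in>\<Phi>. cmod (cblinfun_apply \<phi> ?y)))"
        using D(2) by (simp add: lower_estimate_def)
      also have "\<dots> \<le> D * (d + (\<Sum>\<phi>\<in>\<Phi>. d))"
      proof (intro mult_left_mono add_mono sum_mono)
        show "norm (T ?y) \<le> d" using M(1)[OF mn] by (simp add: dist_norm cblinfun_linear_simps)
        show "cmod (cblinfun_apply \<phi> ?y) \<le> d" if "\<phi> \<in> \<Phi>" for \<phi>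
          using M(2)[OF that mn] by (simp add: dist_norm cblinfun_linear_simps)
      qed (use D in auto)
      also have "\<dots> = D * d * (real (card \<Phi>) + 1)" by (simp add: algebra_simps)
      also have "\<dots> < D * d * (real (card \<Phi>) + 2)"
        using D(1) d by (intro mult_strict_left_mono) auto
      also have "\<dots> = e" unfolding d_def using D(1) by (simp add: divide_simps)
      finally show ?thesis by (simp add: dist_norm)
    qed
    then show "\<exists>M. \<forall>m\<ge>M. \<forall>n\<ge>M. dist ((x \<circ> r) m) ((x \<circ> r) n) < e" by blast
  qed
  then show ?thesis using r(1) by (auto simp: Cauchy_convergent_iff)
qed

text \<open>A form of properness on bounded subsets of \<open>Y\<close>. It carries no constants,
  which is what lets it pass between \<open>T\<close>, its powers and its shifts.\<close>

definition subsequence_property ::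
  "'a::complex_normed_vector set \<Rightarrow> ('a \<Rightarrow>\<^sub>C\<^sub>L 'b::complex_normed_vector) \<Rightarrow> bool"
  where "subsequence_property Y T \<longleftrightarrow> (\<forall>x. (\<forall>n. x n \<in> Y) \<longrightarrow> bounded (range x) \<longrightarrow>
    (\<lambda>n. T (x n)) \<longlonglongrightarrow> 0 \<longrightarrow> (\<exists>r::nat\<Rightarrow>nat. strict_mono r \<and> convergent (x \<circ> r)))"

lemma subsequence_propertyD:
  assumes "subsequence_property Y T" "\<And>n. x n \<in> Y" "bounded (range x)" "(\<lambda>n. T (x n)) \<longlonglongrightarrow> 0"
  obtains r :: "nat \<Rightarrow> nat" and l where "strict_mono r" "(x \<circ> r) \<longlonglongrightarrow> l"
  using assms unfolding subsequence_property_def convergent_def by blast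

lemma lower_estimate_imp_subsequence_property:
  fixes T :: "'a::complex_banach \<Rightarrow>\<^sub>C\<^sub>L 'b::complex_normed_vector"
  assumes "lower_estimate Y T \<Phi> C" "csubspace Y"
  shows "subsequence_property Y T"
  unfolding subsequence_property_def
  by (intro allI impI lower_estimate_subsequence[OF assms]) (auto intro: LIMSEQ_imp_Cauchy)

text \<open>By the open mapping theorem the sequence differs from elements of the null space by
  vectors tending to 0, and in the finite-dimensional null space bounded sequences
  subconverge.\<close>

lemma upper_semi_fredholm_imp_subsequence_property:
  fixes T :: "'a::complex_banach \<Rightarrow>\<^sub>C\<^sub>L 'a"
  assumes usf: "upper_semi_fredholm_on Y T" and Y: "csubspace Y" "closed Y"
  shows "subsequence_property Y T"
  unfolding subsequence_property_def
proof (intro allI impI)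
  fix x assume x: "\<forall>n. x n \<in> Y" "bounded (range x)" "(\<lambda>n. T (x n)) \<longlonglongrightarrow> 0"
  have cl: "closed (T ` Y)" and fin: "cfinite_dim (null_space T \<inter> Y)"
    using usf by (auto simp: upper_semi_fredholm_on_def ecdim_def split: if_splits)
  obtain C where C: "C > 0" "\<And>z. z \<in> T ` Y \<Longrightarrow> \<exists>x\<in>Y. T x = z \<and> norm x \<le> C * norm z"
    by (rule open_mapping[OF Y cl]) (rule that)
  have "\<exists>z\<in>Y. T z = T (x n) \<and> norm z \<le> C * norm (T (x n))" for n
    using x(1) by (intro C(2)) auto
  then obtain z where z: "\<And>n. z n \<in> Y" "\<And>n. T (z n) = T (x n)" "\<And>n. norm (z n) \<le> C * norm (T (x n))"
    by metis
  have z0: "z \<longlonglongrightarrow> 0"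
  proof (rule Lim_null_comparison[OF always_eventually])
    show "\<forall>n. norm (z n) \<le> C * norm (T (x n))" using z(3) by blast
    show "(\<lambda>n. C * norm (T (x n))) \<longlonglongrightarrow> 0"
      by (rule tendsto_mult_right_zero[OF tendsto_norm_zero[OF x(3)]])
  qed
  obtain K where K: "\<And>n. norm (x n) \<le> K" using x(2) by (auto simp: bounded_iff)
  obtain L where L: "\<And>n. norm (z n) \<le> L"
    using convergent_imp_bounded[OF z0] by (auto simp: bounded_iff)
  have "norm (x n - z n) \<le> K + L" for n
    using norm_triangle_ineq4[of "x n" "z n"] K[of n] L[of n] by linarith
  then have "bounded (range (\<lambda>n. x n - z n))" by (auto simp: bounded_iff)
  moreover have "x n - z n \<in> null_space T \<inter> Y" for n
    using x(1) z by (auto simp: null_space_def cblinfun_linear_simps intro: complex_vector.subspace_diff[OF Y(1)])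
  moreover have "csubspace (null_space T \<inter> Y)"
    by (rule complex_vector.subspace_inter[OF csubspace_null_space Y(1)])
  ultimately obtain l r where r: "strict_mono (r::nat\<Rightarrow>nat)" "((\<lambda>n. x n - z n) \<circ> r) \<longlonglongrightarrow> l"
    using cfinite_dim_subsequence[OF _ fin, of "\<lambda>n. x n - z n"] by blast
  have "(\<lambda>n. ((\<lambda>n. x n - z n) \<circ> r) n + (z \<circ> r) n) \<longlonglongrightarrow> l + 0"
    by (intro tendsto_add r LIMSEQ_subseq_LIMSEQ[OF z0 r(1)])
  then have "(x \<circ> r) \<longlonglongrightarrow> l" by (simp add: o_def)
  then show "\<exists>r::nat\<Rightarrow>nat. strict_mono r \<and> convergent (x \<circ> r)"
    using r(1) unfolding convergent_def by (intro exI[of _ r] conjI exI[of _ l])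
qed

lemma subsequence_property_null_space:
  assumes S: "subsequence_property Y T" and Y: "csubspace Y"
  shows "cfinite_dim (null_space T \<inter> Y)"
proof (rule cfinite_dim_if_subsequences)
  show "csubspace (null_space T \<inter> Y)"
    by (rule complex_vector.subspace_inter[OF csubspace_null_space Y])
  fix x :: "nat \<Rightarrow> 'a"
  assume x: "\<And>n. x n \<in> null_space T \<inter> Y" "bounded (range x)"
  have "(\<lambda>n. T (x n)) = (\<lambda>_. 0)" using x(1) by (auto simp: null_space_def)
  then have "(\<lambda>n. T (x n)) \<longlonglongrightarrow> 0" by simp
  moreover have "\<forall>n. x n \<in> Y" using x(1) by blast
  ultimately show "\<exists>r::nat\<Rightarrow>nat. strict_mono r \<and> convergent (x \<circ> r)"
    using S x(2) unfolding subsequence_property_def by blast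
qed

lemma normalized_witness:
  fixes g :: "'i \<Rightarrow> 'a::complex_normed_vector \<Rightarrow>\<^sub>C\<^sub>L complex" and T :: "'a \<Rightarrow>\<^sub>C\<^sub>L 'b::complex_normed_vector"
  assumes Y: "csubspace Y" and y: "y \<in> Y" "norm y > C * (norm (T y) + (\<Sum>i\<in>I. cmod (g i y)))" and C: "C > 0"
  shows "\<exists>x\<in>Y. norm x = 1 \<and> norm (T x) + (\<Sum>i\<in>I. cmod (g i x)) < 1 / C"
proof -
  have "C * (norm (T y) + (\<Sum>i\<in>I. cmod (g i y))) \<ge> 0"
    using C by (intro mult_nonneg_nonneg add_nonneg_nonneg sum_nonneg) auto
  then have ny: "norm y > 0" using y(2) by linarith
  define x where "x = complex_of_real (inverse (norm y)) *\<^sub>C y"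
  have "norm (T x) = inverse (norm y) * norm (T y)" "cmod (g i x) = inverse (norm y) * cmod (g i y)" for i
    unfolding x_def cblinfun_apply_scaleC norm_scaleC norm_of_real using ny by simp_all
  then have "norm (T x) + (\<Sum>i\<in>I. cmod (g i x)) = inverse (norm y) * (norm (T y) + (\<Sum>i\<in>I. cmod (g i y)))"
    by (simp only: sum_distrib_left distrib_left)
  also have "\<dots> < 1 / C" using y(2) ny C by (simp add: field_simps)
  finally have "norm (T x) + (\<Sum>i\<in>I. cmod (g i x)) < 1 / C" .
  moreover have "norm x = 1" unfolding x_def norm_scaleC norm_of_real using ny by simp
  moreover have "x \<in> Y" unfolding x_def by (rule complex_vector.subspace_scale[OF Y y(1)])
  ultimately show ?thesis by blast
qed

text \<open>Compactness argument: if no constant works for the functionals biorthogonal to a basis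
  of the null space, normalized counterexamples subconverge to a unit vector that lies in the null
  space and is annihilated by these functionals, hence is 0.\<close>

lemma subsequence_property_estimate:
  fixes T :: "'a::complex_normed_vector \<Rightarrow>\<^sub>C\<^sub>L 'b::complex_normed_vector"
  assumes S: "subsequence_property Y T" and Y: "csubspace Y" "closed Y"
  obtains b and \<phi> :: "'a \<Rightarrow> 'a \<Rightarrow>\<^sub>C\<^sub>L complex" and C
  where "finite b" "\<not> cdependent b" "cspan b = null_space T \<inter> Y"
    "\<And>e e'. e \<in> b \<Longrightarrow> e' \<in> b \<Longrightarrow> \<phi> e e' = (if e = e' then 1 else 0)" "C > 0"
    "\<And>x. x \<in> Y \<Longrightarrow> norm x \<le> C * (norm (T x) + (\<Sum>e\<in>b. cmod (\<phi> e x)))"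
proof -
  have N: "csubspace (null_space T \<inter> Y)"
    by (rule complex_vector.subspace_inter[OF csubspace_null_space Y(1)])
  obtain b where b: "finite b" "b \<subseteq> null_space T \<inter> Y" "\<not> cdependent b" "null_space T \<inter> Y \<subseteq> cspan b"
    using cfinite_dim_basis[OF subsequence_property_null_space[OF S Y(1)]] by metis
  have sp: "cspan b = null_space T \<inter> Y" by (rule cspan_basis_eq[OF N b(2,4)])
  obtain \<phi> :: "'a \<Rightarrow> 'a \<Rightarrow>\<^sub>C\<^sub>L complex"
    where \<phi>: "\<And>e e'. e \<in> b \<Longrightarrow> e' \<in> b \<Longrightarrow> \<phi> e e' = (if e = e' then 1 else 0)"
    by (rule exists_biorthogonal_functionals[OF b(1,3)]) (rule that)
  have "\<exists>C>0. \<forall>x\<in>Y. norm x \<le> C * (norm (T x) + (\<Sum>e\<in>b. cmod (\<phi> e x)))"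
  proof (rule ccontr)
    assume neg: "\<not> ?thesis"
    have "\<exists>x\<in>Y. norm x = 1 \<and> norm (T x) + (\<Sum>e\<in>b. cmod (\<phi> e x)) < 1 / (real n + 1)" for n :: nat
    proof -
      obtain y where y: "y \<in> Y" "norm y > (real n + 1) * (norm (T y) + (\<Sum>e\<in>b. cmod (\<phi> e y)))"
        using neg by (metis not_less of_nat_0_le_iff add_nonneg_pos zero_less_one)
      then show ?thesis by (intro normalized_witness[OF Y(1)]) auto
    qed
    then obtain x where x: "\<And>n. x n \<in> Y" "\<And>n. norm (x n) = 1"
      "\<And>n. norm (T (x n)) + (\<Sum>e\<in>b. cmod (\<phi> e (x n))) < 1 / (real n + 1)" by metis
    have lim0: "(\<lambda>n. 1 / (real n + 1)) \<longlonglongrightarrow> 0"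
      using LIMSEQ_inverse_real_of_nat by (simp add: inverse_eq_divide add.commute)
    have T0: "(\<lambda>n. T (x n)) \<longlonglongrightarrow> 0"
    proof (rule Lim_null_comparison[OF always_eventually lim0], rule allI)
      fix n
      have "(\<Sum>e\<in>b. cmod (\<phi> e (x n))) \<ge> 0" by (simp add: sum_nonneg)
      then show "norm (T (x n)) \<le> 1 / (real n + 1)" using x(3)[of n] by linarith
    qed
    have \<phi>0: "(\<lambda>n. \<phi> e (x n)) \<longlonglongrightarrow> 0" if e: "e \<in> b" for e
    proof (rule Lim_null_comparison[OF always_eventually lim0], rule allI)
      fix n
      have "cmod (\<phi> e (x n)) \<le> (\<Sum>e\<in>b. cmod (\<phi> e (x n)))"
        by (rule member_le_sum[OF e]) (auto simp: b)
      then show "cmod (\<phi> e (x n)) \<le> 1 / (real n + 1)"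
        using x(3)[of n] norm_ge_zero[of "T (x n)"] by linarith
    qed
    have "bounded (range x)" using x(2) by (auto simp: bounded_iff)
    from subsequence_propertyD[OF S x(1) this T0]
    obtain r :: "nat \<Rightarrow> nat" and l where r: "strict_mono r" "(x \<circ> r) \<longlonglongrightarrow> l" .
    have "l \<in> Y" by (rule closed_sequentially[OF Y(2) _ r(2)]) (simp add: x)
    moreover have "T l = 0"
      using LIMSEQ_unique[OF cblinfun_tendsto[OF r(2), of T]] LIMSEQ_subseq_LIMSEQ[OF T0 r(1)] by (simp add: o_def)
    ultimately have "l \<in> cspan b" unfolding sp by (simp add: null_space_def)
    moreover have "\<phi> e l = 0" if "e \<in> b" for e
      using LIMSEQ_unique[OF cblinfun_tendsto[OF r(2), of "\<phi> e"]] LIMSEQ_subseq_LIMSEQ[OF \<phi>0[OF that] r(1)]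
      by (simp add: o_def)
    ultimately have "l = 0" using biorthogonal_expansion[OF b(1) \<phi>, of l] by simp
    moreover have "(\<lambda>n. norm ((x \<circ> r) n)) \<longlonglongrightarrow> norm l" by (rule tendsto_norm[OF r(2)])
    ultimately show False using x(2) by (simp add: LIMSEQ_const_iff)
  qed
  then obtain C where "C > 0" "\<And>x. x \<in> Y \<Longrightarrow> norm x \<le> C * (norm (T x) + (\<Sum>e\<in>b. cmod (\<phi> e x)))" by blast
  then show thesis using that[OF b(1,3) sp \<phi>] by simp
qed

lemma subsequence_property_closed_range:
  fixes T :: "'a::complex_banach \<Rightarrow>\<^sub>C\<^sub>L 'b::complex_normed_vector"
  assumes S: "subsequence_property Y T" and Y: "csubspace Y" "closed Y"
  shows "closed (T ` Y)"
proof -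
  obtain b and \<phi> :: "'a \<Rightarrow> 'a \<Rightarrow>\<^sub>C\<^sub>L complex" and C
    where b: "finite b" "cspan b = null_space T \<inter> Y"
    and \<phi>: "\<And>e e'. e \<in> b \<Longrightarrow> e' \<in> b \<Longrightarrow> \<phi> e e' = (if e = e' then 1 else 0)"
    and est: "\<And>x. x \<in> Y \<Longrightarrow> norm x \<le> C * (norm (T x) + (\<Sum>e\<in>b. cmod (\<phi> e x)))"
    by (rule subsequence_property_estimate[OF S Y]) (rule that)
  show ?thesis
  proof (rule closed_range_if_bounded_preimages[OF Y])
    fix x assume x: "x \<in> Y"
    \<comment> \<open>Removing the component in the null space makes the functionals vanish and
      leaves the image unchanged, so the estimate bounds a preimage.\<close>
    define y where "y = (\<Sum>e\<in>b. \<phi> e x *\<^sub>C e)"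
    have y: "y \<in> Y" "T y = 0"
      using biorthogonal_projection(1)[OF b(1) \<phi>, of x] unfolding y_def[symmetric] b(2)
      by (auto simp: null_space_def)
    have "(\<Sum>e\<in>b. cmod (\<phi> e (x - y))) = 0"
      by (intro sum.neutral ballI) (simp add: y_def biorthogonal_projection(2)[OF b(1) \<phi>])
    moreover have "x - y \<in> Y" by (rule complex_vector.subspace_diff[OF Y(1) x y(1)])
    moreover have "T (x - y) = T x" using y(2) by (simp add: cblinfun_linear_simps)
    ultimately show "\<exists>x'\<in>Y. T x' = T x \<and> norm x' \<le> C * norm (T x)"
      using est[of "x - y"] by (intro bexI[of _ "x - y"]) auto
  qed
qed

lemma biorthogonal_lower_estimate:
  fixes \<phi> :: "'a::complex_normed_vector \<Rightarrow> 'a \<Rightarrow>\<^sub>C\<^sub>L complex"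
    and T :: "'a \<Rightarrow>\<^sub>C\<^sub>L 'b::complex_normed_vector"
  assumes b: "finite b" and \<phi>: "\<And>e e'. e \<in> b \<Longrightarrow> e' \<in> b \<Longrightarrow> \<phi> e e' = (if e = e' then 1 else 0)"
    and est: "\<And>x. x \<in> Y \<Longrightarrow> norm x \<le> C * (norm (T x) + (\<Sum>e\<in>b. cmod (\<phi> e x)))"
  shows "lower_estimate Y T (\<phi> ` b) C"
proof -
  have "inj_on \<phi> b"
  proof (rule inj_onI)
    fix e e' assume "e \<in> b" "e' \<in> b" "\<phi> e = \<phi> e'"
    then show "e = e'" using \<phi>[of e e'] \<phi>[of e' e'] by (auto split: if_splits)
  qed
  then have "(\<Sum>\<psi>\<in>\<phi> ` b. cmod (cblinfun_apply \<psi> x)) = (\<Sum>e\<in>b. cmod (\<phi> e x))" for x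
    by (simp add: sum.reindex)
  then show ?thesis using b est by (simp add: lower_estimate_def)
qed

lemma subsequence_property_imp_usf:
  fixes T :: "'a::complex_banach \<Rightarrow>\<^sub>C\<^sub>L 'a"
  assumes "subsequence_property Y T" "csubspace Y" "closed Y"
  shows "upper_semi_fredholm_on Y T"
  using subsequence_property_closed_range[OF assms] subsequence_property_null_space[OF assms(1,2)]
  by (simp add: upper_semi_fredholm_on_def ecdim_def)

theorem upper_semi_fredholm_on_iff:
  fixes T :: "'a::complex_banach \<Rightarrow>\<^sub>C\<^sub>L 'a"
  assumes Y: "csubspace Y" "closed Y"
  shows "upper_semi_fredholm_on Y T \<longleftrightarrow> (\<exists>\<Phi> C. lower_estimate Y T \<Phi> C)"
proof
  assume "upper_semi_fredholm_on Y T"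
  then have S: "subsequence_property Y T"
    by (rule upper_semi_fredholm_imp_subsequence_property[OF _ Y])
  obtain b and \<phi> :: "'a \<Rightarrow> 'a \<Rightarrow>\<^sub>C\<^sub>L complex" and C
    where b: "finite b"
    and \<phi>: "\<And>e e'. e \<in> b \<Longrightarrow> e' \<in> b \<Longrightarrow> \<phi> e e' = (if e = e' then 1 else 0)"
    and est: "\<And>x. x \<in> Y \<Longrightarrow> norm x \<le> C * (norm (T x) + (\<Sum>e\<in>b. cmod (\<phi> e x)))"
    by (rule subsequence_property_estimate[OF S Y]) (rule that)
  show "\<exists>\<Phi> C. lower_estimate Y T \<Phi> C"
    using biorthogonal_lower_estimate[OF b \<phi> est] by (intro exI)
next
  assume "\<exists>\<Phi> C. lower_estimate Y T \<Phi> C"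
  then obtain \<Phi> C where "lower_estimate Y T \<Phi> C" by (elim exE)
  then show "upper_semi_fredholm_on Y T"
    by (intro subsequence_property_imp_usf lower_estimate_imp_subsequence_property Y)
qed

lemma lower_estimate_injective:
  fixes T :: "'a::complex_banach \<Rightarrow>\<^sub>C\<^sub>L 'a"
  assumes usf: "upper_semi_fredholm_on Y T" and Y: "csubspace Y" "closed Y"
    and inj: "null_space T \<inter> Y \<subseteq> {0}"
  obtains C where "C > 0" "\<And>x. x \<in> Y \<Longrightarrow> norm x \<le> C * norm (T x)"
proof -
  have "closed (T ` Y)" using usf by (simp add: upper_semi_fredholm_on_def)
  then obtain C where C: "C > 0" "\<And>z. z \<in> T ` Y \<Longrightarrow> \<exists>x\<in>Y. T x = z \<and> norm x \<le> C * norm z"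
    by (rule open_mapping[OF Y]) (rule that)
  have "norm x \<le> C * norm (T x)" if x: "x \<in> Y" for x
  proof -
    obtain y where y: "y \<in> Y" "T y = T x" "norm y \<le> C * norm (T x)" using C(2)[of "T x"] x by blast
    have "x - y \<in> null_space T \<inter> Y"
      using complex_vector.subspace_diff[OF Y(1) x y(1)] y(2) by (simp add: null_space_def cblinfun_linear_simps)
    then have "x = y" using inj by auto
    then show ?thesis using y(3) by simp
  qed
  then show thesis by (rule that[OF C(1)])
qed

lemma bounded_below_iff:
  fixes T :: "'a::complex_banach \<Rightarrow>\<^sub>C\<^sub>L 'a"
  shows "bounded_below T \<longleftrightarrow> (\<exists>C. \<forall>x. norm x \<le> C * norm (T x))"
proof
  assume bb: "bounded_below T"
  then have "cfinite_dim (null_space T)" unfolding bounded_below_def cfinite_dim_def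
    by (intro exI[of _ "{}"]) simp
  then have "upper_semi_fredholm T" using bb
    by (simp add: bounded_below_def upper_semi_fredholm_on_def ecdim_def)
  then obtain C where "\<And>x. x \<in> UNIV \<Longrightarrow> norm x \<le> C * norm (T x)"
    by (rule lower_estimate_injective) (use bb in \<open>auto simp: bounded_below_def\<close>)
  then show "\<exists>C. \<forall>x. norm x \<le> C * norm (T x)" by blast
next
  assume "\<exists>C. \<forall>x. norm x \<le> C * norm (T x)"
  then obtain C where C: "\<And>x. norm x \<le> C * norm (T x)" by blast
  have "closed (range T)"
    by (rule closed_range_if_bounded_preimages[where C = C]) (use C in auto)
  moreover have "null_space T = {0}"
  proof -
    have "x = 0" if "T x = 0" for x using C[of x] that by simp
    then show ?thesis by (auto simp: null_space_def cblinfun_linear_simps)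
  qed
  ultimately show "bounded_below T" by (simp add: bounded_below_def)
qed

lemma bounded_below_iff_usf:
  "bounded_below T \<longleftrightarrow> upper_semi_fredholm T \<and> null_space T = {0}"
proof -
  have "cfinite_dim {0::'a}" unfolding cfinite_dim_def by (intro exI[of _ "{}"]) simp
  then show ?thesis
    by (cases "null_space T = {0}") (simp_all add: bounded_below_def upper_semi_fredholm_on_def ecdim_def)
qed

section \<open>Vector-valued power series\<close>

text \<open>Majorant for the remainder in termwise differentiation: the geometric series
  differentiated twice, reindexed by 2.\<close>

lemma summable_twice_differentiated:
  fixes q R :: real
  assumes "0 < q" "0 \<le> R" "R < 1 / q"
  shows "summable (\<lambda>n. real n * real (n - Suc 0) * R ^ (n - 2) * q ^ n)"
proof -
  have 1: "summable (\<lambda>n. q ^ n * x ^ n)" if "norm x < 1 / q" for x :: real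
    unfolding power_mult_distrib[symmetric] using that assms(1)
    by (intro summable_geometric) (simp add: norm_mult field_simps abs_mult)
  have 2: "summable (\<lambda>n. diffs (\<lambda>n. q ^ n) n * x ^ n)" if "norm x < 1 / q" for x :: real
    by (rule termdiff_converges[OF that 1])
  have "summable (\<lambda>n. diffs (diffs (\<lambda>n. q ^ n)) n * R ^ n)"
    using assms by (intro termdiff_converges[OF _ 2, of _ "1 / q"]) auto
  then have "summable (\<lambda>n. real (n + 2) * real (n + 2 - Suc 0) * R ^ (n + 2 - 2) * q ^ (n + 2))"
    by (simp add: diffs_def mult_ac add_ac)
  then show ?thesis
    by (subst (asm) summable_iff_shift)
qed

lemma power_series_summable:
  fixes a :: "nat \<Rightarrow> 'a::complex_banach"
  assumes a: "\<And>n. norm (a n) \<le> K * q ^ n" and q: "q > 0" and w: "cmod w < 1 / q"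
  shows "summable (\<lambda>n. w ^ n *\<^sub>C a n)"
proof (rule summable_comparison_test')
  show "summable (\<lambda>n. K * (q * cmod w) ^ n)"
    using q w by (intro summable_mult summable_geometric) (simp add: field_simps)
  show "norm (w ^ n *\<^sub>C a n) \<le> K * (q * cmod w) ^ n" for n
    using mult_left_mono[OF a[of n], of "cmod w ^ n"]
    by (simp add: norm_scaleC norm_power power_mult_distrib mult_ac)
qed

lemma power_series_analytic:
  fixes a :: "nat \<Rightarrow> 'a::complex_banach"
  assumes a: "\<And>n. norm (a n) \<le> K * q ^ n" and q: "q > 0"
  shows "vector_analytic_on (\<lambda>w. \<Sum>n. w ^ n *\<^sub>C a n) (ball 0 (1 / q))"
  unfolding vector_analytic_on_def
proof
  fix z assume "z \<in> ball (0::complex) (1 / q)"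
  then have z: "cmod z < 1 / q" by simp
  then obtain R where R: "cmod z < R" "R < 1 / q" using dense by blast
  have R0: "0 \<le> R" using R(1) norm_ge_zero[of z] by linarith
  have K: "0 \<le> K" using order_trans[OF norm_ge_zero a[of 0]] by simp
  let ?f = "\<lambda>w. \<Sum>n. w ^ n *\<^sub>C a n"
  let ?t = "\<lambda>h n. ((z + h) ^ n - z ^ n - h * (of_nat n * z ^ (n - Suc 0))) *\<^sub>C a n"
  let ?b = "\<lambda>n. real n * real (n - Suc 0) * R ^ (n - 2) * q ^ n"
  have sb: "summable ?b" by (rule summable_twice_differentiated[OF q R0 R(2)])
  have tb: "norm (?t h n) \<le> (cmod h)\<^sup>2 * K * ?b n" if h: "h \<noteq> 0" "cmod h < R - cmod z" for h n
  proof -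
    have "cmod (z + h) \<le> R" using norm_triangle_ineq[of z h] h(2) by linarith
    then have *: "cmod (((z + h) ^ n - z ^ n) / h - of_nat n * z ^ (n - Suc 0))
        \<le> real n * real (n - Suc 0) * R ^ (n - 2) * cmod h"
      using lemma_termdiff3[OF h(1), of z R n] R(1) by simp
    have "(z + h) ^ n - z ^ n - h * (of_nat n * z ^ (n - Suc 0))
        = h * (((z + h) ^ n - z ^ n) / h - of_nat n * z ^ (n - Suc 0))"
      by (subst right_diff_distrib) (use h(1) in simp)
    then have "cmod ((z + h) ^ n - z ^ n - h * (of_nat n * z ^ (n - Suc 0)))
        \<le> cmod h * (real n * real (n - Suc 0) * R ^ (n - 2) * cmod h)"
      using mult_left_mono[OF *, of "cmod h"] by (simp add: norm_mult)
    then have "norm (?t h n) \<le> cmod h * (real n * real (n - Suc 0) * R ^ (n - 2) * cmod h) * (K * q ^ n)"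
      unfolding norm_scaleC using R0 a by (intro mult_mono) auto
    then show ?thesis by (simp add: power2_eq_square mult_ac)
  qed
  \<comment> \<open>One fixed admissible increment. The derivative series is summable because its
    terms are, up to division by \<open>h0\<close>, a combination of the terms at
    \<open>z + h0\<close>, the terms at \<open>z\<close> and the summable remainders.\<close>
  define h0 where "h0 = complex_of_real ((R - cmod z) / 2)"
  have h0: "h0 \<noteq> 0" "cmod h0 < R - cmod z" unfolding h0_def norm_of_real using R(1) by auto
  have st: "summable (?t h)" if "h \<noteq> 0" "cmod h < R - cmod z" for h
    by (rule summable_comparison_test'[OF summable_mult[OF sb] tb[OF that]])
  have sw: "summable (\<lambda>n. (z + h) ^ n *\<^sub>C a n)" if "cmod h < R - cmod z" for h
    using norm_triangle_ineq[of z h] that R(2) by (intro power_series_summable[OF a q]) linarith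
  have sz: "summable (\<lambda>n. z ^ n *\<^sub>C a n)" by (rule power_series_summable[OF a q z])
  let ?c = "\<lambda>n. (of_nat n * z ^ (n - Suc 0)) *\<^sub>C a n"
  have split: "?t h n = (z + h) ^ n *\<^sub>C a n - z ^ n *\<^sub>C a n - h *\<^sub>C ?c n" for h n
    by (simp add: complex_vector.scale_left_diff_distrib)
  have sc: "summable ?c"
  proof -
    have "summable (\<lambda>n. inverse h0 *\<^sub>C ((z + h0) ^ n *\<^sub>C a n - z ^ n *\<^sub>C a n - ?t h0 n))"
      by (intro bounded_linear.summable[OF bounded_linear_scaleC_right] summable_diff sw h0 sz st)
    moreover have "inverse h0 *\<^sub>C ((z + h0) ^ n *\<^sub>C a n - z ^ n *\<^sub>C a n - ?t h0 n) = ?c n" for n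
      unfolding split using h0(1) by (simp add: mult.assoc[symmetric])
    ultimately show ?thesis by simp
  qed
  define d where "d = suminf ?c"
  have rem: "norm (?f (z + h) - ?f z - h *\<^sub>C d) \<le> (cmod h)\<^sup>2 * (K * suminf ?b)"
    if h: "h \<noteq> 0" "cmod h < R - cmod z" for h
  proof -
    have "h *\<^sub>C d = (\<Sum>n. h *\<^sub>C ?c n)"
      unfolding d_def by (rule bounded_linear.suminf[OF bounded_linear_scaleC_right sc])
    moreover have "summable (\<lambda>n. h *\<^sub>C ?c n)"
      by (rule bounded_linear.summable[OF bounded_linear_scaleC_right sc])
    ultimately have "?f (z + h) - ?f z - h *\<^sub>C d = suminf (?t h)"
      unfolding split using sw[OF h(2)] sz by (simp add: suminf_diff summable_diff)
    also have "norm \<dots> \<le> (\<Sum>n. (cmod h)\<^sup>2 * K * ?b n)"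
      by (rule norm_suminf_le[OF tb[OF h] summable_mult[OF sb]])
    also have "\<dots> = (cmod h)\<^sup>2 * (K * suminf ?b)"
      using suminf_mult[OF sb, of "(cmod h)\<^sup>2 * K"] by (simp add: mult.assoc)
    finally show ?thesis .
  qed
  have "(?f has_derivative (\<lambda>h. h *\<^sub>C d)) (at z)"
    unfolding has_derivative_at
  proof
    show "bounded_linear (\<lambda>h. h *\<^sub>C d)"
      by (rule bounded_linear_intro[where K = "norm d"])
        (simp_all add: scaleC_add_left norm_scaleC scaleR_scaleC scaleR_conv_of_real)
    show "((\<lambda>h. norm (?f (z + h) - ?f z - h *\<^sub>C d) / norm h) \<longlongrightarrow> 0) (at 0)"
    proof (rule Lim_null_comparison)
      show "((\<lambda>h. cmod h * (K * suminf ?b)) \<longlongrightarrow> 0) (at 0)"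
        by (rule tendsto_eq_intros refl)+ simp
      have "\<forall>\<^sub>F h in at 0. h \<noteq> 0 \<and> cmod h < R - cmod z"
        using R(1) by (auto simp: eventually_at intro!: exI[of _ "R - cmod z"])
      then show "\<forall>\<^sub>F h in at 0. norm (norm (?f (z + h) - ?f z - h *\<^sub>C d) / norm h) \<le> cmod h * (K * suminf ?b)"
      proof (rule eventually_mono)
        fix h assume h: "h \<noteq> 0 \<and> cmod h < R - cmod z"
        then have "norm (?f (z + h) - ?f z - h *\<^sub>C d) / norm h \<le> (cmod h)\<^sup>2 * (K * suminf ?b) / norm h"
          by (intro divide_right_mono rem) auto
        then show "norm (norm (?f (z + h) - ?f z - h *\<^sub>C d) / norm h) \<le> cmod h * (K * suminf ?b)"
          using h by (simp add: power2_eq_square)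
      qed
    qed
  qed
  then show "\<exists>d. (?f has_derivative (\<lambda>h. h *\<^sub>C d)) (at z)" by blast
qed


section \<open>Iterated ranges\<close>

text \<open>\<open>Y\<close> is the range of a power of a B-Fredholm operator in most uses; the
  choice \<open>UNIV\<close> gives the ordinary semi-Fredholm case.\<close>

locale invariant_usf =
  fixes Y :: "'a::complex_banach set" and T :: "'a \<Rightarrow>\<^sub>C\<^sub>L 'a"
  assumes sub: "csubspace Y" and clo: "closed Y" and inv: "\<And>x. x \<in> Y \<Longrightarrow> T x \<in> Y"
    and usf: "upper_semi_fredholm_on Y T"
begin

lemma obtain_estimate:
  obtains \<Phi> C where "C > 0" "lower_estimate Y T \<Phi> C"
proof -
  obtain \<Phi> C where "lower_estimate Y T \<Phi> C"
    using usf unfolding upper_semi_fredholm_on_iff[OF sub clo] by (elim exE)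
  then show thesis by (rule lower_estimate_pos) (rule that)
qed

text \<open>An a priori estimate is inherited by every subspace, so closedness of one iterated range
  yields that of the next.\<close>

lemma
  shows iterate_subspace: "csubspace ((cblinfun_apply T ^^ m) ` Y)" and iterate_closed: "closed ((cblinfun_apply T ^^ m) ` Y)"
    and iterate_subset: "(cblinfun_apply T ^^ m) ` Y \<subseteq> Y"
proof -
  obtain \<Phi> C where est: "lower_estimate Y T \<Phi> C" by (rule obtain_estimate) (rule that)
  have "csubspace ((cblinfun_apply T ^^ m) ` Y) \<and> closed ((cblinfun_apply T ^^ m) ` Y) \<and> (cblinfun_apply T ^^ m) ` Y \<subseteq> Y"
  proof (induction m)
    case 0
    then show ?case using sub clo by simp
  next
    case (Suc m)
    have eq: "(cblinfun_apply T ^^ Suc m) ` Y = T ` ((cblinfun_apply T ^^ m) ` Y)" by (simp add: image_comp)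
    have "closed (T ` ((cblinfun_apply T ^^ m) ` Y))"
      using Suc lower_estimate_subset[OF est]
      by (intro subsequence_property_closed_range lower_estimate_imp_subsequence_property) auto
    then show ?case
      unfolding eq using Suc inv by (auto intro: csubspace_cblinfun_image)
  qed
  then show "csubspace ((cblinfun_apply T ^^ m) ` Y)" "closed ((cblinfun_apply T ^^ m) ` Y)" "(cblinfun_apply T ^^ m) ` Y \<subseteq> Y" by blast+
qed

lemma iterate_antimono:
  assumes "m \<le> n"
  shows "(cblinfun_apply T ^^ n) ` Y \<subseteq> (cblinfun_apply T ^^ m) ` Y"
proof -
  have "(cblinfun_apply T ^^ n) ` Y = (cblinfun_apply T ^^ m) ` ((cblinfun_apply T ^^ (n - m)) ` Y)"
    using assms by (simp add: image_comp flip: funpow_add)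
  then show ?thesis using iterate_subset by blast
qed

lemma iterate_usf: "upper_semi_fredholm_on ((cblinfun_apply T ^^ m) ` Y) T"
proof -
  obtain \<Phi> C where "lower_estimate Y T \<Phi> C" by (rule obtain_estimate) (rule that)
  then show ?thesis
    unfolding upper_semi_fredholm_on_iff[OF iterate_subspace iterate_closed]
    using lower_estimate_subset[OF _ iterate_subset] by blast
qed

lemma finite_null: "cfinite_dim (null_space T \<inter> Y)"
  using usf by (auto simp: upper_semi_fredholm_on_def ecdim_def split: if_splits)

lemma null_iterate_stable:
  obtains m where "\<And>n. n \<ge> m \<Longrightarrow> null_space T \<inter> (cblinfun_apply T ^^ n) ` Y = null_space T \<inter> (cblinfun_apply T ^^ m) ` Y"
proof -
  let ?N = "\<lambda>m. null_space T \<inter> (cblinfun_apply T ^^ m) ` Y"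
  have N: "csubspace (?N m)" for m
    by (rule complex_vector.subspace_inter[OF csubspace_null_space iterate_subspace])
  have fin: "cfinite_dim (?N m)" for m
    by (rule cfinite_dim_subset[OF finite_null]) (use iterate_subset in auto)
  obtain m where m: "\<And>n. cdim (?N m) \<le> cdim (?N n)"
    using ex_has_least_nat[of "\<lambda>_. True" 0 "\<lambda>m. cdim (?N m)"] by auto
  show thesis
  proof (rule that[of m])
    fix n assume "n \<ge> m"
    then have "?N n \<subseteq> ?N m" using iterate_antimono by blast
    then show "?N n = ?N m" by (rule cdim_eq_imp_eq[OF N _ fin N m])
  qed
qed

text \<open>An eigenvector for a nonzero \<open>w\<close> is T^m of a multiple of itself and so lies
  in the iterated range, where \<open>T\<close> is bounded below by \<open>1 / C\<close>; this
  excludes nonzero eigenvalues of modulus less than \<open>1 / C\<close>.\<close>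

lemma injective_near:
  assumes m: "null_space T \<inter> (cblinfun_apply T ^^ m) ` Y \<subseteq> {0}"
  obtains e where "e > 0" "\<And>w x. w \<noteq> 0 \<Longrightarrow> cmod w < e \<Longrightarrow> x \<in> Y \<Longrightarrow> shift T w x = 0 \<Longrightarrow> x = 0"
proof -
  obtain C where C: "C > 0" "\<And>x. x \<in> (cblinfun_apply T ^^ m) ` Y \<Longrightarrow> norm x \<le> C * norm (T x)"
    by (rule lower_estimate_injective[OF iterate_usf iterate_subspace iterate_closed m]) (rule that)
  show thesis
  proof (rule that[of "1 / C"])
    show "1 / C > 0" using C(1) by simp
    fix w x assume w: "w \<noteq> 0" "cmod w < 1 / C" and x: "x \<in> Y" "shift T w x = 0"
    have Tx: "T x = w *\<^sub>C x" using x(2) by (simp add: shift_apply)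
    have pow: "(cblinfun_apply T ^^ n) x = w ^ n *\<^sub>C x" for n
      by (induction n) (simp_all add: scaleC_one cblinfun_linear_simps Tx mult.commute)
    have "x = (cblinfun_apply T ^^ m) (inverse (w ^ m) *\<^sub>C x)"
    proof -
      have "(cblinfun_apply T ^^ n) (c *\<^sub>C x) = c *\<^sub>C (cblinfun_apply T ^^ n) x" for n c
        by (induction n) (simp_all add: cblinfun_linear_simps)
      then show ?thesis using w(1) by (simp add: pow)
    qed
    then have "x \<in> (cblinfun_apply T ^^ m) ` Y" using complex_vector.subspace_scale[OF sub x(1)] by blast
    then have "norm x \<le> C * (cmod w * norm x)" using C(2)[of x] by (simp add: Tx norm_scaleC)
    moreover have "C * cmod w < 1" using w(2) C(1) by (simp add: field_simps)
    ultimately have "norm x * (1 - C * cmod w) \<le> 0" by (simp add: algebra_simps)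
    then show "x = 0" using \<open>C * cmod w < 1\<close> by (simp add: mult_le_0_iff)
  qed
qed

text \<open>
  If the kernel meets every iterated range, then \<open>T\<close> maps the intersection of the iterated ranges onto
  itself, and iterated preimages of a kernel vector are the coefficients of an eigenvector function.
\<close>

lemma dichotomy:
  "(\<exists>m. null_space T \<inter> (cblinfun_apply T ^^ m) ` Y \<subseteq> {0}) \<or>
    (\<exists>r>0. \<exists>f. vector_analytic_on f (ball 0 r) \<and> (\<forall>w\<in>ball 0 r. shift T w (f w) = 0 \<and> f w \<noteq> 0))"
proof (cases "\<exists>m. null_space T \<inter> (cblinfun_apply T ^^ m) ` Y \<subseteq> {0}")
  case False
  obtain m where m: "\<And>n. n \<ge> m \<Longrightarrow> null_space T \<inter> (cblinfun_apply T ^^ n) ` Y = null_space T \<inter> (cblinfun_apply T ^^ m) ` Y"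
    by (rule null_iterate_stable) (rule that)
  define M where "M = (\<Inter>n. (cblinfun_apply T ^^ n) ` Y)"
  have Nm: "null_space T \<inter> (cblinfun_apply T ^^ m) ` Y \<subseteq> M"
  proof
    fix x assume x: "x \<in> null_space T \<inter> (cblinfun_apply T ^^ m) ` Y"
    have "x \<in> (cblinfun_apply T ^^ n) ` Y" for n
      using x m[of n] iterate_antimono[of n m] by (cases "m \<le> n") auto
    then show "x \<in> M" by (simp add: M_def)
  qed
  have M: "csubspace M" "closed M"
    unfolding M_def using iterate_closed iterate_subspace
    by (auto intro!: complex_vector.subspace_Inter closed_INT)
  have "M \<subseteq> T ` M"
  proof
    fix y assume y: "y \<in> M"
    have "\<exists>u\<in>(cblinfun_apply T ^^ n) ` Y. T u = y" for n
    proof -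
      have "y \<in> (cblinfun_apply T ^^ Suc n) ` Y" using y unfolding M_def by blast
      then show ?thesis by auto
    qed
    then obtain u where u: "\<And>n. u n \<in> (cblinfun_apply T ^^ n) ` Y" "\<And>n. T (u n) = y" by metis
    \<comment> \<open>Preimages of \<open>y\<close> in the iterated ranges from the
      \<open>m\<close>-th on differ by null vectors of the stable intersection, which lies in all
      ranges; thus the single preimage \<open>u m\<close> works for every \<open>n\<close>.\<close>
    have "u m \<in> (cblinfun_apply T ^^ n) ` Y" for n
    proof (cases "n \<le> m")
      case True
      then show ?thesis using u(1)[of m] iterate_antimono by blast
    next
      case False
      then have "u n \<in> (cblinfun_apply T ^^ m) ` Y" using u(1)[of n] iterate_antimono[of m n] by auto
      then have "u n - u m \<in> null_space T \<inter> (cblinfun_apply T ^^ m) ` Y"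
        using complex_vector.subspace_diff[OF iterate_subspace _ u(1)] u(2)
        by (simp add: null_space_def cblinfun_linear_simps)
      then have "u n - u m \<in> (cblinfun_apply T ^^ n) ` Y" using m[of n] False by auto
      then have "u n - (u n - u m) \<in> (cblinfun_apply T ^^ n) ` Y"
        by (rule complex_vector.subspace_diff[OF iterate_subspace u(1)])
      then show ?thesis by simp
    qed
    then have "u m \<in> M" by (simp add: M_def)
    then show "y \<in> T ` M" using u(2)[of m] by blast
  qed
  moreover have "T ` M \<subseteq> M"
  proof clarify
    fix x assume x: "x \<in> M"
    have "T x \<in> (cblinfun_apply T ^^ n) ` Y" for n
    proof -
      have "T x \<in> (cblinfun_apply T ^^ Suc n) ` Y" using x unfolding M_def by force
      then show ?thesis using iterate_antimono[of n "Suc n"] by auto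
    qed
    then show "T x \<in> M" by (simp add: M_def)
  qed
  ultimately have TM: "T ` M = M" by blast
  have "closed (T ` M)" using M(2) TM by simp
  then obtain C where C: "C > 0" "\<And>z. z \<in> T ` M \<Longrightarrow> \<exists>x\<in>M. T x = z \<and> norm x \<le> C * norm z"
    by (rule open_mapping[OF M]) (rule that)
  have "\<exists>x. z \<in> M \<longrightarrow> x \<in> M \<and> T x = z \<and> norm x \<le> C * norm z" for z
    using C(2)[of z] unfolding TM by blast
  then obtain s where s: "\<And>z. z \<in> M \<Longrightarrow> s z \<in> M \<and> T (s z) = z \<and> norm (s z) \<le> C * norm z" by metis
  obtain x0 where x0: "x0 \<in> null_space T \<inter> (cblinfun_apply T ^^ m) ` Y" "x0 \<noteq> 0" using False by blast
  define a where "a n = (s ^^ n) x0" for n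
  have aM: "a n \<in> M" for n
    by (induction n) (use x0 Nm s in \<open>auto simp: a_def\<close>)
  have a0: "a 0 = x0" "T (a 0) = 0" using x0 by (auto simp: a_def null_space_def)
  have aS: "T (a (Suc n)) = a n" for n using s[OF aM[of n]] by (simp add: a_def)
  have an: "norm (a n) \<le> norm x0 * C ^ n" for n
  proof (induction n)
    case (Suc n)
    have "norm (a (Suc n)) \<le> C * norm (a n)" using s[OF aM[of n]] by (simp add: a_def)
    also have "\<dots> \<le> C * (norm x0 * C ^ n)" using Suc C(1) by (intro mult_left_mono) auto
    finally show ?case by (simp add: mult_ac)
  qed (simp add: a0)
  \<comment> \<open>As \<open>T\<close> kills \<open>a 0\<close> and maps \<open>a (Suc n)\<close>
    to \<open>a n\<close>, applying \<open>T\<close> shifts the series by one place, which is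
    multiplication by \<open>w\<close>. At 0 the value is the nonzero vector \<open>x0\<close>, and
    continuity keeps it nonzero on a smaller disc.\<close>
  define f where "f w = (\<Sum>n. w ^ n *\<^sub>C a n)" for w
  have f: "vector_analytic_on f (ball 0 (1 / C))"
    unfolding f_def by (rule power_series_analytic[OF an C(1)])
  have sf: "(\<lambda>n. w ^ n *\<^sub>C a n) sums f w" if "cmod w < 1 / C" for w
    unfolding f_def by (rule summable_sums[OF power_series_summable[OF an C(1) that]])
  have fT: "shift T w (f w) = 0" if w: "cmod w < 1 / C" for w
  proof -
    have "(\<lambda>n. T (w ^ n *\<^sub>C a n)) sums T (f w)"
      by (rule bounded_linear.sums[OF bounded_linear_cblinfun_apply sf[OF w]])
    moreover have "(\<lambda>n. T (w ^ n *\<^sub>C a n)) sums (w *\<^sub>C f w)"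
    proof -
      have "(\<lambda>n. w *\<^sub>C (w ^ n *\<^sub>C a n)) sums (w *\<^sub>C f w)"
        by (rule bounded_linear.sums[OF bounded_linear_scaleC_right sf[OF w]])
      then have "(\<lambda>n. T (w ^ Suc n *\<^sub>C a (Suc n))) sums (w *\<^sub>C f w)"
        by (simp add: cblinfun_apply_scaleC aS)
      then show ?thesis
        by (subst (asm) sums_Suc_iff) (use a0 in \<open>simp add: cblinfun_apply_scaleC\<close>)
    qed
    ultimately have "T (f w) = w *\<^sub>C f w" by (rule sums_unique2)
    then show ?thesis by (simp add: shift_apply)
  qed
  have "(\<lambda>n. 0 ^ n *\<^sub>C a n) = (\<lambda>n. if n = 0 then a n else 0)"
    by (auto simp: fun_eq_iff power_0_left scaleC_one)
  then have "(\<lambda>n. 0 ^ n *\<^sub>C a n) sums a 0" using sums_single[of 0 a] by simp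
  moreover have "(\<lambda>n. 0 ^ n *\<^sub>C a n) sums f 0" using sf[of 0] C(1) by simp
  ultimately have f0: "f 0 = x0" using a0(1) sums_unique2 by metis
  obtain d where "(f has_derivative (\<lambda>h. h *\<^sub>C d)) (at 0)"
    using f C(1) unfolding vector_analytic_on_def by force
  then have "continuous (at 0) f" by (rule has_derivative_continuous)
  then obtain e where e: "e > 0" "\<And>y. dist 0 y < e \<Longrightarrow> f y \<noteq> 0"
    using continuous_at_avoid[of 0 f 0] f0 x0(2) by auto
  have "vector_analytic_on f (ball 0 (min e (1 / C)))"
    using f unfolding vector_analytic_on_def by auto
  moreover have "\<forall>w\<in>ball 0 (min e (1 / C)). shift T w (f w) = 0 \<and> f w \<noteq> 0"
    using e(2) fT by auto
  moreover have "min e (1 / C) > 0" using e(1) C(1) by simp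
  ultimately show ?thesis by blast
qed simp

end

section \<open>Powers of an operator\<close>

primrec cblinfun_power :: "('a::complex_normed_vector \<Rightarrow>\<^sub>C\<^sub>L 'a) \<Rightarrow> nat \<Rightarrow> 'a \<Rightarrow>\<^sub>C\<^sub>L 'a" where
  "cblinfun_power T 0 = cblinfun_id"
| "cblinfun_power T (Suc n) = T o\<^sub>C\<^sub>L cblinfun_power T n"

lemma cblinfun_power_apply: "cblinfun_apply (cblinfun_power T n) = cblinfun_apply T ^^ n"
  by (induction n) (auto simp: fun_eq_iff cblinfun_id_apply cblinfun_apply_compose)

lemma csubspace_range_power: "csubspace (range_power T n)"
  unfolding range_power_def cblinfun_power_apply[symmetric]
  by (rule csubspace_cblinfun_image[OF complex_vector.subspace_UNIV])

lemma csubspace_null_power: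
  fixes T :: "'a::complex_normed_vector \<Rightarrow>\<^sub>C\<^sub>L 'a"
  shows "csubspace (null_space (cblinfun_apply T ^^ n))"
  using csubspace_null_space[of "cblinfun_power T n"] by (simp add: cblinfun_power_apply)

lemma range_power_add: "(cblinfun_apply T ^^ m) ` range_power T n = range_power T (m + n)"
  unfolding range_power_def by (simp add: funpow_add image_comp)

lemma range_power_invariant: "x \<in> range_power T n \<Longrightarrow> T x \<in> range_power T n"
  unfolding range_power_def by (auto simp: funpow_swap1)

lemma null_power_stable:
  fixes T :: "'a::complex_normed_vector \<Rightarrow>\<^sub>C\<^sub>L 'a"
  assumes "null_space (cblinfun_apply T ^^ a) = null_space (cblinfun_apply T ^^ Suc a)" "a \<le> k"
  shows "null_space (cblinfun_apply T ^^ k) = null_space (cblinfun_apply T ^^ a)"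
  using assms(2)
proof (induction k rule: dec_induct)
  case (step k)
  have "(cblinfun_apply T ^^ Suc k) x = 0 \<longleftrightarrow> (cblinfun_apply T ^^ k) x = 0" for x
  proof
    assume x: "(cblinfun_apply T ^^ Suc k) x = 0"
    obtain j where j: "k = j + a" using step.hyps(1) by (metis add.commute le_Suc_ex)
    show "(cblinfun_apply T ^^ k) x = 0"
    proof (cases j)
      case 0
      then have "x \<in> null_space (cblinfun_apply T ^^ Suc a)" using x j by (simp add: null_space_def)
      then have "x \<in> null_space (cblinfun_apply T ^^ a)" unfolding assms(1) .
      then show ?thesis using j 0 by (simp add: null_space_def)
    next
      case (Suc i)
      have "(cblinfun_apply T ^^ k) (T x) = 0" using x by (simp add: funpow_swap1)
      then have "T x \<in> null_space (cblinfun_apply T ^^ a)" using step.IH by (auto simp: null_space_def)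
      then have "(cblinfun_apply T ^^ Suc a) x = 0" by (simp add: null_space_def funpow_swap1)
      moreover have "k = i + Suc a" using j Suc by simp
      moreover have "(cblinfun_apply T ^^ i) 0 = 0"
        unfolding cblinfun_power_apply[symmetric] by (simp add: cblinfun_linear_simps)
      ultimately show ?thesis by (simp only: funpow_add o_apply)
    qed
  qed (simp add: cblinfun_linear_simps)
  then show ?case using step.IH by (auto simp: null_space_def)
qed simp

text \<open>Elements of \<open>range_power T a\<close> have the form T^a u, and T kills such an
  element exactly if u is a null vector of T^(a+1). This translates the ascent into the language of
  iterated ranges.\<close>

lemma null_power_eq_iff:
  fixes T :: "'a::complex_banach \<Rightarrow>\<^sub>C\<^sub>L 'a"
  shows "null_space (cblinfun_apply T ^^ a) = null_space (cblinfun_apply T ^^ Suc a) \<longleftrightarrow>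
    null_space (cblinfun_apply T) \<inter> range_power T a \<subseteq> {0}"
proof
  assume L: "null_space (cblinfun_apply T ^^ a) = null_space (cblinfun_apply T ^^ Suc a)"
  show "null_space (cblinfun_apply T) \<inter> range_power T a \<subseteq> {0}"
  proof
    fix x assume "x \<in> null_space (cblinfun_apply T) \<inter> range_power T a"
    then obtain u where u: "x = (cblinfun_apply T ^^ a) u" "T x = 0"
      by (auto simp: null_space_def range_power_def)
    then have "u \<in> null_space (cblinfun_apply T ^^ Suc a)" by (simp add: null_space_def)
    then show "x \<in> {0}" using u(1) unfolding L[symmetric] by (simp add: null_space_def)
  qed
next
  assume R: "null_space (cblinfun_apply T) \<inter> range_power T a \<subseteq> {0}"
  have "(cblinfun_apply T ^^ a) x = 0" if "T ((cblinfun_apply T ^^ a) x) = 0" for x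
    using R that by (auto simp: null_space_def range_power_def)
  then show "null_space (cblinfun_apply T ^^ a) = null_space (cblinfun_apply T ^^ Suc a)"
    by (auto simp: null_space_def cblinfun_linear_simps)
qed

lemma ascent_eq_enatD:
  assumes "ascent T = enat a"
  shows "null_space (cblinfun_apply T ^^ a) = null_space (cblinfun_apply T ^^ Suc a)"
proof -
  let ?S = "{enat a | a. null_space (cblinfun_apply T ^^ a) = null_space (cblinfun_apply T ^^ Suc a)}"
  have "?S \<noteq> {}"
  proof
    assume "?S = {}"
    then have "ascent T = top" unfolding ascent_def by (simp only: Inf_empty)
    then show False using assms by (simp add: top_enat_def)
  qed
  then obtain x where "x \<in> ?S" by blast
  then have "Inf ?S \<in> ?S" unfolding Inf_enat_def by (auto intro: LeastI)
  then have "enat a \<in> ?S" using assms by (simp only: ascent_def)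
  then show ?thesis by (auto simp del: funpow.simps)
qed

lemma ascent_le:
  fixes T :: "'a::complex_banach \<Rightarrow>\<^sub>C\<^sub>L 'a"
  assumes "null_space (cblinfun_apply T ^^ m) = null_space (cblinfun_apply T ^^ Suc m)"
  obtains a where "ascent T = enat a" "a \<le> m"
proof -
  have "ascent T \<le> enat m" unfolding ascent_def using assms by (intro Inf_lower) blast
  then show thesis using that by (cases "ascent T") auto
qed

text \<open>A preimage of controlled norm for T^(m+1) also serves for T^m, because the two null
  spaces agree; so bounded preimages, and with them closed range, pass down one power.\<close>

lemma closed_range_power_pred:
  fixes T :: "'a::complex_banach \<Rightarrow>\<^sub>C\<^sub>L 'a"
  assumes cl: "closed (range_power T (Suc m))"
    and N: "null_space (cblinfun_apply T ^^ m) = null_space (cblinfun_apply T ^^ Suc m)"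
  shows "closed (range_power T m)"
proof -
  let ?P = "cblinfun_power T m" and ?Q = "cblinfun_power T (Suc m)"
  have cl': "closed (range ?Q)" using cl unfolding range_power_def cblinfun_power_apply .
  obtain C where C: "C > 0" "\<And>z. z \<in> range ?Q \<Longrightarrow> \<exists>x\<in>UNIV. ?Q x = z \<and> norm x \<le> C * norm z"
    by (rule open_mapping[OF complex_vector.subspace_UNIV closed_UNIV cl']) (rule that)
  obtain K where K: "K > 0" "\<And>x. norm (T x) \<le> K * norm x" by (rule cblinfun_bound_pos[of T]) (rule that)
  have "closed (range ?P)"
  proof (rule closed_range_if_bounded_preimages[OF complex_vector.subspace_UNIV closed_UNIV])
    fix x
    obtain x' where x': "?Q x' = ?Q x" "norm x' \<le> C * norm (?Q x)" using C(2)[of "?Q x"] by blast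
    have "?Q (x' - x) = 0" using x'(1) by (simp add: cblinfun_linear_simps)
    then have "x' - x \<in> null_space (cblinfun_apply T ^^ m)"
      unfolding N by (simp add: null_space_def cblinfun_power_apply del: cblinfun_power.simps)
    then have "?P (x' - x) = 0" by (simp add: null_space_def cblinfun_power_apply)
    then have "?P x' = ?P x" by (simp add: cblinfun_linear_simps)
    moreover have "norm x' \<le> (C * K) * norm (?P x)"
    proof -
      have "norm x' \<le> C * norm (T (?P x))" using x'(2) by (simp add: cblinfun_apply_compose)
      also have "\<dots> \<le> C * (K * norm (?P x))" using K(2) C(1) by (intro mult_left_mono) auto
      finally show ?thesis by (simp add: mult.assoc)
    qed
    ultimately show "\<exists>x'\<in>UNIV. ?P x' = ?P x \<and> norm x' \<le> (C * K) * norm (?P x)" by blast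
  qed
  then show ?thesis unfolding range_power_def cblinfun_power_apply .
qed


section \<open>The index\<close>

text \<open>With finite nullity no difference of infinities occurs, and infinite codimension makes
  the right side vacuous. Later index arguments count spanning vectors instead of computing with
  extended numbers.\<close>

lemma index_nonpos_iff:
  assumes "cfinite_dim (null_space (cblinfun_apply T) \<inter> Y)"
  shows "\<not> 0 < index_on Y T \<longleftrightarrow>
    (\<forall>B. finite B \<longrightarrow> B \<subseteq> Y \<longrightarrow> Y \<subseteq> cspan (T ` Y \<union> B) \<longrightarrow> cdim (null_space (cblinfun_apply T) \<inter> Y) \<le> card B)"
proof -
  let ?k = "cdim (null_space (cblinfun_apply T) \<inter> Y)"
  have "index_on Y T = ereal_of_enat (enat ?k) - ereal_of_enat (ecodim (T ` Y) Y)"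
    using assms by (simp add: index_on_def ecdim_def)
  then have "\<not> 0 < index_on Y T \<longleftrightarrow> enat ?k \<le> ecodim (T ` Y) Y"
    by (cases "ecodim (T ` Y) Y") (auto simp: not_less)
  also have "\<dots> \<longleftrightarrow> (\<forall>B. finite B \<longrightarrow> B \<subseteq> Y \<longrightarrow> Y \<subseteq> cspan (T ` Y \<union> B) \<longrightarrow> ?k \<le> card B)"
    unfolding ecodim_def le_Inf_iff by auto
  finally show ?thesis .
qed

lemma unit_sphere_compact:
  fixes W :: "'a::complex_normed_vector set"
  assumes W: "csubspace W" "cfinite_dim W"
  shows "compact {v\<in>W. norm v = 1}"
  unfolding compact_eq_seq_compact_metric
proof (rule seq_compactI)
  fix v :: "nat \<Rightarrow> 'a" assume v: "\<forall>n. v n \<in> {v\<in>W. norm v = 1}"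
  then have "bounded (range v)" by (auto simp: bounded_iff)
  then obtain l r where r: "l \<in> W" "strict_mono (r::nat\<Rightarrow>nat)" "(v \<circ> r) \<longlonglongrightarrow> l"
    using cfinite_dim_subsequence[OF W, of v] v by blast
  have "(\<lambda>n. norm ((v \<circ> r) n)) \<longlonglongrightarrow> norm l" by (rule tendsto_norm[OF r(3)])
  then have "norm l = 1" using v by (simp add: LIMSEQ_const_iff)
  then show "\<exists>l\<in>{v\<in>W. norm v = 1}. \<exists>r. strict_mono r \<and> (v \<circ> r) \<longlonglongrightarrow> l" using r by blast
qed

text \<open>The distance from \<open>Z\<close> is continuous and positive on the compact unit sphere
  of \<open>W\<close>; \<open>D\<close> is the reciprocal of its minimum, or 1 if \<open>W\<close>
  is trivial.\<close>

lemma finite_dim_angle: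
  fixes W Z :: "'a::complex_normed_vector set"
  assumes W: "csubspace W" "cfinite_dim W" and Z: "csubspace Z" "closed Z" and WZ: "W \<inter> Z \<subseteq> {0}"
  obtains D where "D > 0" "\<And>v z. v \<in> W \<Longrightarrow> z \<in> Z \<Longrightarrow> norm v \<le> D * norm (v + z)"
proof (cases "{v\<in>W. norm v = 1} = {}")
  case True
  have v0: "v = 0" if "v \<in> W" for v
  proof (rule ccontr)
    assume "v \<noteq> 0"
    then have "norm (complex_of_real (inverse (norm v)) *\<^sub>C v) = 1"
      unfolding norm_scaleC norm_of_real by simp
    moreover have "complex_of_real (inverse (norm v)) *\<^sub>C v \<in> W"
      by (rule complex_vector.subspace_scale[OF W(1) that])
    ultimately show False using True by blast
  qed
  then have "norm v \<le> 1 * norm (v + z)" if "v \<in> W" for v z using v0[OF that] by simp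
  then show thesis by (intro that[of 1]) auto
next
  case False
  interpret p: complex_seminorm scaleC "\<lambda>x. infdist x Z" by (rule complex_seminorm_infdist[OF Z(1)])
  have ne: "Z \<noteq> {}" using complex_vector.subspace_0[OF Z(1)] by blast
  have "continuous_on {v\<in>W. norm v = 1} (\<lambda>v. infdist v Z)" by (intro continuous_intros)
  then obtain u where u: "u \<in> W" "norm u = 1" "\<And>v. v \<in> W \<Longrightarrow> norm v = 1 \<Longrightarrow> infdist u Z \<le> infdist v Z"
    using continuous_attains_inf[OF unit_sphere_compact[OF W] False, of "\<lambda>v. infdist v Z"] by blast
  have "u \<notin> Z" using WZ u(1,2) by auto
  then have d: "infdist u Z > 0" using Z(2) ne by (rule infdist_pos_not_in_closed[rotated 2])
  show thesis
  proof (rule that[of "1 / infdist u Z"])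
    show "1 / infdist u Z > 0" using d by simp
    fix v z assume v: "v \<in> W" and z: "z \<in> Z"
    show "norm v \<le> 1 / infdist u Z * norm (v + z)"
    proof (cases "v = 0")
      case False
      let ?c = "complex_of_real (inverse (norm v))"
      have "norm (?c *\<^sub>C v) = 1" unfolding norm_scaleC norm_of_real using False by simp
      then have "infdist u Z \<le> infdist (?c *\<^sub>C v) Z"
        by (intro u(3) complex_vector.subspace_scale[OF W(1) v])
      also have "\<dots> = inverse (norm v) * infdist v Z"
        unfolding p.p_scale norm_of_real by simp
      finally have "norm v * infdist u Z \<le> infdist v Z" using False by (simp add: field_simps)
      also have "\<dots> \<le> dist v (- z)"
        using complex_vector.subspace_neg[OF Z(1) z] by (rule infdist_le)
      finally show ?thesis using d by (simp add: dist_norm field_simps)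
    qed (use d in simp)
  qed
qed

context invariant_usf
begin

lemma null_iterate_finite: "csubspace {x\<in>Y. (cblinfun_apply T ^^ m) x = 0} \<and> cfinite_dim {x\<in>Y. (cblinfun_apply T ^^ m) x = 0}"
proof (induction m)
  case 0
  have "{x\<in>Y. (cblinfun_apply T ^^ 0) x = 0} = cspan {}"
    using complex_vector.subspace_0[OF sub] by auto
  then show ?case using cfinite_dim_cspan[of "{}"] complex_vector.subspace_span by (metis finite.emptyI)
next
  case (Suc m)
  have eq: "{x\<in>Y. (cblinfun_apply T ^^ Suc m) x = 0} = {x\<in>Y. T x \<in> {x\<in>Y. (cblinfun_apply T ^^ m) x = 0}}"
    using inv by (auto simp: funpow_swap1)
  have "{x\<in>Y. (cblinfun_apply T ^^ Suc m) x = 0} = null_space (cblinfun_apply T ^^ Suc m) \<inter> Y"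
    by (auto simp: null_space_def)
  then have "csubspace {x\<in>Y. (cblinfun_apply T ^^ Suc m) x = 0}"
    using complex_vector.subspace_inter[OF csubspace_null_power sub] by metis
  then show ?case
    using cfinite_dim_preimage[OF sub finite_null, of "{x\<in>Y. (cblinfun_apply T ^^ m) x = 0}"] Suc
    unfolding eq by blast
qed

lemma index_nonpos_if_finite_ascent:
  assumes m: "null_space T \<inter> (cblinfun_apply T ^^ m) ` Y \<subseteq> {0}"
  shows "\<not> 0 < index_on Y T"
  unfolding index_nonpos_iff[OF finite_null]
proof (intro allI impI)
  fix B assume B: "finite B" "B \<subseteq> Y" "Y \<subseteq> cspan (T ` Y \<union> B)"
  \<comment> \<open>A positive exponent is taken so that the null vectors of \<open>T\<close> in
    \<open>Y\<close> lie in \<open>N\<close>. If \<open>x \<in> Y0\<close> and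
    \<open>T x \<in> N\<close>, then T^k x is a null vector in the k-th range, hence 0, and so
    \<open>x = 0\<close>. Thus \<open>N\<close> can serve as the space independent of the image of
    \<open>Y0\<close>, and its dimension equals the codimension of \<open>Y0\<close>.\<close>
  define k where "k = Suc m"
  have k: "null_space T \<inter> (cblinfun_apply T ^^ k) ` Y \<subseteq> {0}"
    using m iterate_antimono[of m k] by (auto simp: k_def)
  define N where "N = {x\<in>Y. (cblinfun_apply T ^^ k) x = 0}"
  have N: "csubspace N" "cfinite_dim N" "N \<subseteq> Y"
    using null_iterate_finite[of k] by (auto simp: N_def)
  obtain Y0 where Y0: "csubspace Y0" "Y0 \<subseteq> Y" "N \<inter> Y0 = {0}" "Y = {n + w | n w. n \<in> N \<and> w \<in> Y0}"
    by (rule exists_complement[OF N(1) sub N(3)]) (rule that)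
  obtain c where c: "finite c" "N \<subseteq> cspan c" "card c = cdim N"
    using cfinite_dim_basis[OF N(2)] by metis
  show "cdim (null_space T \<inter> Y) \<le> card B"
  proof (rule cdim_null_space_le[OF sub Y0(1) c(1) _ _ N(1,3) _ _ B(1,3)])
    show "Y \<subseteq> cspan (Y0 \<union> c)"
    proof
      fix y assume "y \<in> Y"
      then obtain n w where nw: "y = n + w" "n \<in> N" "w \<in> Y0" using Y0(4) by blast
      have "n \<in> cspan (Y0 \<union> c)" using c(2) nw(2) complex_vector.span_mono[of c "Y0 \<union> c"] by auto
      moreover have "w \<in> cspan (Y0 \<union> c)" using nw(3) by (intro complex_vector.span_base) simp
      ultimately show "y \<in> cspan (Y0 \<union> c)" unfolding nw(1) by (rule complex_vector.span_add)
    qed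
    have N0: "x = 0" if "x \<in> Y0" "(cblinfun_apply T ^^ k) x = 0" for x
      using that Y0(2,3) by (auto simp: N_def)
    show "x = 0" if "x \<in> Y0" "T x = 0" for x
    proof (rule N0[OF that(1)])
      have "(cblinfun_apply T ^^ m) 0 = 0"
        unfolding cblinfun_power_apply[symmetric] by (simp add: cblinfun_linear_simps)
      then show "(cblinfun_apply T ^^ k) x = 0" using that(2) by (simp add: k_def funpow_swap1)
    qed
    show "card c \<le> cdim N" using c(3) by simp
    show "T ` Y0 \<inter> N \<subseteq> {0}"
    proof clarify
      fix x assume x: "x \<in> Y0" "T x \<in> N"
      have "T ((cblinfun_apply T ^^ k) x) = 0" using x(2) by (simp add: N_def funpow_swap1)
      moreover have "(cblinfun_apply T ^^ k) x \<in> (cblinfun_apply T ^^ k) ` Y" using x(1) Y0(2) by blast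
      ultimately have "(cblinfun_apply T ^^ k) x = 0" using k by (auto simp: null_space_def)
      then show "T x = 0" using N0[OF x(1)] by (simp add: cblinfun_linear_simps)
    qed
  qed
qed

text \<open>Nonpositive index leaves room for a subspace \<open>W\<close> that meets the range
  trivially and has the dimension of the null space. \<open>T\<close> is bounded below on the
  complement \<open>Y0\<close> of the null space and \<open>W\<close> is at a positive angle to the
  range, so under small shifts the image of \<open>Y0\<close> still meets \<open>W\<close> trivially
  and the same dimension count applies.\<close>

lemma index_nonpos_near:
  assumes ind: "\<not> 0 < index_on Y T"
  obtains e where "e > 0" "\<And>w B. cmod w < e \<Longrightarrow> finite B \<Longrightarrow> Y \<subseteq> cspan (shift T w ` Y \<union> B) \<Longrightarrow>
    cdim (null_space (shift T w) \<inter> Y) \<le> card B"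
proof -
  have S: "subsequence_property Y T"
    by (rule upper_semi_fredholm_imp_subsequence_property[OF usf sub clo])
  obtain b and \<phi> :: "'a \<Rightarrow> 'a \<Rightarrow>\<^sub>C\<^sub>L complex" and C
    where b: "finite b" "\<not> cdependent b" "cspan b = null_space T \<inter> Y"
    and \<phi>: "\<And>e e'. e \<in> b \<Longrightarrow> e' \<in> b \<Longrightarrow> \<phi> e e' = (if e = e' then 1 else 0)" and C: "C > 0"
    and est: "\<And>x. x \<in> Y \<Longrightarrow> norm x \<le> C * (norm (T x) + (\<Sum>e\<in>b. cmod (\<phi> e x)))"
    by (rule subsequence_property_estimate[OF S sub clo]) (rule that)
  define Y0 where "Y0 = {x\<in>Y. \<forall>e\<in>b. \<phi> e x = 0}"
  have Y0: "csubspace Y0"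
    unfolding Y0_def using complex_vector.subspace_0[OF sub] complex_vector.subspace_add[OF sub]
      complex_vector.subspace_scale[OF sub]
    by (intro complex_vector.subspaceI) (auto simp: cblinfun_linear_simps)
  have est0: "norm x \<le> C * norm (T x)" if "x \<in> Y0" for x
  proof -
    have "(\<Sum>e\<in>b. cmod (\<phi> e x)) = 0" using that by (intro sum.neutral) (simp add: Y0_def)
    then show ?thesis using est[of x] that by (simp add: Y0_def)
  qed
  have Yspan: "Y \<subseteq> cspan (Y0 \<union> b)"
  proof
    fix x assume x: "x \<in> Y"
    define y where "y = (\<Sum>e\<in>b. \<phi> e x *\<^sub>C e)"
    have ysp: "y \<in> cspan b" unfolding y_def by (rule biorthogonal_projection(1)[OF b(1) \<phi>])
    then have yY: "y \<in> Y" unfolding b(3) by simp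
    have "\<phi> e (x - y) = 0" if "e \<in> b" for e
      unfolding y_def by (rule biorthogonal_projection(2)[OF b(1) \<phi> that])
    then have "x - y \<in> Y0"
      unfolding Y0_def using complex_vector.subspace_diff[OF sub x yY] by simp
    then have "x - y \<in> cspan (Y0 \<union> b)" by (intro complex_vector.span_base) simp
    moreover have "y \<in> cspan (Y0 \<union> b)" using ysp complex_vector.span_mono[of b "Y0 \<union> b"] by auto
    ultimately have "(x - y) + y \<in> cspan (Y0 \<union> b)" by (rule complex_vector.span_add)
    then show "x \<in> cspan (Y0 \<union> b)" by simp
  qed
  have TY: "csubspace (T ` Y)" "closed (T ` Y)" "T ` Y \<subseteq> Y"
    using csubspace_cblinfun_image[OF sub] usf inv by (auto simp: upper_semi_fredholm_on_def)
  obtain Z where Z: "csubspace Z" "Z \<subseteq> Y" "T ` Y \<inter> Z = {0}" "Y = {n + w | n w. n \<in> T ` Y \<and> w \<in> Z}"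
    by (rule exists_complement[OF TY(1) sub TY(3)]) (rule that)
  have "cdim (null_space T \<inter> Y) = card b"
    unfolding b(3)[symmetric] by (rule complex_vector.dim_span_eq_card_independent[OF b(2)])
  then have cardb: "card b \<le> card B" if "finite B" "B \<subseteq> Y" "Y \<subseteq> cspan (T ` Y \<union> B)" for B
    using ind that unfolding index_nonpos_iff[OF finite_null] by metis
  obtain d where d: "d \<subseteq> Z" "\<not> cdependent d" "Z \<subseteq> cspan d" "card d = cdim Z"
    by (rule complex_vector.basis_exists)
  \<comment> \<open>The complement \<open>Z\<close> of the range may have infinite dimension; only
    \<open>card b\<close> independent vectors of it are kept.\<close>
  have "\<exists>d'\<subseteq>d. finite d' \<and> card d' = card b"
  proof (cases "finite d")
    case True
    have "Y \<subseteq> cspan (T ` Y \<union> d)"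
    proof
      fix y assume "y \<in> Y"
      then obtain n w where nw: "y = n + w" "n \<in> T ` Y" "w \<in> Z" using Z(4) by blast
      have "w \<in> cspan (T ` Y \<union> d)" using d(3) nw(3) complex_vector.span_mono[of d "T ` Y \<union> d"] by auto
      moreover have "n \<in> cspan (T ` Y \<union> d)" using nw(2) by (intro complex_vector.span_base) simp
      ultimately show "y \<in> cspan (T ` Y \<union> d)" unfolding nw(1) by (intro complex_vector.span_add)
    qed
    then have "card b \<le> card d" using cardb[OF True] d(1) Z(2) by blast
    then show ?thesis by (meson obtain_subset_with_card_n)
  next
    case False
    then show ?thesis using infinite_arbitrarily_large by blast
  qed
  then obtain d' where d': "d' \<subseteq> d" "finite d'" "card d' = card b" by blast
  define W where "W = cspan d'"
  have W: "csubspace W" "cfinite_dim W" "cdim W = card b"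
    unfolding W_def d'(3)[symmetric]
    by (rule complex_vector.subspace_span cfinite_dim_cspan[OF d'(2)]
        complex_vector.dim_span_eq_card_independent[OF complex_vector.independent_mono[OF d(2) d'(1)]])+
  have WZ: "W \<subseteq> Z" unfolding W_def using d'(1) d(1) by (intro complex_vector.span_minimal Z(1)) auto
  have WTY: "W \<inter> T ` Y \<subseteq> {0}" using WZ Z(3) by auto
  obtain D where D: "D > 0" "\<And>v z. v \<in> W \<Longrightarrow> z \<in> T ` Y \<Longrightarrow> norm v \<le> D * norm (v + z)"
    by (rule finite_dim_angle[OF W(1,2) TY(1,2) WTY]) (rule that)
  \<comment> \<open>If (T - w) x lies in \<open>W\<close>, the angle bounds its norm by D |w| norm
    x. So \<open>T x\<close> has norm at most (D + 1) |w| norm x, and the estimate on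
    \<open>Y0\<close> bounds \<open>norm x\<close> by C (D + 1) |w| norm x, which forces
    \<open>x = 0\<close> once |w| is below this \<open>e\<close>.\<close>
  define e where "e = 1 / (C * (D + 1))"
  have key: "x = 0" if w: "cmod w < e" and x: "x \<in> Y0" "shift T w x \<in> W" for w x
  proof -
    let ?v = "shift T w x"
    have xY: "x \<in> Y" using x(1) by (simp add: Y0_def)
    have "- T x \<in> T ` Y" using xY by (intro complex_vector.subspace_neg[OF TY(1)]) simp
    then have "norm ?v \<le> D * norm (?v + - T x)" by (rule D(2)[OF x(2)])
    then have 1: "norm ?v \<le> D * (cmod w * norm x)" by (simp add: shift_apply norm_scaleC)
    have "norm (T x) \<le> norm ?v + norm (w *\<^sub>C x)"
      using norm_triangle_ineq[of ?v "w *\<^sub>C x"] by (simp add: shift_apply)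
    then have 2: "norm (T x) \<le> (D + 1) * (cmod w * norm x)" using 1 by (simp add: norm_scaleC algebra_simps)
    have "norm x \<le> C * norm (T x)" by (rule est0[OF x(1)])
    also have "\<dots> \<le> C * ((D + 1) * (cmod w * norm x))" using 2 C by (intro mult_left_mono) auto
    finally have "norm x * (1 - C * (D + 1) * cmod w) \<le> 0" by (simp add: algebra_simps)
    moreover have "C * (D + 1) * cmod w < 1"
      using w C D(1) unfolding e_def by (subst (asm) pos_less_divide_eq) (auto simp: mult_ac)
    ultimately show ?thesis by (simp add: mult_le_0_iff)
  qed
  show thesis
  proof (rule that[of e])
    show "e > 0" using C D(1) by (simp add: e_def)
    fix w B assume w: "cmod w < e" and B: "finite B" "Y \<subseteq> cspan (shift T w ` Y \<union> B)"
    show "cdim (null_space (shift T w) \<inter> Y) \<le> card B"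
    proof (rule cdim_null_space_le[OF sub Y0 b(1) Yspan _ W(1) _ _ _ B])
      show "x = 0" if "x \<in> Y0" "shift T w x = 0" for x
        using key[OF w that(1)] that(2) complex_vector.subspace_0[OF W(1)] by simp
      show "W \<subseteq> Y" using WZ Z(2) by blast
      show "card b \<le> cdim W" using W(3) by simp
      show "shift T w ` Y0 \<inter> W \<subseteq> {0}"
      proof clarify
        fix x assume x: "x \<in> Y0" "shift T w x \<in> W"
        have "x = 0" by (rule key[OF w x])
        then show "shift T w x = 0" by (simp add: cblinfun_linear_simps)
      qed
    qed
  qed
qed

end

section \<open>Upper semi B-Fredholm operators\<close>

lemma shift_shift: "shift (shift T z) w = shift T (z + w)"
  by (rule cblinfun_eqI) (simp add: cblinfun_linear_simps cblinfun_id_apply scaleC_add_left)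

lemma upper_semi_b_fredholm_at_invariant:
  "upper_semi_b_fredholm_at T n \<Longrightarrow> invariant_usf (range_power T n) T"
  unfolding upper_semi_b_fredholm_at_def
  by unfold_locales (auto intro: csubspace_range_power range_power_invariant)

lemma power_commute_shift:
  "(cblinfun_apply T ^^ n) (shift T w x) = shift T w ((cblinfun_apply T ^^ n) x)"
  unfolding cblinfun_power_apply[symmetric]
  by (induction n arbitrary: x)
    (simp_all add: cblinfun_id_apply cblinfun_apply_compose shift_apply cblinfun_linear_simps)

lemma null_space_shift_subset:
  assumes w: "w \<noteq> 0"
  shows "null_space (shift T w) \<subseteq> range_power T n"
proof
  fix x assume "x \<in> null_space (shift T w)"
  then have Tx: "T x = w *\<^sub>C x" by (simp add: null_space_def shift_apply)
  have "cblinfun_power T j x = w ^ j *\<^sub>C x" for j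
    by (induction j) (simp_all add: cblinfun_id_apply cblinfun_apply_compose scaleC_one cblinfun_linear_simps Tx mult.commute)
  then have "x = cblinfun_power T n (inverse (w ^ n) *\<^sub>C x)"
    using w by (simp add: cblinfun_apply_scaleC scaleC_one)
  then show "x \<in> range_power T n" unfolding range_power_def cblinfun_power_apply by blast
qed

text \<open>
  Away from \<open>0\<close> the operators \<open>T\<^sup>n\<close> and \<open>w\<^sup>n\<close> agree modulo \<open>T - w\<close>, so that everything about \<open>T - w\<close>
  is decided on the range of \<open>T\<^sup>n\<close>.
\<close>

lemma shift_fredholm_near:
  fixes T :: "'a::complex_banach \<Rightarrow>\<^sub>C\<^sub>L 'a"
  assumes at: "upper_semi_b_fredholm_at T n"
  obtains e where "e > 0"
    "\<And>w. w \<noteq> 0 \<Longrightarrow> cmod w < e \<Longrightarrow> upper_semi_fredholm (shift T w)"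
    "\<And>w. w \<noteq> 0 \<Longrightarrow> cmod w < e \<Longrightarrow> \<not> 0 < index_on (range_power T n) T \<Longrightarrow> \<not> 0 < fredholm_index (shift T w)"
proof -
  define Y where "Y = range_power T n"
  let ?P = "cblinfun_power T n"
  interpret invariant_usf Y T unfolding Y_def by (rule upper_semi_b_fredholm_at_invariant[OF at])
  have PY: "?P x \<in> Y" for x by (simp add: Y_def range_power_def cblinfun_power_apply)
  have Yr: "range ?P = Y" by (simp add: Y_def range_power_def cblinfun_power_apply)
  obtain C \<Phi> where C: "C > 0" and est: "lower_estimate Y T \<Phi> C" by (rule obtain_estimate) (rule that)
  have usf_shift: "upper_semi_fredholm (shift T w)" if w: "w \<noteq> 0" "cmod w < 1 / (2 * C)" for w
  proof (rule subsequence_property_imp_usf[OF _ complex_vector.subspace_UNIV closed_UNIV])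
    have "C * cmod w \<le> 1 / 2" using w(2) C by (simp add: field_simps)
    then have estw: "lower_estimate Y (shift T w) \<Phi> (2 * C)" by (rule lower_estimate_shift[OF est C])
    show "subsequence_property UNIV (shift T w)"
      unfolding subsequence_property_def
    proof (intro allI impI)
      fix x :: "nat \<Rightarrow> 'a"
      assume x: "bounded (range x)" "(\<lambda>k. shift T w (x k)) \<longlonglongrightarrow> 0"
      \<comment> \<open>Modulo null sequences T^j acts on \<open>x\<close> as the scalar w^j; so a
        convergent subsequence of T^n x_k, which lives in \<open>Y\<close>, can be divided by
        w^n.\<close>
      have diff: "(\<lambda>k. cblinfun_power T j (x k) - w ^ j *\<^sub>C x k) \<longlonglongrightarrow> 0" for j
      proof (induction j)
        case 0
        then show ?case by (simp add: cblinfun_id_apply scaleC_one)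
      next
        case (Suc j)
        have "(\<lambda>k. T (cblinfun_power T j (x k) - w ^ j *\<^sub>C x k) + w ^ j *\<^sub>C shift T w (x k))
          \<longlonglongrightarrow> T 0 + w ^ j *\<^sub>C 0"
          by (intro tendsto_add cblinfun_tendsto[OF Suc] bounded_linear.tendsto[OF bounded_linear_scaleC_right x(2)])
        moreover have "T (cblinfun_power T j (x k) - w ^ j *\<^sub>C x k) + w ^ j *\<^sub>C shift T w (x k) =
          cblinfun_power T (Suc j) (x k) - w ^ Suc j *\<^sub>C x k" for k
          by (simp add: cblinfun_apply_compose cblinfun_id_apply cblinfun_linear_simps
              complex_vector.scale_right_diff_distrib mult.commute)
        ultimately show ?case by (simp add: cblinfun_linear_simps del: cblinfun_power.simps)
      qed
      have "bounded (range (\<lambda>k. ?P (x k)))"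
        using bounded_linear_image[OF x(1) bounded_linear_cblinfun_apply[of ?P]] by (simp add: image_image)
      moreover have "(\<lambda>k. shift T w (?P (x k))) \<longlonglongrightarrow> 0"
        using cblinfun_tendsto[OF x(2), of ?P]
        by (simp add: cblinfun_power_apply power_commute_shift)
          (simp add: cblinfun_linear_simps flip: cblinfun_power_apply)
      ultimately obtain r l where r: "strict_mono (r::nat\<Rightarrow>nat)" "((\<lambda>k. ?P (x k)) \<circ> r) \<longlonglongrightarrow> l"
        using subsequence_propertyD[OF lower_estimate_imp_subsequence_property[OF estw sub], of "\<lambda>k. ?P (x k)"] PY
        by blast
      have "(\<lambda>k. inverse (w ^ n) *\<^sub>C (((\<lambda>k. ?P (x k)) \<circ> r) k - ((\<lambda>k. ?P (x k) - w ^ n *\<^sub>C x k) \<circ> r) k))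
          \<longlonglongrightarrow> inverse (w ^ n) *\<^sub>C (l - 0)"
        by (intro bounded_linear.tendsto[OF bounded_linear_scaleC_right] tendsto_diff r
            LIMSEQ_subseq_LIMSEQ[OF diff])
      moreover have "inverse (w ^ n) *\<^sub>C (((\<lambda>k. ?P (x k)) \<circ> r) k - ((\<lambda>k. ?P (x k) - w ^ n *\<^sub>C x k) \<circ> r) k) = (x \<circ> r) k" for k
        using w(1) by (simp add: scaleC_one)
      ultimately have "(x \<circ> r) \<longlonglongrightarrow> inverse (w ^ n) *\<^sub>C (l - 0)" by (simp only: fun_eq_iff)
      then have "convergent (x \<circ> r)" unfolding convergent_def by (rule exI)
      then show "\<exists>r::nat\<Rightarrow>nat. strict_mono r \<and> convergent (x \<circ> r)" using r(1) by blast
    qed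
  qed
  have index: "\<exists>e>0. \<forall>w. w \<noteq> 0 \<longrightarrow> cmod w < e \<longrightarrow> upper_semi_fredholm (shift T w) \<longrightarrow> \<not> 0 < fredholm_index (shift T w)"
    if ind: "\<not> 0 < index_on Y T"
  proof -
    obtain e where e: "e > 0" "\<And>w B. cmod w < e \<Longrightarrow> finite B \<Longrightarrow> Y \<subseteq> cspan (shift T w ` Y \<union> B) \<Longrightarrow>
        cdim (null_space (shift T w) \<inter> Y) \<le> card B"
      by (rule index_nonpos_near[OF ind]) (rule that)
    have "\<not> 0 < fredholm_index (shift T w)"
      if w: "w \<noteq> 0" "cmod w < e" and u: "upper_semi_fredholm (shift T w)" for w
    proof -
      have fin: "cfinite_dim (null_space (shift T w) \<inter> UNIV)"
        using u by (auto simp: upper_semi_fredholm_on_def ecdim_def split: if_splits)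
      show ?thesis
        unfolding index_nonpos_iff[OF fin]
      proof (intro allI impI)
        fix B assume B: "finite B" "UNIV \<subseteq> cspan (range (shift T w) \<union> B)"
        \<comment> \<open>T^n commutes with T - w and maps onto \<open>Y\<close>, so it carries a
          spanning set of the whole space modulo the range of T - w to one of \<open>Y\<close>
          modulo the image of \<open>Y\<close>. The null space of T - w already lies in
          \<open>Y\<close>.\<close>
        have "Y \<subseteq> cspan (shift T w ` Y \<union> ?P ` B)"
        proof -
          have "Y = ?P ` cspan (range (shift T w) \<union> B)"
            unfolding Yr[symmetric] using B(2) by (simp add: top.extremum_unique)
          also have "\<dots> = cspan (?P ` (range (shift T w) \<union> B))"
            by (rule complex_vector_pair.linear_span_image[OF linear_cblinfun_apply, symmetric])
          also have "?P ` (range (shift T w) \<union> B) = shift T w ` Y \<union> ?P ` B"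
            unfolding image_Un Yr[symmetric] image_image
            by (simp add: cblinfun_power_apply power_commute_shift)
          finally show ?thesis by simp
        qed
        then have "cdim (null_space (shift T w) \<inter> Y) \<le> card (?P ` B)"
          using e(2)[OF w(2), of "?P ` B"] B(1) by blast
        moreover have "null_space (shift T w) \<inter> Y = null_space (shift T w) \<inter> UNIV"
          using null_space_shift_subset[OF w(1), of T n] by (auto simp: Y_def)
        ultimately show "cdim (null_space (shift T w) \<inter> UNIV) \<le> card B"
          using card_image_le[OF B(1), of ?P] by simp
      qed
    qed
    then show ?thesis using e(1) by blast
  qed
  show thesis
  proof (cases "0 < index_on Y T")
    case True
    show ?thesis
      by (rule that[of "1 / (2 * C)"]) (use C usf_shift True in \<open>auto simp: Y_def\<close>)
  next
    case False
    then obtain e where e: "e > 0" "\<And>w. w \<noteq> 0 \<Longrightarrow> cmod w < e \<Longrightarrow> upper_semi_fredholm (shift T w) \<Longrightarrow> \<not> 0 < fredholm_index (shift T w)"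
      using index by blast
    show ?thesis
      by (rule that[of "min e (1 / (2 * C))"]) (use C usf_shift e in auto)
  qed
qed

lemma upper_semi_b_fredholm_at_0: "upper_semi_b_fredholm_at T 0 \<longleftrightarrow> upper_semi_fredholm T"
  by (simp add: upper_semi_b_fredholm_at_def range_power_def)

lemma upper_semi_fredholm_imp_b_fredholm:
  assumes "upper_semi_fredholm T"
  shows "upper_semi_b_fredholm T" "b_fredholm_index T = fredholm_index T"
proof -
  have at: "upper_semi_b_fredholm_at T 0" using assms by (simp add: upper_semi_b_fredholm_at_0)
  then have "(LEAST n. upper_semi_b_fredholm_at T n) = 0" by (intro Least_equality) auto
  then show "b_fredholm_index T = fredholm_index T" by (simp add: b_fredholm_index_def range_power_def)
  show "upper_semi_b_fredholm T" unfolding upper_semi_b_fredholm_def using at by (rule exI)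
qed

lemma bounded_below_index:
  assumes "bounded_below T"
  shows "\<not> 0 < fredholm_index T"
proof -
  have N: "null_space T \<inter> UNIV = {0}" using assms by (simp add: bounded_below_def)
  have "cfinite_dim {0::'a}" "cdim {0::'a} = 0"
    using cfinite_dim_cspan[of "{}"] complex_vector.dim_le_card[of "{0}" "{}"] by simp_all
  then show ?thesis by (subst index_nonpos_iff) (simp_all only: N le0 simp_thms)
qed


section \<open>Left poles\<close>

text \<open>The condition in \<open>left_poles\<close> that concerns the operator alone; being
  isolated in the spectrum is treated separately.\<close>

definition left_pole_at_zero :: "('a::complex_banach \<Rightarrow>\<^sub>C\<^sub>L 'a) \<Rightarrow> bool"
  where "left_pole_at_zero T \<longleftrightarrow> (\<exists>a. ascent T = enat a \<and> closed (range_power T (a + 1)))"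

text \<open>Ranges of powers from \<open>n\<close> on are closed. If \<open>a + 1 < n\<close> for
  the ascent \<open>a\<close>, the null spaces are constant from \<open>a\<close> on, and closedness
  descends one power at a time to \<open>a + 1\<close>.\<close>

lemma finite_ascent_imp_left_pole:
  fixes T :: "'a::complex_banach \<Rightarrow>\<^sub>C\<^sub>L 'a"
  assumes at: "upper_semi_b_fredholm_at T n" and m: "null_space T \<inter> range_power T m \<subseteq> {0}"
  shows "left_pole_at_zero T"
proof -
  interpret invariant_usf "range_power T n" T by (rule upper_semi_b_fredholm_at_invariant[OF at])
  have cl: "closed (range_power T k)" if "n \<le> k" for k
    using iterate_closed[of "k - n"] that by (simp add: range_power_add)
  obtain a where a: "ascent T = enat a"
    by (rule ascent_le[OF iffD2[OF null_power_eq_iff m]]) (rule that)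
  note asc = ascent_eq_enatD[OF a]
  have "closed (range_power T (a + 1))"
  proof (cases "n \<le> a + 1")
    case False
    then have "a + 1 \<le> n" by simp
    then show ?thesis
    proof (induction rule: inc_induct)
      case (step k)
      have "null_space (cblinfun_apply T ^^ k) = null_space (cblinfun_apply T ^^ Suc k)"
        using null_power_stable[OF asc, of k] null_power_stable[OF asc, of "Suc k"] step.hyps by simp
      then show ?case by (rule closed_range_power_pred[OF step.IH])
    qed (rule cl[OF order_refl])
  qed (rule cl)
  then show ?thesis unfolding left_pole_at_zero_def using a by blast
qed

lemma left_pole_imp_b_fredholm:
  fixes T :: "'a::complex_banach \<Rightarrow>\<^sub>C\<^sub>L 'a"
  assumes "left_pole_at_zero T"
  shows "upper_semi_b_fredholm T" "\<not> 0 < b_fredholm_index T"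
proof -
  obtain a where a: "ascent T = enat a" "closed (range_power T (Suc a))"
    using assms by (auto simp: left_pole_at_zero_def)
  note asc = ascent_eq_enatD[OF a(1)]
  have N: "null_space T \<inter> range_power T a \<subseteq> {0}" using asc null_power_eq_iff by blast
  have cl: "closed (range_power T a)" by (rule closed_range_power_pred[OF a(2) asc])
  have "cfinite_dim (null_space T \<inter> range_power T a)"
    unfolding cfinite_dim_def using N by (intro exI[of _ "{}"]) simp
  moreover have "T ` range_power T a = range_power T (Suc a)"
    using range_power_add[of 1 T a] by simp
  ultimately have at: "upper_semi_b_fredholm_at T a"
    using cl a(2) by (simp add: upper_semi_b_fredholm_at_def upper_semi_fredholm_on_def ecdim_def)
  then show "upper_semi_b_fredholm T" unfolding upper_semi_b_fredholm_def by (rule exI)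
  \<comment> \<open>The index is defined on the range of this power, not of the power
    \<open>a\<close> just found. Since the range of T^(a+n) lies in that of T^a, finite ascent is
    still visible there.\<close>
  define n where "n = (LEAST n. upper_semi_b_fredholm_at T n)"
  have atn: "upper_semi_b_fredholm_at T n" unfolding n_def by (rule LeastI[of "upper_semi_b_fredholm_at T", OF at])
  interpret invariant_usf "range_power T n" T by (rule upper_semi_b_fredholm_at_invariant[OF atn])
  have "range_power T (a + n) \<subseteq> range_power T a"
    unfolding range_power_def by (auto simp: funpow_add)
  then have "null_space T \<inter> (cblinfun_apply T ^^ a) ` range_power T n \<subseteq> {0}"
    using N unfolding range_power_add by blast
  then show "\<not> 0 < b_fredholm_index T"
    unfolding b_fredholm_index_def n_def[symmetric] by (rule index_nonpos_if_finite_ascent)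
qed

text \<open>A finite-dimensional null space is inherited by all powers, so T^(a+1) is semi-Fredholm.
  A bounded sequence with T x_n tending to 0 has T^(a+1) x_n tending to 0 as well, and hence
  subconverges.\<close>

lemma left_pole_imp_fredholm:
  fixes T :: "'a::complex_banach \<Rightarrow>\<^sub>C\<^sub>L 'a"
  assumes "left_pole_at_zero T" and fin: "ecdim (null_space T) < \<infinity>"
  shows "upper_semi_fredholm T"
proof -
  obtain a where a: "ascent T = enat a" "closed (range_power T (Suc a))"
    using assms by (auto simp: left_pole_at_zero_def)
  let ?P = "cblinfun_power T (Suc a)"
  have N: "cfinite_dim (null_space (cblinfun_power T k))" for k
  proof (induction k)
    case 0
    have "null_space (cblinfun_power T 0) = cspan {}" by (auto simp: null_space_def cblinfun_id_apply)
    then show ?case using cfinite_dim_cspan[of "{}"] by simp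
  next
    case (Suc k)
    have eq: "null_space (cblinfun_power T (Suc k)) = {x \<in> UNIV. T x \<in> null_space (cblinfun_power T k)}"
      unfolding cblinfun_power_apply by (auto simp: null_space_def funpow_swap1)
    show ?case
      unfolding eq using fin
      by (intro cfinite_dim_preimage complex_vector.subspace_UNIV csubspace_null_space Suc)
        (simp add: ecdim_def split: if_splits)
  qed
  have "upper_semi_fredholm ?P"
    using a(2) N[of "Suc a"]
    by (simp add: upper_semi_fredholm_on_def ecdim_def range_power_def cblinfun_power_apply del: cblinfun_power.simps funpow.simps)
  then obtain \<Phi> C where est: "lower_estimate UNIV ?P \<Phi> C"
    unfolding upper_semi_fredholm_on_iff[OF complex_vector.subspace_UNIV closed_UNIV] by (elim exE)
  have S: "subsequence_property UNIV ?P"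
    by (rule lower_estimate_imp_subsequence_property[OF est complex_vector.subspace_UNIV])
  have "subsequence_property UNIV T"
    unfolding subsequence_property_def
  proof (intro allI impI)
    fix x assume x: "bounded (range x)" "(\<lambda>n. T (x n)) \<longlonglongrightarrow> 0"
    have "(\<lambda>n. cblinfun_power T a (T (x n))) \<longlonglongrightarrow> cblinfun_power T a 0"
      by (rule cblinfun_tendsto[OF x(2)])
    moreover have "cblinfun_power T a (T (x n)) = ?P (x n)" for n
      unfolding cblinfun_power_apply by (simp add: funpow_swap1)
    ultimately have "(\<lambda>n. ?P (x n)) \<longlonglongrightarrow> 0" by (simp add: cblinfun_linear_simps del: cblinfun_power.simps)
    then show "\<exists>r::nat\<Rightarrow>nat. strict_mono r \<and> convergent (x \<circ> r)"
      using S x(1) unfolding subsequence_property_def by blast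
  qed
  then show ?thesis by (rule subsequence_property_imp_usf[OF _ complex_vector.subspace_UNIV closed_UNIV])
qed

section \<open>The approximate point spectrum\<close>

lemma bounded_below_iff_estimate: "bounded_below T \<longleftrightarrow> (\<exists>C. lower_estimate UNIV T {} C)"
  by (simp add: bounded_below_iff lower_estimate_def)

lemma not_sigma_a_near:
  assumes "z \<notin> sigma_a T"
  obtains e where "e > 0" "ball z e \<inter> sigma_a T = {}"
proof -
  obtain C where "lower_estimate UNIV (shift T z) {} C"
    using assms by (auto simp: sigma_a_def bounded_below_iff_estimate)
  then obtain D where D: "D > 0" "lower_estimate UNIV (shift T z) {} D" by (rule lower_estimate_pos) (rule that)
  have "y \<notin> sigma_a T" if y: "dist z y < 1 / (2 * D)" for y
  proof -
    have "D * cmod (y - z) \<le> 1 / 2" using y D(1) by (simp add: dist_norm norm_minus_commute field_simps)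
    then have "lower_estimate UNIV (shift (shift T z) (y - z)) {} (2 * D)"
      by (rule lower_estimate_shift[OF D(2,1)])
    then have "lower_estimate UNIV (shift T y) {} (2 * D)" unfolding shift_shift by simp
    then show ?thesis by (auto simp: sigma_a_def bounded_below_iff_estimate)
  qed
  then show thesis using D(1) by (intro that[of "1 / (2 * D)"]) auto
qed

lemma closed_sigma_a: "closed (sigma_a T)"
  unfolding closed_def open_contains_ball using not_sigma_a_near[of _ T] by (metis ComplD ComplI IntI empty_iff subsetI)

lemma acc_sigma_a_subset: "acc (sigma_a T) \<subseteq> sigma_a T"
  using closed_sigma_a[of T] by (auto simp: acc_def closed_limpt)

lemma sigma_a_bound:
  assumes "z \<in> sigma_a T"
  shows "cmod z \<le> norm T"
proof (rule ccontr)
  assume z: "\<not> cmod z \<le> norm T"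
  have "norm x \<le> inverse (cmod z - norm T) * norm (shift T z x)" for x
  proof -
    have "cmod z * norm x \<le> norm (shift T z x) + norm (T x)"
      using norm_triangle_ineq4[of "T x" "shift T z x"] by (simp add: shift_apply norm_scaleC)
    then have "(cmod z - norm T) * norm x \<le> norm (shift T z x)"
      using norm_cblinfun_le[of T x] by (simp add: left_diff_distrib)
    then show ?thesis using z by (simp add: field_simps)
  qed
  then show False using assms by (auto simp: sigma_a_def bounded_below_iff)
qed

lemma compact_sigma_a: "compact (sigma_a T)"
  using closed_sigma_a[of T] sigma_a_bound[of _ T] by (auto simp: compact_eq_bounded_closed bounded_iff)

lemma vector_analytic_on_translate:
  assumes "vector_analytic_on f (ball 0 r)"
  shows "vector_analytic_on (\<lambda>w. f (w - z)) (ball z r)"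
  unfolding vector_analytic_on_def
proof
  fix w assume "w \<in> ball z r"
  then have "w - z \<in> ball 0 r" by (simp add: dist_norm norm_minus_commute)
  then obtain d where d: "(f has_derivative (\<lambda>h. h *\<^sub>C d)) (at (w - z))"
    using assms unfolding vector_analytic_on_def by blast
  have "((\<lambda>w. w - z) has_derivative (\<lambda>h. h)) (at w)" by (auto intro!: derivative_eq_intros)
  from has_derivative_compose[OF this d]
  show "\<exists>d. ((\<lambda>w. f (w - z)) has_derivative (\<lambda>h. h *\<^sub>C d)) (at w)" by blast
qed

text \<open>Spectral form of \<open>dichotomy\<close>. In the first case injectivity on an iterated
  range excludes nearby eigenvalues and \<open>shift_fredholm_near\<close> supplies closed range
  there; in the second the eigenvector function both fills a disc with spectrum and violates the
  SVEP.\<close>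

lemma b_fredholm_dichotomy:
  fixes T :: "'a::complex_banach \<Rightarrow>\<^sub>C\<^sub>L 'a"
  assumes at: "upper_semi_b_fredholm_at (shift T z) n"
  shows "left_pole_at_zero (shift T z) \<and> z \<notin> acc (sigma_a T) \<and>
      (upper_semi_fredholm (shift T z) \<longrightarrow> \<not> 0 < fredholm_index (shift T z)) \<or>
    (\<exists>r>0. ball z r \<subseteq> sigma_a T) \<and> \<not> svep_at T z"
proof -
  let ?S = "shift T z"
  interpret invariant_usf "range_power ?S n" ?S by (rule upper_semi_b_fredholm_at_invariant[OF at])
  from dichotomy show ?thesis
  proof
    assume "\<exists>m. null_space ?S \<inter> (cblinfun_apply ?S ^^ m) ` range_power ?S n \<subseteq> {0}"
    then obtain m where m: "null_space ?S \<inter> (cblinfun_apply ?S ^^ m) ` range_power ?S n \<subseteq> {0}" by blast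
    obtain e where e: "e > 0" "\<And>w x. w \<noteq> 0 \<Longrightarrow> cmod w < e \<Longrightarrow> x \<in> range_power ?S n \<Longrightarrow> shift ?S w x = 0 \<Longrightarrow> x = 0"
      by (rule injective_near[OF m]) (rule that)
    obtain d where d: "d > 0" "\<And>w. w \<noteq> 0 \<Longrightarrow> cmod w < d \<Longrightarrow> upper_semi_fredholm (shift ?S w)"
      by (rule shift_fredholm_near[OF at]) (rule that)
    have "z \<notin> acc (sigma_a T)"
    proof
      assume "z \<in> acc (sigma_a T)"
      then obtain y where y: "y \<in> sigma_a T" "y \<noteq> z" "dist y z < min d e"
        using d(1) e(1) by (auto simp: acc_def islimpt_approachable dest!: spec[of _ "min d e"])
      have w: "y - z \<noteq> 0" "cmod (y - z) < d" "cmod (y - z) < e" using y by (auto simp: dist_norm)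
      have "null_space (shift ?S (y - z)) \<subseteq> {0}"
        using e(2)[OF w(1,3)] null_space_shift_subset[OF w(1), of ?S n] by (auto simp: null_space_def)
      then have "null_space (shift ?S (y - z)) = {0}" by (auto simp: null_space_def cblinfun_linear_simps)
      then have "bounded_below (shift ?S (y - z))"
        using d(2)[OF w(1,2)] by (simp add: bounded_below_iff_usf)
      then show False using y(1) unfolding shift_shift by (simp add: sigma_a_def)
    qed
    moreover have m': "null_space ?S \<inter> range_power ?S (m + n) \<subseteq> {0}" using m unfolding range_power_add .
    then have "left_pole_at_zero ?S" by (rule finite_ascent_imp_left_pole[OF at])
    moreover have "\<not> 0 < fredholm_index ?S" if "upper_semi_fredholm ?S"
    proof -
      interpret U: invariant_usf UNIV ?S by unfold_locales (auto intro: that complex_vector.subspace_UNIV)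
      show ?thesis
        by (rule U.index_nonpos_if_finite_ascent[of "m + n"]) (use m' in \<open>simp add: range_power_def\<close>)
    qed
    ultimately show ?thesis by blast
  next
    assume "\<exists>r>0. \<exists>f. vector_analytic_on f (ball 0 r) \<and> (\<forall>w\<in>ball 0 r. shift ?S w (f w) = 0 \<and> f w \<noteq> 0)"
    then obtain r f where r: "r > 0" and f: "vector_analytic_on f (ball 0 r)"
      "\<And>w. w \<in> ball 0 r \<Longrightarrow> shift ?S w (f w) = 0" "\<And>w. w \<in> ball 0 r \<Longrightarrow> f w \<noteq> 0" by blast
    have in0: "w - z \<in> ball 0 r" if "w \<in> ball z r" for w
      using that by (simp add: dist_norm norm_minus_commute)
    have eig: "shift T w (f (w - z)) = 0" if "w \<in> ball z r" for w
      using f(2)[OF in0[OF that]] unfolding shift_shift by simp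
    have "ball z r \<subseteq> sigma_a T"
    proof
      fix w assume w: "w \<in> ball z r"
      have "f (w - z) \<in> null_space (shift T w)" using eig[OF w] by (simp add: null_space_def)
      then show "w \<in> sigma_a T" using f(3)[OF in0[OF w]] by (auto simp: sigma_a_def bounded_below_def)
    qed
    moreover have "\<not> svep_at T z"
    proof
      assume "svep_at T z"
      then have "\<forall>w\<in>ball z r. f (w - z) = 0"
        using r vector_analytic_on_translate[OF f(1), of z] eig unfolding svep_at_def by blast
      then show False using f(3)[of 0] r by (auto dest: bspec[of _ _ z])
    qed
    ultimately show ?thesis using r by blast
  qed
qed

lemma ball_subset_acc:
  assumes "ball z r \<subseteq> K" "w \<in> ball z r"
  shows "w \<in> acc K"
  unfolding acc_def using interior_maximal[OF assms(1) open_ball] assms(2)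
  by (auto intro: interior_limit_point)

lemma left_poles_iff: "z \<in> left_poles T \<longleftrightarrow> z \<in> sigma_a T \<and> z \<notin> acc (sigma_a T) \<and> left_pole_at_zero (shift T z)"
  by (auto simp: left_poles_def iso_def left_pole_at_zero_def)

text \<open>The disc alternative of \<open>b_fredholm_dichotomy\<close> would make \<open>z\<close>
  an accumulation point. Hence the index condition in \<open>sigma_aw\<close> is automatic at
  semi-Fredholm points off the accumulation points.\<close>

lemma fredholm_not_acc:
  assumes "upper_semi_fredholm (shift T z)" "z \<notin> acc (sigma_a T)"
  shows "left_pole_at_zero (shift T z)" "\<not> 0 < fredholm_index (shift T z)"
proof -
  have at: "upper_semi_b_fredholm_at (shift T z) 0" using assms(1) by (simp add: upper_semi_b_fredholm_at_0)
  have "\<not> ball z r \<subseteq> sigma_a T" if "r > 0" for r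
    using ball_subset_acc[of z r "sigma_a T" z] assms(2) that by auto
  then show "left_pole_at_zero (shift T z)" "\<not> 0 < fredholm_index (shift T z)"
    using b_fredholm_dichotomy[OF at] assms(1) by blast+
qed

lemma left_poles_finite_iff:
  "z \<in> left_poles_finite T \<longleftrightarrow> z \<in> sigma_a T \<and> upper_semi_fredholm (shift T z) \<and> z \<notin> acc (sigma_a T)"
proof
  assume "z \<in> left_poles_finite T"
  then show "z \<in> sigma_a T \<and> upper_semi_fredholm (shift T z) \<and> z \<notin> acc (sigma_a T)"
    using left_pole_imp_fredholm by (auto simp: left_poles_finite_def left_poles_iff)
next
  assume z: "z \<in> sigma_a T \<and> upper_semi_fredholm (shift T z) \<and> z \<notin> acc (sigma_a T)"
  then have "ecdim (null_space (shift T z)) < \<infinity>" by (simp add: upper_semi_fredholm_on_def)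
  then show "z \<in> left_poles_finite T"
    using z fredholm_not_acc(1) by (auto simp: left_poles_finite_def left_poles_iff)
qed

text \<open>At isolated points of \<open>sigma_a\<close>, membership in \<open>sigma_aw\<close> just
  means failing to be semi-Fredholm, which is also what membership in
  \<open>left_poles_finite\<close> excludes. So the two sides of a-Browder's theorem can differ at
  accumulation points only.\<close>

lemma a_browder_iff: "a_browder T \<longleftrightarrow> acc (sigma_a T) \<subseteq> sigma_aw T"
proof
  assume "a_browder T"
  then show "acc (sigma_a T) \<subseteq> sigma_aw T"
    using acc_sigma_a_subset by (auto simp: a_browder_def left_poles_finite_iff)
next
  assume acc: "acc (sigma_a T) \<subseteq> sigma_aw T"
  have "z \<in> sigma_aw T \<longleftrightarrow> z \<in> sigma_a T - left_poles_finite T" for z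
    using acc fredholm_not_acc(2)[of T z] by (auto simp: sigma_aw_def left_poles_finite_iff)
  then show "a_browder T" unfolding a_browder_def by blast
qed

text \<open>As \<open>sigma_SBF\<close> is not confined to \<open>sigma_a\<close> by definition,
  points outside \<open>sigma_a\<close> count too; there the operator is bounded below, hence
  semi-Fredholm of nonpositive index.\<close>

lemma sigma_SBF_subset_sigma_aw: "sigma_SBF T \<subseteq> sigma_aw T"
proof
  fix z assume z: "z \<in> sigma_SBF T"
  show "z \<in> sigma_aw T"
  proof (rule ccontr)
    assume "z \<notin> sigma_aw T"
    then have "upper_semi_fredholm (shift T z) \<and> \<not> 0 < fredholm_index (shift T z)"
      using bounded_below_index[of "shift T z"] bounded_below_iff_usf[of "shift T z"]
      by (auto simp: sigma_aw_def sigma_a_def)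
    then show False
      using z upper_semi_fredholm_imp_b_fredholm[of "shift T z"] by (auto simp: sigma_SBF_def)
  qed
qed

lemma generalized_a_browder_iff: "generalized_a_browder T \<longleftrightarrow> acc (sigma_a T) \<subseteq> sigma_SBF T"
proof
  assume "generalized_a_browder T"
  then show "acc (sigma_a T) \<subseteq> sigma_SBF T"
    using acc_sigma_a_subset by (auto simp: generalized_a_browder_def left_poles_iff)
next
  assume acc: "acc (sigma_a T) \<subseteq> sigma_SBF T"
  have "sigma_SBF T = sigma_a T - left_poles T"
  proof (intro equalityI subsetI)
    fix z assume z: "z \<in> sigma_SBF T"
    have "z \<in> sigma_a T" using z sigma_SBF_subset_sigma_aw by (auto simp: sigma_aw_def)
    moreover have "z \<notin> left_poles T"
      using z left_pole_imp_b_fredholm[of "shift T z"] by (auto simp: sigma_SBF_def left_poles_iff)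
    ultimately show "z \<in> sigma_a T - left_poles T" by simp
  next
    fix z assume z: "z \<in> sigma_a T - left_poles T"
    show "z \<in> sigma_SBF T"
    proof (rule ccontr)
      assume n: "z \<notin> sigma_SBF T"
      then have "z \<notin> acc (sigma_a T)" using acc by blast
      moreover obtain n where "upper_semi_b_fredholm_at (shift T z) n"
        using n by (auto simp: sigma_SBF_def upper_semi_b_fredholm_def)
      ultimately have "left_pole_at_zero (shift T z)"
        using b_fredholm_dichotomy[of T z n] ball_subset_acc[of z _ "sigma_a T" z] centre_in_ball by blast
      then show False using z \<open>z \<notin> acc (sigma_a T)\<close> by (simp add: left_poles_iff)
    qed
  qed
  then show "generalized_a_browder T" by (simp add: generalized_a_browder_def)
qed

text \<open>If an accumulation point \<open>z\<close> escaped \<open>sigma_SBF\<close>, the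
  dichotomy would fill a disc around \<open>z\<close> with spectrum, while a punctured disc consists
  of semi-Fredholm points of nonpositive index; a point of both is an accumulation point outside
  \<open>sigma_aw\<close>.\<close>

theorem a_browder_iff_generalized: "a_browder T \<longleftrightarrow> generalized_a_browder T"
proof
  assume "generalized_a_browder T"
  then show "a_browder T"
    using sigma_SBF_subset_sigma_aw unfolding a_browder_iff generalized_a_browder_iff by blast
next
  assume "a_browder T"
  then have acc: "acc (sigma_a T) \<subseteq> sigma_aw T" by (simp add: a_browder_iff)
  show "generalized_a_browder T"
    unfolding generalized_a_browder_iff
  proof
    fix z assume z: "z \<in> acc (sigma_a T)"
    show "z \<in> sigma_SBF T"
    proof (rule ccontr)
      assume n: "z \<notin> sigma_SBF T"
      define n where "n = (LEAST n. upper_semi_b_fredholm_at (shift T z) n)"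
      have "\<exists>n. upper_semi_b_fredholm_at (shift T z) n"
        using n by (simp add: sigma_SBF_def upper_semi_b_fredholm_def)
      then have at: "upper_semi_b_fredholm_at (shift T z) n" unfolding n_def by (rule LeastI_ex)
      have ind: "\<not> 0 < index_on (range_power (shift T z) n) (shift T z)"
        using n by (auto simp: sigma_SBF_def b_fredholm_index_def n_def)
      obtain r where r: "r > 0" "ball z r \<subseteq> sigma_a T"
        using b_fredholm_dichotomy[OF at] z by blast
      obtain e where e: "e > 0" "\<And>w. w \<noteq> 0 \<Longrightarrow> cmod w < e \<Longrightarrow> upper_semi_fredholm (shift (shift T z) w)"
        "\<And>w. w \<noteq> 0 \<Longrightarrow> cmod w < e \<Longrightarrow> \<not> 0 < index_on (range_power (shift T z) n) (shift T z) \<Longrightarrow>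
          \<not> 0 < fredholm_index (shift (shift T z) w)"
        by (rule shift_fredholm_near[OF at]) (rule that)
      define w where "w = complex_of_real (min r e / 2)"
      have w: "w \<noteq> 0" "cmod w < r" "cmod w < e"
        using r(1) e(1) unfolding w_def norm_of_real by auto
      have "z + w \<in> acc (sigma_a T)"
        by (rule ball_subset_acc[OF r(2)]) (use w in \<open>simp add: dist_norm\<close>)
      then have "z + w \<in> sigma_aw T" using acc by blast
      then show False
        using e(2)[OF w(1,3)] e(3)[OF w(1,3) ind] unfolding shift_shift by (simp add: sigma_aw_def)
    qed
  qed
qed


section \<open>The single-valued extension property\<close>

lemma svep_imp_not_acc:
  assumes "upper_semi_fredholm (shift T z)" "svep_at T z"
  shows "z \<notin> acc (sigma_a T)"
proof -
  have "upper_semi_b_fredholm_at (shift T z) 0" using assms(1) by (simp add: upper_semi_b_fredholm_at_0)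
  from b_fredholm_dichotomy[OF this] show ?thesis using assms(2) by blast
qed

lemma not_acc_imp_svep:
  assumes z: "z \<notin> acc (sigma_a T)"
  shows "svep_at T z"
  unfolding svep_at_def
proof (intro allI impI ballI, elim conjE)
  fix r f w assume r: "r > 0" and f: "vector_analytic_on f (ball z r)" "\<forall>w\<in>ball z r. shift T w (f w) = 0"
    and w: "w \<in> ball z r"
  obtain e where e: "e > 0" "\<And>y. y \<in> sigma_a T \<Longrightarrow> y \<noteq> z \<Longrightarrow> \<not> dist y z < e"
    using z by (auto simp: acc_def islimpt_approachable)
  have f0: "f y = 0" if "y \<noteq> z" "dist y z < e" "y \<in> ball z r" for y
  proof -
    have "bounded_below (shift T y)" using e(2)[of y] that by (auto simp: sigma_a_def)
    moreover have "f y \<in> null_space (shift T y)" using f(2) that by (simp add: null_space_def)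
    ultimately show ?thesis by (auto simp: bounded_below_def)
  qed
  \<comment> \<open>A functional norming \<open>f w\<close> reduces the vanishing of
    \<open>f w\<close> to the identity theorem for a scalar holomorphic function that vanishes on a
    punctured disc around \<open>z\<close>.\<close>
  obtain \<phi> :: "'a \<Rightarrow>\<^sub>C\<^sub>L complex" where \<phi>: "\<phi> (f w) = complex_of_real (norm (f w))"
    by (rule exists_norming_functional) (rule that)
  define g where "g y = \<phi> (f y)" for y
  have "g holomorphic_on ball z r"
    unfolding holomorphic_on_def
  proof
    fix y assume "y \<in> ball z r"
    then obtain d where "(f has_derivative (\<lambda>h. h *\<^sub>C d)) (at y)"
      using f(1) unfolding vector_analytic_on_def by blast
    then have "((\<lambda>y. \<phi> (f y)) has_derivative (\<lambda>h. \<phi> (h *\<^sub>C d))) (at y)"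
      by (rule bounded_linear.has_derivative[OF bounded_linear_cblinfun_apply])
    then have "(g has_field_derivative \<phi> d) (at y)"
      unfolding g_def has_field_derivative_def by (simp add: cblinfun_apply_scaleC mult_commute_abs)
    then show "g field_differentiable (at y within ball z r)"
      by (meson field_differentiable_at_within field_differentiable_def)
  qed
  moreover have "z islimpt (ball z (min e r) - {z})"
    using e(1) r by (subst islimpt_punctured[symmetric]) (auto intro: interior_limit_point simp: interior_open)
  moreover have "g y = 0" if "y \<in> ball z (min e r) - {z}" for y
    using f0[of y] that by (simp add: g_def dist_commute cblinfun_linear_simps)
  moreover have "ball z (min e r) - {z} \<subseteq> ball z r" by (intro subsetI) simp
  ultimately have "g w = 0"
    using analytic_continuation[of g "ball z r" "ball z (min e r) - {z}" z w] r w by auto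
  then show "f w = 0" using \<phi> by (simp add: g_def)
qed

section \<open>Commuting operators\<close>

text \<open>Plays the role of surjectivity: \<open>p\<close> may be degenerate and polynomials need
  not be complete for it, so equations are solved only up to any positive error.\<close>

definition dense_range_wrt :: "('v::ab_group_add \<Rightarrow> real) \<Rightarrow> ('v \<Rightarrow> 'v) \<Rightarrow> bool"
  where "dense_range_wrt p F \<longleftrightarrow> (\<forall>y. \<forall>e>0. \<exists>x. p (F x - y) < e)"

definition bounded_functional :: "(complex poly \<Rightarrow> real) \<Rightarrow> real \<Rightarrow> (complex poly \<Rightarrow> complex) \<Rightarrow> bool"
  where "bounded_functional p c \<phi> \<longleftrightarrow> (\<forall>x y. \<phi> (x + y) = \<phi> x + \<phi> y) \<and>
    (\<forall>a x. \<phi> (smult a x) = a * \<phi> x) \<and> (\<forall>x. cmod (\<phi> x) \<le> c * p x)"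

text \<open>Models an operator, multiplication by the variable, that is bounded by \<open>R\<close>
  and has empty approximate point spectrum, with a lower bound uniform in the parameter. The aim is
  to show that such a seminorm vanishes at 1.\<close>

locale poly_seminorm = complex_seminorm smult p for p :: "complex poly \<Rightarrow> real" +
  fixes R \<delta> :: real
  assumes \<delta>: "\<delta> > 0" and R: "R \<ge> 0"
    and upper: "p (pCons 0 q) \<le> R * p q"
    and lower: "\<delta> * p q \<le> p ([:-\<mu>, 1:] * q)"
begin

lemma linear_factor_mult: "[:-\<mu>, 1:] * q = pCons 0 q - smult \<mu> (q :: complex poly)"
  by simp

lemma mult_upper: "p ([:-\<mu>, 1:] * q) \<le> (R + cmod \<mu>) * p q"
proof -
  have "p ([:-\<mu>, 1:] * q) \<le> p (smult (-\<mu>) q) + p (pCons 0 q)"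
    using p_add[of "smult (-\<mu>) q" "pCons 0 q"] by simp
  also have "p (smult (-\<mu>) q) = cmod \<mu> * p q" by (simp only: p_scale norm_minus_cancel)
  finally show ?thesis using upper[of q] by (simp add: algebra_simps)
qed

lemma dense_range_if_halving:
  assumes "\<And>y. \<exists>x. p ([:-\<mu>, 1:] * x - y) \<le> p y / 2"
  shows "dense_range_wrt p ((*) [:-\<mu>, 1:])"
  unfolding dense_range_wrt_def
proof (intro allI impI)
  fix y and e :: real assume e: "e > 0"
  have iter: "\<exists>x. p ([:-\<mu>, 1:] * x - y) \<le> p y * (1/2) ^ n" for n
  proof (induction n)
    case 0
    show ?case by (intro exI[of _ 0]) (simp add: p_minus)
  next
    case (Suc n)
    then obtain x where x: "p ([:-\<mu>, 1:] * x - y) \<le> p y * (1/2) ^ n" by blast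
    obtain x' where x': "p ([:-\<mu>, 1:] * x' - (y - [:-\<mu>, 1:] * x)) \<le> p (y - [:-\<mu>, 1:] * x) / 2"
      using assms by blast
    have eq: "[:-\<mu>, 1:] * (x + x') - y = [:-\<mu>, 1:] * x' - (y - [:-\<mu>, 1:] * x)"
      by (simp add: algebra_simps)
    have "p y * (1/2) ^ Suc n = p y * (1/2) ^ n / 2" by simp
    then have "p ([:-\<mu>, 1:] * (x + x') - y) \<le> p y * (1/2) ^ Suc n"
      unfolding eq using x x' p_minus_commute[of y "[:-\<mu>, 1:] * x"] by linarith
    then show ?case by (rule exI)
  qed
  have "(\<lambda>n. p y * (1/2) ^ n) \<longlonglongrightarrow> 0"
    by (intro tendsto_mult_right_zero LIMSEQ_realpow_zero) auto
  then have "\<forall>\<^sub>F n in sequentially. p y * (1/2) ^ n < e" by (rule order_tendstoD(2)[OF _ e])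
  then obtain n where n: "p y * (1/2) ^ n < e" using eventually_happens'[OF sequentially_bot] by blast
  show "\<exists>x. p ([:-\<mu>, 1:] * x - y) < e" using iter[of n] n by (meson order_le_less_trans)
qed

text \<open>First term of the Neumann series: for x = - y / \<mu> the residual is the variable times
  x, of size at most R / |\<mu>| times \<open>p y\<close>.\<close>

lemma dense_range_large:
  assumes "cmod \<mu> \<ge> 2 * R" "\<mu> \<noteq> 0"
  shows "dense_range_wrt p ((*) [:-\<mu>, 1:])"
proof (rule dense_range_if_halving, rule exI)
  fix y
  let ?x = "smult (- inverse \<mu>) y"
  have "smult \<mu> ?x = - y" using assms(2) by simp
  then have "[:-\<mu>, 1:] * ?x - y = pCons 0 ?x" unfolding linear_factor_mult by simp
  then have "p ([:-\<mu>, 1:] * ?x - y) \<le> R * p ?x" using upper by metis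
  also have "\<dots> = R * (inverse (cmod \<mu>) * p y)" by (simp only: p_scale norm_minus_cancel norm_inverse)
  also have "\<dots> \<le> p y / 2"
    using assms R p_nonneg[of y] mult_right_mono[OF assms(1) p_nonneg[of y]] by (simp add: field_simps)
  finally show "p ([:-\<mu>, 1:] * ?x - y) \<le> p y / 2" .
qed

text \<open>A solution up to \<open>p y / 4\<close> satisfies
  \<open>\<delta> * p x \<le> 5 / 4 * p y\<close> by the lower bound, so moving the parameter by
  \<open>\<delta> / 5\<close> costs at most another \<open>p y / 4\<close>. The step width does not
  depend on the parameter.\<close>

lemma dense_range_step:
  assumes dense: "dense_range_wrt p ((*) [:-\<mu>, 1:])" and near: "cmod (\<mu> - \<nu>) \<le> \<delta> / 5"
  shows "dense_range_wrt p ((*) [:-\<nu>, 1:])"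
proof (rule dense_range_if_halving)
  fix y
  show "\<exists>x. p ([:-\<nu>, 1:] * x - y) \<le> p y / 2"
  proof (cases "p y = 0")
    case True
    then show ?thesis by (intro exI[of _ 0]) (simp add: p_minus)
  next
    case False
    then have "p y / 4 > 0" using p_nonneg[of y] by simp
    then obtain x where x: "p ([:-\<mu>, 1:] * x - y) < p y / 4"
      using dense unfolding dense_range_wrt_def by blast
    have "\<delta> * p x \<le> p (([:-\<mu>, 1:] * x - y) + y)" using lower[of x \<mu>] by simp
    also have "\<dots> \<le> p y / 4 + p y" using p_add[of "[:-\<mu>, 1:] * x - y" y] x by linarith
    finally have \<delta>x: "\<delta> * p x \<le> 5 / 4 * p y" by simp
    have "[:-\<nu>, 1:] * x - y = ([:-\<mu>, 1:] * x - y) + smult (\<mu> - \<nu>) x"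
      by (simp add: smult_diff_left)
    then have "p ([:-\<nu>, 1:] * x - y) \<le> p ([:-\<mu>, 1:] * x - y) + cmod (\<mu> - \<nu>) * p x"
      using p_add[of "[:-\<mu>, 1:] * x - y" "smult (\<mu> - \<nu>) x"] by (simp only: p_scale)
    also have "\<dots> \<le> p y / 4 + \<delta> / 5 * p x"
      using x near p_nonneg[of x] by (intro add_mono mult_right_mono) auto
    also have "\<dots> \<le> p y / 2" using \<delta>x by simp
    finally show ?thesis by blast
  qed
qed

text \<open>Density holds for large parameters and spreads in steps of \<open>\<delta> / 5\<close>;
  \<open>\<mu>\<close> is reached from a far point on the horizontal ray to its right.\<close>

lemma dense_range: "dense_range_wrt p ((*) [:-\<mu>, 1:])"
proof -
  have shifted: "dense_range_wrt p ((*) [:-\<mu>, 1:])"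
    if "dense_range_wrt p ((*) [:-(\<mu> + of_real (real n * (\<delta> / 5))), 1:])" for n
    using that
  proof (induction n)
    case (Suc n)
    have step: "cmod ((\<mu> + of_real (real (Suc n) * (\<delta> / 5))) - (\<mu> + of_real (real n * (\<delta> / 5)))) = \<delta> / 5"
    proof -
      have "(\<mu> + of_real (real (Suc n) * (\<delta> / 5))) - (\<mu> + of_real (real n * (\<delta> / 5))) = of_real (\<delta> / 5)"
        unfolding add_diff_cancel_left of_real_diff[symmetric] by (simp add: algebra_simps add_divide_distrib)
      then show ?thesis using \<delta> by (simp only: norm_of_real abs_of_pos)
    qed
    show ?case by (rule Suc.IH, rule dense_range_step[OF Suc.prems]) (simp only: step order_refl)
  qed simp
  obtain n where n: "(2 * R + cmod \<mu> + 1) / (\<delta> / 5) \<le> real n" using real_arch_simple by blast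
  then have "2 * R + cmod \<mu> + 1 \<le> real n * (\<delta> / 5)" using \<delta> by (simp add: field_simps)
  moreover have "real n * (\<delta> / 5) - cmod \<mu> \<le> cmod (\<mu> + of_real (real n * (\<delta> / 5)))"
    using norm_diff_ineq[of "of_real (real n * (\<delta> / 5))" \<mu>] \<delta>
    by (simp only: norm_of_real add.commute[of \<mu>])
  ultimately have "2 * R + 1 \<le> cmod (\<mu> + of_real (real n * (\<delta> / 5)))" by linarith
  then show ?thesis using R by (intro shifted[of n] dense_range_large) auto
qed

lemma dense_range_compose:
  assumes F: "dense_range_wrt p F" "\<And>x y. F (x - y) = F x - F y" "\<And>x. p (F x) \<le> K * p x"
    and G: "dense_range_wrt p G"
  shows "dense_range_wrt p (\<lambda>x. F (G x))"
  unfolding dense_range_wrt_def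
proof (intro allI impI)
  fix y and e :: real assume e: "e > 0"
  then obtain z where z: "p (F z - y) < e / 2" using F(1) unfolding dense_range_wrt_def by (meson half_gt_zero)
  have "e / (2 * (\<bar>K\<bar> + 1)) > 0" using e by simp
  then obtain x where x: "p (G x - z) < e / (2 * (\<bar>K\<bar> + 1))" using G unfolding dense_range_wrt_def by blast
  have "F (G x) - y = F (G x - z) + (F z - y)" by (simp add: F(2))
  then have "p (F (G x) - y) \<le> p (F (G x - z)) + p (F z - y)" using p_add by metis
  also have "p (F (G x - z)) \<le> (\<bar>K\<bar> + 1) * p (G x - z)"
    by (rule order_trans[OF F(3)]) (intro mult_right_mono p_nonneg, simp)
  also have "\<dots> \<le> (\<bar>K\<bar> + 1) * (e / (2 * (\<bar>K\<bar> + 1)))" using x by (intro mult_left_mono) auto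
  also have "\<dots> = e / 2" by (simp add: field_simps)
  finally show "\<exists>x. p (F (G x) - y) < e" using z by (intro exI[of _ x]) linarith
qed

text \<open>\<open>c\<close> witnesses continuity only qualitatively: by density the sharper
  constant \<open>k\<close>, checked on the range of \<open>F\<close>, is valid everywhere.\<close>

lemma functional_bound:
  assumes \<psi>: "bounded_functional p c \<psi>" and F: "dense_range_wrt p F"
    and k: "k \<ge> 0" "\<And>x. cmod (\<psi> (F x)) \<le> k * p (F x)"
  shows "cmod (\<psi> y) \<le> k * p y"
proof (rule field_le_epsilon)
  fix e :: real assume e: "e > 0"
  define d where "d = e / (k + \<bar>c\<bar> + 1)"
  have d: "d > 0" using e k(1) by (simp add: d_def)
  obtain x where x: "p (F x - y) < d" using F d unfolding dense_range_wrt_def by blast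
  have "\<psi> y = \<psi> (F x) + \<psi> (y - F x)"
    using \<psi> unfolding bounded_functional_def by (metis add.commute diff_add_cancel)
  then have "cmod (\<psi> y) \<le> cmod (\<psi> (F x)) + cmod (\<psi> (y - F x))" by (simp only: norm_triangle_ineq)
  also have "cmod (\<psi> (F x)) \<le> k * (p y + d)"
  proof -
    have "p (F x) \<le> p y + d" using p_add[of y "F x - y"] x by simp
    then show ?thesis using k by (meson mult_left_mono order_trans)
  qed
  also have "cmod (\<psi> (y - F x)) \<le> \<bar>c\<bar> * d"
  proof -
    have "cmod (\<psi> (y - F x)) \<le> c * p (y - F x)" using \<psi> unfolding bounded_functional_def by blast
    also have "\<dots> \<le> \<bar>c\<bar> * d" using x p_minus_commute[of y "F x"] p_nonneg by (intro mult_mono) auto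
    finally show ?thesis .
  qed
  also have "k * (p y + d) + \<bar>c\<bar> * d \<le> k * p y + d * (k + \<bar>c\<bar> + 1)" using d by (simp add: algebra_simps)
  also have "d * (k + \<bar>c\<bar> + 1) = e" using k(1) by (simp add: d_def)
  finally show "cmod (\<psi> y) \<le> k * p y + e" by simp
qed

text \<open>The adjoint of multiplication by z - \<mu> is onto: on the range the value is forced, by
  division, and \<open>lower\<close> bounds it with constant \<open>c / \<delta>\<close>;
  Hahn-Banach extends it.\<close>

lemma functional_preimage:
  assumes \<phi>: "bounded_functional p c \<phi>" and c: "c \<ge> 0"
  shows "\<exists>\<psi>. bounded_functional p (c / \<delta>) \<psi> \<and> (\<forall>x. \<psi> ([:-\<mu>, 1:] * x) = \<phi> x)"
proof -
  interpret q: complex_seminorm smult "\<lambda>x. c / \<delta> * p x"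
  proof unfold_locales
    show "c / \<delta> * p (x + y) \<le> c / \<delta> * p x + c / \<delta> * p y" for x y
      using mult_left_mono[OF p_add[of x y], of "c / \<delta>"] c \<delta> by (simp add: distrib_left)
    show "c / \<delta> * p (smult a x) = cmod a * (c / \<delta> * p x)" for a x by (simp add: p_scale)
  qed
  let ?M = "range ((*) [:-\<mu>, 1:])"
  let ?f = "\<lambda>y. \<phi> (y div [:-\<mu>, 1:])"
  have f: "?f ([:-\<mu>, 1:] * x) = \<phi> x" for x
    by (subst nonzero_mult_div_cancel_left) auto
  have M: "subspace ?M"
  proof (rule subspaceI)
    show "0 \<in> ?M" by (rule range_eqI[of _ _ 0]) simp
    show "x + y \<in> ?M" if "x \<in> ?M" "y \<in> ?M" for x y
      using that by (auto simp del: mult_pCons_left simp flip: distrib_left)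
    show "smult a x \<in> ?M" if "x \<in> ?M" for a x
      using that by (auto simp del: mult_pCons_left simp flip: mult_smult_right)
  qed
  obtain g where g: "\<And>x y. g (x + y) = g x + g y" "\<And>a x. g (smult a x) = a * g x"
    "\<And>x. x \<in> ?M \<Longrightarrow> g x = ?f x" "\<And>x. cmod (g x) \<le> c / \<delta> * p x"
  proof (rule q.hahn_banach[OF M, of ?f])
    show "?f (x + y) = ?f x + ?f y" if xy: "x \<in> ?M" "y \<in> ?M" for x y
    proof -
      obtain x' y' where *: "x = [:-\<mu>, 1:] * x'" "y = [:-\<mu>, 1:] * y'" using xy by blast
      have "x + y = [:-\<mu>, 1:] * (x' + y')" unfolding * by (rule distrib_left[symmetric])
      then show ?thesis using \<phi> f unfolding bounded_functional_def * by metis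
    qed
    show "?f (smult a x) = a * ?f x" if x: "x \<in> ?M" for a x
    proof -
      obtain x' where *: "x = [:-\<mu>, 1:] * x'" using x by blast
      have "smult a x = [:-\<mu>, 1:] * smult a x'" unfolding * by (rule mult_smult_right[symmetric])
      then show ?thesis using \<phi> f unfolding bounded_functional_def * by metis
    qed
    show "cmod (?f x) \<le> c / \<delta> * p x" if x: "x \<in> ?M" for x
    proof -
      obtain x' where *: "x = [:-\<mu>, 1:] * x'" using x by blast
      have "cmod (\<phi> x') \<le> c * p x'" using \<phi> unfolding bounded_functional_def by blast
      also have "\<dots> \<le> c * (p x / \<delta>)"
        using lower[of x' \<mu>] \<delta> c unfolding *[symmetric] by (intro mult_left_mono) (auto simp: field_simps)
      finally show ?thesis unfolding * f by simp
    qed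
  qed (rule that)
  have "bounded_functional p (c / \<delta>) g" using g(1,2,4) by (simp add: bounded_functional_def)
  moreover have "\<forall>x. g ([:-\<mu>, 1:] * x) = \<phi> x" by (rule allI, rule trans[OF g(3)[OF rangeI] f])
  ultimately show ?thesis by (intro exI conjI)
qed

text \<open>
  Multiplication by \<open>z - \<mu>\<close> has dense range for every \<open>\<mu>\<close>, so a functional has a unique preimage
  \<open>\<psi>\<^sub>\<mu>\<close> under its adjoint; \<open>\<mu> \<mapsto> \<psi>\<^sub>\<mu>\<close> is entire and vanishes at infinity, hence vanishes.
\<close>

theorem seminorm_one_eq_0: "p 1 = 0"
proof -
  obtain \<phi> where \<phi>: "\<And>x y. \<phi> (x + y) = \<phi> x + \<phi> y" "\<And>c x. \<phi> (smult c x) = c * \<phi> x"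
    "\<And>x. cmod (\<phi> x) \<le> p x" "\<phi> 1 = complex_of_real (p 1)"
    by (rule norming_functional[where ?x0.0 = 1]) (rule that)
  have b\<phi>: "bounded_functional p 1 \<phi>" using \<phi> by (simp add: bounded_functional_def)
  have "\<forall>\<mu>. \<exists>\<psi>. bounded_functional p (1 / \<delta>) \<psi> \<and> (\<forall>x. \<psi> ([:-\<mu>, 1:] * x) = \<phi> x)"
    using functional_preimage[OF b\<phi>] by simp
  then obtain \<Psi> where \<Psi>: "\<And>\<mu>. bounded_functional p (1 / \<delta>) (\<Psi> \<mu>)"
    and \<Psi>m: "\<And>\<mu> x. \<Psi> \<mu> ([:-\<mu>, 1:] * x) = \<phi> x" by metis
  \<comment> \<open>Solving twice gives the square of the adjoint resolvent applied to
    \<open>\<phi>\<close>, which is the expected derivative of \<open>\<Psi>\<close>.\<close>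
  have "\<forall>\<mu>. \<exists>\<psi>. bounded_functional p (1 / \<delta> / \<delta>) \<psi> \<and> (\<forall>x. \<psi> ([:-\<mu>, 1:] * x) = \<Psi> \<mu> x)"
    using functional_preimage[OF \<Psi>] \<delta> by simp
  then obtain \<Theta> where \<Theta>: "\<And>\<mu>. bounded_functional p (1 / \<delta> / \<delta>) (\<Theta> \<mu>)"
    and \<Theta>m: "\<And>\<mu> x. \<Theta> \<mu> ([:-\<mu>, 1:] * x) = \<Psi> \<mu> x" by metis
  \<comment> \<open>Tested on multiples of (z - \<mu>) (z - \<nu>)^2, which are dense, all three
    functionals reduce to \<open>\<phi>\<close> and the combination is exactly (\<mu> - \<nu>)^2
    times \<open>\<phi> x\<close>; three applications of \<open>lower\<close> give the factor
    \<open>\<delta> ^ 3\<close>.\<close>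
  have quad: "cmod (\<Psi> \<mu> y - \<Psi> \<nu> y - (\<mu> - \<nu>) * \<Theta> \<nu> y) \<le> (cmod (\<mu> - \<nu>))\<^sup>2 / \<delta> ^ 3 * p y" for \<mu> \<nu> y
  proof (rule functional_bound)
    let ?t = "\<mu> - \<nu>"
    let ?F = "\<lambda>x. [:-\<mu>, 1:] * ([:-\<nu>, 1:] * ([:-\<nu>, 1:] * x))"
    let ?\<chi> = "\<lambda>y. \<Psi> \<mu> y - \<Psi> \<nu> y - ?t * \<Theta> \<nu> y"
    show "bounded_functional p (1 / \<delta> + 1 / \<delta> + cmod ?t * (1 / \<delta> / \<delta>)) ?\<chi>"
      unfolding bounded_functional_def
    proof (intro conjI allI)
      note l = \<Psi>[of \<mu>] \<Psi>[of \<nu>] \<Theta>[of \<nu>]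
      show "?\<chi> (x + y) = ?\<chi> x + ?\<chi> y" for x y
        using l unfolding bounded_functional_def by (simp add: algebra_simps)
      show "?\<chi> (smult a x) = a * ?\<chi> x" for a x
        using l unfolding bounded_functional_def by (simp add: algebra_simps)
      show "cmod (?\<chi> x) \<le> (1 / \<delta> + 1 / \<delta> + cmod ?t * (1 / \<delta> / \<delta>)) * p x" for x
      proof -
        have "cmod (?\<chi> x) \<le> cmod (\<Psi> \<mu> x) + cmod (\<Psi> \<nu> x) + cmod ?t * cmod (\<Theta> \<nu> x)"
          using norm_triangle_ineq4[of "\<Psi> \<mu> x - \<Psi> \<nu> x" "?t * \<Theta> \<nu> x"] norm_triangle_ineq4[of "\<Psi> \<mu> x" "\<Psi> \<nu> x"]
          unfolding norm_mult by linarith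
        also have "\<dots> \<le> 1 / \<delta> * p x + 1 / \<delta> * p x + cmod ?t * (1 / \<delta> / \<delta> * p x)"
          using l unfolding bounded_functional_def by (intro add_mono mult_left_mono norm_ge_zero) blast+
        finally show ?thesis by (simp only: distrib_right mult.assoc)
      qed
    qed
    show "dense_range_wrt p ?F"
      by (intro dense_range_compose[OF dense_range right_diff_distrib mult_upper] dense_range)
    show "0 \<le> (cmod ?t)\<^sup>2 / \<delta> ^ 3" using \<delta> by simp
    fix x
    let ?a = "[:-\<nu>, 1:]"
    have 1: "\<Psi> \<mu> (?F x) = \<phi> (?a * (?a * x))" by (rule \<Psi>m)
    have "?F x = ?a * ([:-\<mu>, 1:] * (?a * x))" by (simp only: mult.left_commute)
    then have 2: "\<Psi> \<nu> (?F x) = \<phi> ([:-\<mu>, 1:] * (?a * x))" using \<Psi>m by metis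
    have "?F x = ?a * (?a * ([:-\<mu>, 1:] * x))" by (simp only: mult.left_commute)
    then have 3: "\<Theta> \<nu> (?F x) = \<phi> ([:-\<mu>, 1:] * x)" using \<Theta>m \<Psi>m by metis
    have split: "\<phi> (?a * z) = \<phi> ([:-\<mu>, 1:] * z) + ?t * \<phi> z" for z
    proof -
      have "?a * z = [:-\<mu>, 1:] * z + smult ?t z" by (simp add: smult_diff_left)
      then show ?thesis by (simp only: \<phi>(1,2))
    qed
    have alg: "a + t * (b + t * c) - a - t * b = t\<^sup>2 * c" for a b c t :: complex
      by (simp add: algebra_simps power2_eq_square)
    have "?\<chi> (?F x) = ?t\<^sup>2 * \<phi> x"
      unfolding 1 2 3 split[of "?a * x"] split[of x] by (rule alg)
    then have "cmod (?\<chi> (?F x)) = (cmod ?t)\<^sup>2 * cmod (\<phi> x)" by (simp only: norm_mult norm_power)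
    also have "\<dots> \<le> (cmod ?t)\<^sup>2 * (p (?F x) / \<delta> ^ 3)"
    proof (intro mult_left_mono)
      have "\<delta> * (\<delta> * (\<delta> * p x)) \<le> p (?F x)"
        using \<delta> by (meson lower mult_left_mono order_trans less_imp_le)
      then have "p x \<le> p (?F x) / \<delta> ^ 3" using \<delta> by (simp add: field_simps power3_eq_cube del: mult_pCons_left)
      then show "cmod (\<phi> x) \<le> p (?F x) / \<delta> ^ 3" using \<phi>(3)[of x] by linarith
    qed simp
    finally show "cmod (?\<chi> (?F x)) \<le> (cmod ?t)\<^sup>2 / \<delta> ^ 3 * p (?F x)" by (simp only: times_divide_eq_left times_divide_eq_right)
  qed
  have hol: "((\<lambda>\<mu>. \<Psi> \<mu> y) has_field_derivative \<Theta> \<nu> y) (at \<nu>)" for y \<nu>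
    unfolding has_field_derivative_iff
  proof (rule iffD2[OF Lim_null], rule Lim_null_comparison)
    show "((\<lambda>\<mu>. cmod (\<mu> - \<nu>) * (p y / \<delta> ^ 3)) \<longlongrightarrow> 0) (at \<nu>)"
      by (rule tendsto_eq_intros refl)+ simp
    have "norm ((\<Psi> \<mu> y - \<Psi> \<nu> y) / (\<mu> - \<nu>) - \<Theta> \<nu> y) \<le> cmod (\<mu> - \<nu>) * (p y / \<delta> ^ 3)"
      if "\<mu> \<noteq> \<nu>" for \<mu>
    proof -
      have "(\<Psi> \<mu> y - \<Psi> \<nu> y) / (\<mu> - \<nu>) - \<Theta> \<nu> y = (\<Psi> \<mu> y - \<Psi> \<nu> y - (\<mu> - \<nu>) * \<Theta> \<nu> y) / (\<mu> - \<nu>)"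
        using that by (simp add: diff_divide_distrib)
      then have "norm ((\<Psi> \<mu> y - \<Psi> \<nu> y) / (\<mu> - \<nu>) - \<Theta> \<nu> y)
          \<le> (cmod (\<mu> - \<nu>))\<^sup>2 / \<delta> ^ 3 * p y / cmod (\<mu> - \<nu>)"
        using divide_right_mono[OF quad[of \<mu> y \<nu>], of "cmod (\<mu> - \<nu>)"] by (simp only: norm_divide norm_ge_zero)
      also have "\<dots> = cmod (\<mu> - \<nu>) * (p y / \<delta> ^ 3)" using that by (simp add: power2_eq_square)
      finally show ?thesis .
    qed
    then show "\<forall>\<^sub>F \<mu> in at \<nu>. norm ((\<Psi> \<mu> y - \<Psi> \<nu> y) / (\<mu> - \<nu>) - \<Theta> \<nu> y) \<le> cmod (\<mu> - \<nu>) * (p y / \<delta> ^ 3)"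
      by (auto simp: eventually_at_filter)
  qed
  \<comment> \<open>For |\<mu>| > R multiplication by z - \<mu> is bounded below by |\<mu>| - R,
    which improves the constant bound \<open>1 / \<delta>\<close> to one that decays.\<close>
  have vanish: "((\<lambda>\<mu>. \<Psi> \<mu> y) \<longlongrightarrow> 0) at_infinity" for y
    unfolding Lim_at_infinity
  proof (intro allI impI)
    fix e :: real assume e: "e > 0"
    define b where "b = R + p y / e + 1"
    have "dist (\<Psi> \<mu> y) 0 < e" if \<mu>: "b \<le> cmod \<mu>" for \<mu>
    proof -
      have k: "cmod \<mu> - R \<ge> p y / e + 1" using \<mu> by (simp add: b_def)
      have pe: "p y / e \<ge> 0" using p_nonneg[of y] e by simp
      have pos: "cmod \<mu> - R > 0" using k pe by linarith
      have "cmod (\<Psi> \<mu> y) \<le> inverse (cmod \<mu> - R) * p y"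
      proof (rule functional_bound[OF \<Psi> dense_range])
        show "0 \<le> inverse (cmod \<mu> - R)" using pos by simp
        fix x
        have "smult \<mu> x = pCons 0 x - [:-\<mu>, 1:] * x" unfolding linear_factor_mult by simp
        then have "cmod \<mu> * p x \<le> p (pCons 0 x) + p ([:-\<mu>, 1:] * x)"
          using p_diff[of "pCons 0 x" "[:-\<mu>, 1:] * x"] p_scale[of \<mu> x] by metis
        then have "(cmod \<mu> - R) * p x \<le> p ([:-\<mu>, 1:] * x)" using upper[of x] by (simp only: left_diff_distrib)
        then have "p x \<le> inverse (cmod \<mu> - R) * p ([:-\<mu>, 1:] * x)"
          using pos by (simp add: field_simps del: mult_pCons_left)
        then show "cmod (\<Psi> \<mu> ([:-\<mu>, 1:] * x)) \<le> inverse (cmod \<mu> - R) * p ([:-\<mu>, 1:] * x)"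
          unfolding \<Psi>m by (rule order_trans[OF \<phi>(3)])
      qed
      also have "\<dots> < e"
      proof -
        have "p y < e * (p y / e + 1)" using e by (simp add: distrib_left)
        also have "\<dots> \<le> e * (cmod \<mu> - R)" using k e by (intro mult_left_mono) auto
        finally show ?thesis using pos by (simp add: field_simps)
      qed
      finally show ?thesis by simp
    qed
    then show "\<exists>B. \<forall>x. B \<le> norm x \<longrightarrow> dist (\<Psi> x y) 0 < e" by blast
  qed
  have "(\<lambda>\<mu>. \<Psi> \<mu> y) holomorphic_on UNIV" for y
    using hol by (auto simp: holomorphic_on_def field_differentiable_def)
  then have "\<Psi> 0 y = 0" for y using Liouville_weak_0 vanish by blast
  \<comment> \<open>\<open>\<phi> 1\<close> is the value of \<open>\<Psi> 0\<close> at the variable,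
    while \<open>\<phi>\<close> was chosen to take the value \<open>p 1\<close> at 1.\<close>
  then have "\<phi> 1 = 0" using \<Psi>m[of 0 1] by metis
  then show ?thesis using \<phi>(4) by simp
qed

end

section \<open>Upper limits of norms along a sequence\<close>

definition limsup_norm :: "(nat \<Rightarrow> 'a::real_normed_vector) \<Rightarrow> real"
  where "limsup_norm u = Inf {c. \<forall>\<^sub>F n in sequentially. norm (u n) \<le> c}"

lemma limsup_norm_bdd: "bdd_below {c. \<forall>\<^sub>F n in sequentially. norm (u n) \<le> c}"
proof (rule bdd_belowI[of _ 0], clarify)
  fix c assume "\<forall>\<^sub>F n in sequentially. norm (u n) \<le> c"
  then obtain n where "norm (u n) \<le> c" using eventually_happens'[OF sequentially_bot] by blast
  then show "0 \<le> c" by (rule order_trans[OF norm_ge_zero])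
qed

lemma limsup_norm_le: "(\<forall>\<^sub>F n in sequentially. norm (u n) \<le> c) \<Longrightarrow> limsup_norm u \<le> c"
  unfolding limsup_norm_def by (rule cInf_lower[OF _ limsup_norm_bdd]) simp

lemma limsup_norm_eventually:
  assumes "bounded (range u)" "e > 0"
  shows "\<forall>\<^sub>F n in sequentially. norm (u n) \<le> limsup_norm u + e"
proof -
  obtain K where "\<And>n. norm (u n) \<le> K" using assms(1) by (auto simp: bounded_iff)
  then have ne: "{c. \<forall>\<^sub>F n in sequentially. norm (u n) \<le> c} \<noteq> {}" by (auto intro: always_eventually)
  have "limsup_norm u < limsup_norm u + e" using assms(2) by simp
  then obtain c where c: "\<forall>\<^sub>F n in sequentially. norm (u n) \<le> c" "c < limsup_norm u + e"
    using cInf_lessD[OF ne] unfolding limsup_norm_def by blast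
  from c(1) show ?thesis by (rule eventually_mono) (use c(2) in linarith)
qed

text \<open>The null sequence \<open>d\<close> is where terms tending to 0, such as those of a
  second operator and of finitely many functionals, are discarded.\<close>

lemma limsup_norm_dominated:
  fixes u v :: "nat \<Rightarrow> 'a::real_normed_vector"
  assumes v: "bounded (range v)" and a: "a \<ge> 0" and d: "d \<longlonglongrightarrow> (0::real)"
    and le: "\<And>n. norm (u n) \<le> a * norm (v n) + d n"
  shows "limsup_norm u \<le> a * limsup_norm v"
proof (rule field_le_epsilon)
  fix e :: real assume e: "e > 0"
  define e' where "e' = e / (a + 1)"
  have e': "e' > 0" using a e by (simp add: e'_def)
  have "\<forall>\<^sub>F n in sequentially. norm (u n) \<le> a * (limsup_norm v + e') + e'"
    using limsup_norm_eventually[OF v e'] order_tendstoD(2)[OF d e']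
  proof eventually_elim
    case (elim n)
    have "a * norm (v n) \<le> a * (limsup_norm v + e')" using elim(1) a by (rule mult_left_mono)
    then show ?case using le[of n] elim(2) by linarith
  qed
  then have "limsup_norm u \<le> a * (limsup_norm v + e') + e'" by (rule limsup_norm_le)
  also have "\<dots> = a * limsup_norm v + e' * (a + 1)" by (simp add: algebra_simps)
  also have "e' * (a + 1) = e" using a by (simp add: e'_def)
  finally show "limsup_norm u \<le> a * limsup_norm v + e" .
qed

lemma limsup_norm_add:
  fixes u v :: "nat \<Rightarrow> 'a::real_normed_vector"
  assumes u: "bounded (range u)" and v: "bounded (range v)"
  shows "limsup_norm (\<lambda>n. u n + v n) \<le> limsup_norm u + limsup_norm v"
proof (rule field_le_epsilon)
  fix e :: real assume "e > 0"
  then have e: "e / 2 > 0" by simp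
  have "\<forall>\<^sub>F n in sequentially. norm (u n + v n) \<le> limsup_norm u + limsup_norm v + e"
    using limsup_norm_eventually[OF u e] limsup_norm_eventually[OF v e]
  proof eventually_elim
    case (elim n)
    then show ?case using norm_triangle_ineq[of "u n" "v n"] by simp
  qed
  then show "limsup_norm (\<lambda>n. u n + v n) \<le> limsup_norm u + limsup_norm v + e" by (rule limsup_norm_le)
qed

lemma limsup_norm_const:
  assumes "\<And>n. norm (u n) = c"
  shows "limsup_norm u = c"
proof (rule antisym)
  show "limsup_norm u \<le> c" by (rule limsup_norm_le) (simp add: assms)
  show "c \<le> limsup_norm u"
  proof (rule field_le_epsilon)
    fix e :: real assume "e > 0"
    moreover have "bounded (range u)" using assms by (auto simp: bounded_iff)
    ultimately show "c \<le> limsup_norm u + e" using limsup_norm_eventually[of u e] by (simp add: assms)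
  qed
qed

section \<open>Polynomials in an operator, evaluated at a vector by Horner's scheme\<close>

definition op_poly :: "('a::complex_normed_vector \<Rightarrow>\<^sub>C\<^sub>L 'a) \<Rightarrow> complex poly \<Rightarrow> 'a \<Rightarrow> 'a"
  where "op_poly T q x = fold_coeffs (\<lambda>a y. a *\<^sub>C x + T y) q 0"

lemma op_poly_0 [simp]: "op_poly T 0 x = 0"
  by (simp add: op_poly_def)

lemma op_poly_pCons [simp]: "op_poly T (pCons a q) x = a *\<^sub>C x + T (op_poly T q x)"
  by (cases "a = 0 \<and> q = 0") (auto simp: op_poly_def cblinfun_linear_simps)

lemma op_poly_add: "op_poly T (p + q) x = op_poly T p x + op_poly T q x"
  by (induction p q rule: poly_induct2) (simp_all add: cblinfun_linear_simps scaleC_add_left)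

lemma op_poly_smult: "op_poly T (smult c q) x = c *\<^sub>C op_poly T q x"
  by (induction q) (simp_all add: cblinfun_linear_simps scaleC_add_right)

lemma op_poly_commute:
  fixes S V :: "'a::complex_normed_vector \<Rightarrow>\<^sub>C\<^sub>L 'a"
  assumes "\<And>x. S (V x) = V (S x)"
  shows "V (op_poly S q x) = op_poly S q (V x)"
  by (induction q) (simp_all add: cblinfun_linear_simps assms[symmetric])

lemma op_poly_bound:
  obtains K where "\<And>x. norm (op_poly T q x) \<le> K * norm x"
proof -
  have "\<exists>K. \<forall>x. norm (op_poly T q x) \<le> K * norm x"
  proof (induction q)
    case 0
    show ?case by (intro exI[of _ 0]) simp
  next
    case (pCons a q)
    then obtain K where K: "\<And>x. norm (op_poly T q x) \<le> K * norm x" by blast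
    obtain L where L: "L > 0" "\<And>x. norm (T x) \<le> L * norm x" by (rule cblinfun_bound_pos[of T]) (rule that)
    have "norm (op_poly T (pCons a q) x) \<le> (cmod a + L * K) * norm x" for x
    proof -
      have "norm (op_poly T (pCons a q) x) \<le> cmod a * norm x + norm (T (op_poly T q x))"
        unfolding op_poly_pCons by (rule order_trans[OF norm_triangle_ineq]) (simp add: norm_scaleC)
      also have "norm (T (op_poly T q x)) \<le> L * (K * norm x)"
        using L(1) by (intro order_trans[OF L(2)] mult_left_mono K) simp
      finally show ?thesis by (simp add: algebra_simps)
    qed
    then show ?case by blast
  qed
  then show thesis using that by blast
qed

text \<open>
  If the estimates held but \<open>V\<close> had none, there would be unit vectors \<open>u\<^sub>n\<close> on which \<open>V\<close> and all functionals
  involved tend to \<open>0\<close>, and \<open>limsup \<parallel>q(S) u\<^sub>n\<parallel>\<close> would be a seminorm on polynomials \<open>q\<close> for which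
  multiplication by every \<open>z - \<mu>\<close> is bounded below.
\<close>

lemma commuting_estimate_uniform:
  fixes S V :: "'a::complex_banach \<Rightarrow>\<^sub>C\<^sub>L 'a"
  assumes comm: "\<And>x. S (V x) = V (S x)" and fin: "finite \<Phi>" and C: "C > 0"
    and est: "\<And>\<mu> u. norm u \<le> C * (norm (shift S \<mu> u) + norm (V u) + (\<Sum>\<phi>\<in>\<Phi>. cmod (cblinfun_apply \<phi> u)))"
  shows "\<exists>\<Psi> D. \<Psi> \<subseteq> {\<phi> o\<^sub>C\<^sub>L cblinfun_power S k | \<phi> k. \<phi> \<in> \<Phi>} \<and> lower_estimate UNIV V \<Psi> D"
proof (rule ccontr)
  assume neg: "\<not> ?thesis"
  \<comment> \<open>The functionals do not commute with \<open>S\<close>. Controlling them on S^k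
    u_n for all k up to \<open>n\<close> makes them tend to 0 along q(S) u_n for every polynomial
    q.\<close>
  define \<Psi> where "\<Psi> n = (\<lambda>(\<phi>, k). \<phi> o\<^sub>C\<^sub>L cblinfun_power S k) ` (\<Phi> \<times> {..n})" for n :: nat
  have fin\<Psi>: "finite (\<Psi> n)" for n using fin by (simp add: \<Psi>_def)
  have "\<exists>u. norm u = 1 \<and> norm (V u) + (\<Sum>\<psi>\<in>\<Psi> n. cmod (cblinfun_apply \<psi> u)) < 1 / (real n + 1)" for n
  proof -
    have "\<Psi> n \<subseteq> {\<phi> o\<^sub>C\<^sub>L cblinfun_power S k | \<phi> k. \<phi> \<in> \<Phi>}" by (auto simp: \<Psi>_def)
    then have "\<not> lower_estimate UNIV V (\<Psi> n) (real n + 1)" using neg by blast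
    then obtain y where y: "norm y > (real n + 1) * (norm (V y) + (\<Sum>\<psi>\<in>\<Psi> n. cmod (cblinfun_apply \<psi> y)))"
      using fin\<Psi>[of n] by (auto simp: lower_estimate_def not_le)
    then show ?thesis
      using normalized_witness[OF complex_vector.subspace_UNIV, of y "real n + 1" V "\<lambda>\<psi>. \<psi>" "\<Psi> n"] by auto
  qed
  then obtain u where u: "\<And>n. norm (u n) = 1"
    "\<And>n. norm (V (u n)) + (\<Sum>\<psi>\<in>\<Psi> n. cmod (cblinfun_apply \<psi> (u n))) < 1 / (real n + 1)" by metis
  have lim0: "(\<lambda>n. 1 / (real n + 1)) \<longlonglongrightarrow> 0"
    using LIMSEQ_inverse_real_of_nat by (simp add: inverse_eq_divide add.commute)
  have V0: "(\<lambda>n. V (u n)) \<longlonglongrightarrow> 0"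
  proof (rule Lim_null_comparison[OF always_eventually lim0], rule allI)
    fix n
    have "(\<Sum>\<psi>\<in>\<Psi> n. cmod (cblinfun_apply \<psi> (u n))) \<ge> 0" by (simp add: sum_nonneg)
    then show "norm (V (u n)) \<le> 1 / (real n + 1)" using u(2)[of n] by linarith
  qed
  have \<phi>0: "(\<lambda>n. cblinfun_apply \<phi> (cblinfun_power S k (u n))) \<longlonglongrightarrow> 0" if \<phi>: "\<phi> \<in> \<Phi>" for \<phi> k
  proof (rule Lim_null_comparison[OF _ lim0])
    show "\<forall>\<^sub>F n in sequentially. norm (cblinfun_apply \<phi> (cblinfun_power S k (u n))) \<le> 1 / (real n + 1)"
    proof (rule eventually_sequentiallyI)
      fix n assume n: "n \<ge> k"
      have mem: "\<phi> o\<^sub>C\<^sub>L cblinfun_power S k \<in> \<Psi> n"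
        unfolding \<Psi>_def using \<phi> n by (intro image_eqI[of _ _ "(\<phi>, k)"]) auto
      have "cmod (cblinfun_apply (\<phi> o\<^sub>C\<^sub>L cblinfun_power S k) (u n)) \<le> (\<Sum>\<psi>\<in>\<Psi> n. cmod (cblinfun_apply \<psi> (u n)))"
        by (rule member_le_sum[OF mem]) (auto simp: fin\<Psi>)
      then show "norm (cblinfun_apply \<phi> (cblinfun_power S k (u n))) \<le> 1 / (real n + 1)"
        using u(2)[of n] norm_ge_zero[of "V (u n)"] unfolding cblinfun_apply_compose by linarith
    qed
  qed
  have bdd: "bounded (range (\<lambda>n. op_poly S q (u n)))" for q
  proof -
    obtain K where "\<And>x. norm (op_poly S q x) \<le> K * norm x" by (rule op_poly_bound[of S q]) (rule that)
    then have "norm (op_poly S q (u n)) \<le> K" for n using u(1)[of n] by (metis mult.right_neutral)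
    then show ?thesis by (auto simp: bounded_iff)
  qed
  have Vq: "(\<lambda>n. V (op_poly S q (u n))) \<longlonglongrightarrow> 0" for q
  proof -
    obtain K where K: "\<And>x. norm (op_poly S q x) \<le> K * norm x" by (rule op_poly_bound[of S q]) (rule that)
    show ?thesis
      unfolding op_poly_commute[of S V, OF comm]
    proof (rule Lim_null_comparison[OF always_eventually])
      show "\<forall>n. norm (op_poly S q (V (u n))) \<le> K * norm (V (u n))" using K by blast
      show "(\<lambda>n. K * norm (V (u n))) \<longlonglongrightarrow> 0" by (rule tendsto_mult_right_zero[OF tendsto_norm_zero[OF V0]])
    qed
  qed
  have \<phi>q: "(\<lambda>n. cblinfun_apply \<phi> (cblinfun_power S k (op_poly S q (u n)))) \<longlonglongrightarrow> 0" if \<phi>: "\<phi> \<in> \<Phi>" for \<phi> k q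
  proof (induction q arbitrary: k)
    case 0
    show ?case by (simp add: cblinfun_linear_simps)
  next
    case (pCons a q)
    have "cblinfun_power S k (S y) = cblinfun_power S (Suc k) y" for y
      unfolding cblinfun_power_apply by (simp add: funpow_swap1)
    then have eq: "cblinfun_apply \<phi> (cblinfun_power S k (op_poly S (pCons a q) (u n))) =
        a * cblinfun_apply \<phi> (cblinfun_power S k (u n)) +
        cblinfun_apply \<phi> (cblinfun_power S (Suc k) (op_poly S q (u n)))" for n
      by (simp add: cblinfun_linear_simps del: cblinfun_power.simps)
    have "(\<lambda>n. a * cblinfun_apply \<phi> (cblinfun_power S k (u n)) +
        cblinfun_apply \<phi> (cblinfun_power S (Suc k) (op_poly S q (u n)))) \<longlonglongrightarrow> 0 + 0"
      by (intro tendsto_add tendsto_mult_right_zero \<phi>0[OF \<phi>] pCons.IH)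
    then show ?case unfolding eq by simp
  qed
  define p where "p q = limsup_norm (\<lambda>n. op_poly S q (u n))" for q
  have scale_le: "p (smult c q) \<le> cmod c * p q" for c q
    unfolding p_def
    by (rule limsup_norm_dominated[OF bdd, where d = "\<lambda>_. 0"]) (auto simp: op_poly_smult norm_scaleC)
  have lin: "op_poly S ([:-\<mu>, 1:] * q) x = shift S \<mu> (op_poly S q x)" for \<mu> q x
  proof -
    have "[:-\<mu>, 1:] * q = pCons 0 q + smult (- \<mu>) q" by simp
    then have "op_poly S ([:-\<mu>, 1:] * q) x = op_poly S (pCons 0 q) x + op_poly S (smult (- \<mu>) q) x"
      by (simp only: op_poly_add)
    also have "\<dots> = shift S \<mu> (op_poly S q x)"
      by (simp only: op_poly_smult op_poly_pCons shift_apply) simp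
    finally show ?thesis .
  qed
  interpret poly_seminorm p "norm S" "inverse C"
  proof unfold_locales
    fix x y :: "complex poly" and c :: complex
    show "p (x + y) \<le> p x + p y"
      unfolding p_def op_poly_add by (rule limsup_norm_add[OF bdd bdd])
    show "p (smult c x) = cmod c * p x"
    proof (cases "c = 0")
      case True
      then show ?thesis by (simp add: p_def limsup_norm_const[of _ 0])
    next
      case False
      have "p (smult (inverse c) (smult c x)) \<le> cmod (inverse c) * p (smult c x)" by (rule scale_le)
      then have "p x \<le> inverse (cmod c) * p (smult c x)" using False by (simp add: norm_inverse)
      then have "cmod c * p x \<le> p (smult c x)" using False by (simp add: field_simps)
      then show ?thesis using scale_le[of c x] by simp
    qed
  next
    show "inverse C > 0" using C by simp
    show "0 \<le> norm S" by simp
  next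
    fix q
    show "p (pCons 0 q) \<le> norm S * p q"
      unfolding p_def
      by (rule limsup_norm_dominated[OF bdd, where d = "\<lambda>_. 0"]) (auto intro: norm_cblinfun_le)
  next
    fix q \<mu>
    \<comment> \<open>Everything in \<open>est\<close> except the term with
      \<open>shift S \<mu>\<close>; it tends to 0 along the sequence, so only multiplication by the
      linear factor survives in the limit.\<close>
    define d where "d n = C * (norm (V (op_poly S q (u n))) + (\<Sum>\<phi>\<in>\<Phi>. cmod (cblinfun_apply \<phi> (op_poly S q (u n)))))" for n
    have "d \<longlonglongrightarrow> C * (0 + (\<Sum>\<phi>\<in>\<Phi>. 0))"
      unfolding d_def
    proof (intro tendsto_mult tendsto_const tendsto_add tendsto_sum tendsto_norm_zero Vq)
      fix \<phi> assume "\<phi> \<in> \<Phi>"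
      from \<phi>q[OF this, of 0 q] show "(\<lambda>n. cblinfun_apply \<phi> (op_poly S q (u n))) \<longlonglongrightarrow> 0"
        by (simp add: cblinfun_id_apply)
    qed
    then have d: "d \<longlonglongrightarrow> 0" by simp
    have "p q \<le> C * p ([:-\<mu>, 1:] * q)"
      unfolding p_def
    proof (rule limsup_norm_dominated[OF bdd less_imp_le[OF C] d])
      fix n
      show "norm (op_poly S q (u n)) \<le> C * norm (op_poly S ([:-\<mu>, 1:] * q) (u n)) + d n"
        using est[of "op_poly S q (u n)" \<mu>] unfolding lin d_def by (simp only: distrib_left add.assoc)
    qed
    then have "inverse C * p q \<le> inverse C * (C * p ([:-\<mu>, 1:] * q))"
      using C by (intro mult_left_mono) auto
    also have "\<dots> = p ([:-\<mu>, 1:] * q)" using C by (subst mult.assoc[symmetric]) simp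
    finally show "inverse C * p q \<le> p ([:-\<mu>, 1:] * q)" .
  qed (simp_all add: smult_add_right smult_add_left)
  have "p 1 = 1"
    unfolding p_def by (rule limsup_norm_const) (simp add: one_pCons u(1) scaleC_one cblinfun_linear_simps)
  then show False using seminorm_one_eq_0 by simp
qed

text \<open>Compactness makes the estimates uniform: finitely many parameters suffice for a disc,
  and outside it S - \<mu> is bounded below. The set \<open>\<T>\<close> records which functionals
  may occur: with the empty set the conclusion is boundedness below, with \<open>UNIV\<close> a
  semi-Fredholm estimate.\<close>

theorem commuting_estimate:
  fixes S V :: "'a::complex_banach \<Rightarrow>\<^sub>C\<^sub>L 'a"
  assumes comm: "\<And>x. S (V x) = V (S x)"
    and est: "\<And>\<mu>. \<exists>\<Phi> C. finite \<Phi> \<and> \<Phi> \<subseteq> \<T> \<and>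
      (\<forall>u. norm u \<le> C * (norm (shift S \<mu> u) + norm (V u) + (\<Sum>\<phi>\<in>\<Phi>. cmod (cblinfun_apply \<phi> u))))"
  shows "\<exists>\<Psi> D. \<Psi> \<subseteq> {\<phi> o\<^sub>C\<^sub>L cblinfun_power S k | \<phi> k. \<phi> \<in> \<T>} \<and> lower_estimate UNIV V \<Psi> D"
proof -
  let ?s = "\<lambda>\<Phi> u. \<Sum>\<phi>\<in>\<Phi>. cmod (cblinfun_apply \<phi> u)"
  obtain \<Phi> C where fin: "\<And>\<mu>. finite (\<Phi> \<mu>)" and sub: "\<And>\<mu>. \<Phi> \<mu> \<subseteq> \<T>"
    and est0: "\<And>\<mu> u. norm u \<le> C \<mu> * (norm (shift S \<mu> u) + norm (V u) + ?s (\<Phi> \<mu>) u)"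
    using est by metis
  define D where "D \<mu> = max 1 (C \<mu>)" for \<mu>
  have D: "D \<mu> \<ge> 1" for \<mu> by (simp add: D_def)
  have nn: "0 \<le> norm (shift S \<mu> u) + norm (V u) + ?s \<Xi> u" for \<mu> u and \<Xi> :: "('a \<Rightarrow>\<^sub>C\<^sub>L complex) set"
    by (intro add_nonneg_nonneg sum_nonneg) auto
  have est1: "norm u \<le> D \<mu> * (norm (shift S \<mu> u) + norm (V u) + ?s (\<Phi> \<mu>) u)" for \<mu> u
    by (rule order_trans[OF est0 mult_right_mono[OF _ nn]]) (simp add: D_def)
  define K where "K = cball (0::complex) (norm S + 1)"
  have "compact K" by (simp add: K_def)
  then obtain F where F: "F \<subseteq> K" "finite F" "K \<subseteq> (\<Union>\<mu>\<in>F. ball \<mu> (1 / (2 * D \<mu>)))"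
  proof (rule compactE_image[of K K "\<lambda>\<mu>. ball \<mu> (1 / (2 * D \<mu>))"])
    show "K \<subseteq> (\<Union>\<mu>\<in>K. ball \<mu> (1 / (2 * D \<mu>)))"
    proof
      fix \<mu> assume "\<mu> \<in> K"
      moreover have "1 / (2 * D \<mu>) > 0" using D[of \<mu>] by simp
      ultimately show "\<mu> \<in> (\<Union>\<mu>\<in>K. ball \<mu> (1 / (2 * D \<mu>)))" using centre_in_ball by blast
    qed
  qed auto
  define \<Xi> where "\<Xi> = (\<Union>\<mu>\<in>F. \<Phi> \<mu>)"
  define E where "E = 1 + (\<Sum>\<mu>\<in>F. 2 * D \<mu>)"
  have fin\<Xi>: "finite \<Xi>" using F(2) fin by (simp add: \<Xi>_def)
  have DE: "2 * D \<mu> \<le> E" if "\<mu> \<in> F" for \<mu>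
    using member_le_sum[OF that, of "\<lambda>\<mu>. 2 * D \<mu>"] D F(2) unfolding E_def
    by (smt (verit, best))
  have E1: "E \<ge> 1" unfolding E_def using D by (simp add: sum_nonneg order_trans[OF zero_le_one])
  have unif: "norm u \<le> E * (norm (shift S \<mu> u) + norm (V u) + ?s \<Xi> u)" for \<mu> u
  proof (cases "\<mu> \<in> K")
    case True
    then obtain \<nu> where \<nu>: "\<nu> \<in> F" "dist \<nu> \<mu> < 1 / (2 * D \<nu>)" using F(3) by auto
    have D0: "D \<nu> > 0" using D[of \<nu>] by linarith
    have near: "D \<nu> * cmod (\<mu> - \<nu>) \<le> 1 / 2"
      using \<nu>(2) D0 by (simp add: dist_norm norm_minus_commute field_simps)
    have ss: "?s (\<Phi> \<nu>) u \<le> ?s \<Xi> u"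
      by (rule sum_mono2[OF fin\<Xi>]) (use \<nu>(1) in \<open>auto simp: \<Xi>_def\<close>)
    have sh: "norm (shift S \<nu> u) \<le> norm (shift S \<mu> u) + cmod (\<mu> - \<nu>) * norm u"
    proof -
      have "shift S \<nu> u = shift S \<mu> u + (\<mu> - \<nu>) *\<^sub>C u"
        unfolding shift_apply by (simp add: complex_vector.scale_left_diff_distrib)
      then show ?thesis using norm_triangle_ineq[of "shift S \<mu> u" "(\<mu> - \<nu>) *\<^sub>C u"] by (simp only: norm_scaleC)
    qed
    have "norm u \<le> D \<nu> * (norm (shift S \<nu> u) + norm (V u) + ?s (\<Phi> \<nu>) u)" by (rule est1)
    also have "\<dots> \<le> D \<nu> * (norm (shift S \<mu> u) + cmod (\<mu> - \<nu>) * norm u + norm (V u) + ?s \<Xi> u)"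
      using sh ss D0 by (intro mult_left_mono) auto
    also have "\<dots> = D \<nu> * (norm (shift S \<mu> u) + norm (V u) + ?s \<Xi> u) + (D \<nu> * cmod (\<mu> - \<nu>)) * norm u"
      by (simp only: distrib_left mult.assoc add_ac)
    also have "\<dots> \<le> D \<nu> * (norm (shift S \<mu> u) + norm (V u) + ?s \<Xi> u) + 1 / 2 * norm u"
      using near by (intro add_left_mono mult_right_mono) auto
    finally have "norm u \<le> 2 * D \<nu> * (norm (shift S \<mu> u) + norm (V u) + ?s \<Xi> u)" by simp
    also have "\<dots> \<le> E * (norm (shift S \<mu> u) + norm (V u) + ?s \<Xi> u)"
      by (rule mult_right_mono[OF DE[OF \<nu>(1)] nn])
    finally show ?thesis .
  next
    case False
    then have \<mu>: "cmod \<mu> > norm S + 1" by (simp add: K_def)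
    have "cmod \<mu> * norm u \<le> norm (S u) + norm (shift S \<mu> u)"
      using norm_triangle_ineq4[of "S u" "shift S \<mu> u"] by (simp add: shift_apply norm_scaleC)
    moreover have "norm (S u) \<le> norm S * norm u" by (rule norm_cblinfun_le)
    moreover have "(norm S + 1) * norm u \<le> cmod \<mu> * norm u" using \<mu> by (intro mult_right_mono) auto
    ultimately have "norm u \<le> norm (shift S \<mu> u)" by (simp add: distrib_right)
    also have "\<dots> \<le> norm (shift S \<mu> u) + norm (V u) + ?s \<Xi> u"
      using norm_ge_zero[of "V u"] sum_nonneg[of \<Xi> "\<lambda>\<phi>. cmod (cblinfun_apply \<phi> u)"] by simp
    also have "\<dots> \<le> E * (norm (shift S \<mu> u) + norm (V u) + ?s \<Xi> u)"
      using mult_right_mono[OF E1 nn] by simp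
    finally show ?thesis .
  qed
  have E0: "E > 0" using E1 by linarith
  obtain \<Psi> D' where *: "\<Psi> \<subseteq> {\<phi> o\<^sub>C\<^sub>L cblinfun_power S k | \<phi> k. \<phi> \<in> \<Xi>}" "lower_estimate UNIV V \<Psi> D'"
    using commuting_estimate_uniform[OF comm fin\<Xi> E0 unif] by (elim exE conjE)
  have "\<Xi> \<subseteq> \<T>" using sub by (auto simp: \<Xi>_def)
  then have "\<Psi> \<subseteq> {\<phi> o\<^sub>C\<^sub>L cblinfun_power S k | \<phi> k. \<phi> \<in> \<T>}" using *(1) by blast
  then show ?thesis using *(2) by (intro exI conjI)
qed

section \<open>Composition operators and rank one operators\<close>

definition lcomp :: "('b::complex_normed_vector \<Rightarrow>\<^sub>C\<^sub>L 'c::complex_normed_vector) \<Rightarrow>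
    ('a::complex_normed_vector \<Rightarrow>\<^sub>C\<^sub>L 'b) \<Rightarrow>\<^sub>C\<^sub>L ('a \<Rightarrow>\<^sub>C\<^sub>L 'c)"
  where "lcomp G = Cblinfun (Blinfun (\<lambda>U. G o\<^sub>C\<^sub>L U))"

lemma lcomp_apply: "lcomp G U = G o\<^sub>C\<^sub>L U"
  unfolding lcomp_def
proof (rule cblinfun_of_bounded[where K = "norm G"])
  show "norm (G o\<^sub>C\<^sub>L U) \<le> norm U * norm G" for U
    using norm_cblinfun_compose[of G U] by (simp add: mult.commute)
qed (auto intro!: cblinfun_eqI simp: cblinfun_apply_compose cblinfun_linear_simps)

definition rcomp :: "('a::complex_normed_vector \<Rightarrow>\<^sub>C\<^sub>L 'b::complex_normed_vector) \<Rightarrow>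
    ('b \<Rightarrow>\<^sub>C\<^sub>L 'c::complex_normed_vector) \<Rightarrow>\<^sub>C\<^sub>L ('a \<Rightarrow>\<^sub>C\<^sub>L 'c)"
  where "rcomp F = Cblinfun (Blinfun (\<lambda>U. U o\<^sub>C\<^sub>L F))"

lemma rcomp_apply: "rcomp F U = U o\<^sub>C\<^sub>L F"
  unfolding rcomp_def
  by (rule cblinfun_of_bounded[where K = "norm F"])
    (auto intro!: cblinfun_eqI norm_cblinfun_compose simp: cblinfun_apply_compose cblinfun_linear_simps)

definition vector_map :: "'a::complex_normed_vector \<Rightarrow> complex \<Rightarrow>\<^sub>C\<^sub>L 'a"
  where "vector_map x = Cblinfun (Blinfun (\<lambda>c. c *\<^sub>C x))"

lemma vector_map_apply: "vector_map x c = c *\<^sub>C x"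
  unfolding vector_map_def
  by (rule cblinfun_of_bounded[where K = "norm x"])
    (auto simp: scaleC_add_left norm_scaleC)

lemma norm_vector_map: "norm (vector_map x) \<le> norm x"
  by (rule norm_cblinfun_bound) (simp_all add: vector_map_apply norm_scaleC mult.commute)

definition vector_embedding :: "'a::complex_normed_vector \<Rightarrow>\<^sub>C\<^sub>L (complex \<Rightarrow>\<^sub>C\<^sub>L 'a)"
  where "vector_embedding = Cblinfun (Blinfun vector_map)"

lemma vector_embedding_apply: "vector_embedding x = vector_map x"
  unfolding vector_embedding_def
  by (rule cblinfun_of_bounded[where K = 1])
    (auto intro!: cblinfun_eqI simp: vector_map_apply cblinfun_linear_simps scaleC_add_right norm_vector_map mult.commute)

definition rank_one :: "'b::complex_normed_vector \<Rightarrow> ('a::complex_normed_vector \<Rightarrow>\<^sub>C\<^sub>L complex) \<Rightarrow> 'a \<Rightarrow>\<^sub>C\<^sub>L 'b"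
  where "rank_one x f = vector_map x o\<^sub>C\<^sub>L f"

lemma rank_one_apply: "rank_one x f y = f y *\<^sub>C x"
  by (simp add: rank_one_def cblinfun_apply_compose vector_map_apply)

lemma norm_rank_one: "norm (rank_one x f) = norm x * norm f"
proof (rule antisym)
  have "norm (rank_one x f) \<le> norm (vector_map x) * norm f"
    unfolding rank_one_def by (rule norm_cblinfun_compose)
  also have "\<dots> \<le> norm x * norm f" by (intro mult_right_mono norm_vector_map norm_ge_zero)
  finally show "norm (rank_one x f) \<le> norm x * norm f" .
  show "norm x * norm f \<le> norm (rank_one x f)"
  proof (cases "x = 0")
    case False
    have "norm f \<le> norm (rank_one x f) / norm x"
    proof (rule norm_cblinfun_bound)
      fix y
      have "cmod (f y) * norm x \<le> norm (rank_one x f) * norm y"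
        using norm_cblinfun_le[of "rank_one x f" y] by (simp add: rank_one_apply norm_scaleC)
      then show "cmod (f y) \<le> norm (rank_one x f) / norm x * norm y"
        using False by (simp add: field_simps)
    qed simp
    then show ?thesis using False by (simp add: field_simps)
  qed simp
qed

lemma shift_adjoint_apply: "shift (adjoint_op B) z f = f o\<^sub>C\<^sub>L shift B z"
  by (rule cblinfun_eqI) (simp add: shift_apply adjoint_op_apply cblinfun_apply_compose cblinfun_linear_simps cblinfun_id_apply)

lemma shift_lcomp_apply: "shift (lcomp A) z U = shift A z o\<^sub>C\<^sub>L U"
  by (rule cblinfun_eqI) (simp add: shift_apply lcomp_apply cblinfun_apply_compose cblinfun_linear_simps cblinfun_id_apply)

lemma shift_gen_derivation_apply:
  fixes A :: "'x::complex_banach \<Rightarrow>\<^sub>C\<^sub>L 'x" and B :: "'y::complex_banach \<Rightarrow>\<^sub>C\<^sub>L 'y"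
  shows "shift (gen_derivation A B) (\<mu> - \<nu>) U = (shift A \<mu> o\<^sub>C\<^sub>L U) - (U o\<^sub>C\<^sub>L shift B \<nu>)"
  by (rule cblinfun_eqI)
    (simp add: shift_apply gen_derivation_apply cblinfun_apply_compose cblinfun_linear_simps cblinfun_id_apply
      complex_vector.scale_left_diff_distrib)

text \<open>The derivation acts factorwise on the tensor of \<open>x\<close> and \<open>f\<close>:
  it gives (A - \<mu>) x tensored with \<open>f\<close>, minus \<open>x\<close> tensored with the
  shifted adjoint of \<open>B\<close> at \<open>f\<close>. Approximate eigenvectors of the factors
  thus produce those of the derivation.\<close>

lemma norm_shift_gen_derivation_rank_one:
  fixes A :: "'x::complex_banach \<Rightarrow>\<^sub>C\<^sub>L 'x" and B :: "'y::complex_banach \<Rightarrow>\<^sub>C\<^sub>L 'y"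
  shows "norm (shift (gen_derivation A B) (\<mu> - \<nu>) (rank_one x f)) \<le>
    norm (shift A \<mu> x) * norm f + norm x * norm (shift (adjoint_op B) \<nu> f)"
proof -
  have "shift A \<mu> o\<^sub>C\<^sub>L rank_one x f = rank_one (shift A \<mu> x) f"
    by (rule cblinfun_eqI) (simp add: cblinfun_apply_compose rank_one_apply cblinfun_apply_scaleC)
  moreover have "rank_one x f o\<^sub>C\<^sub>L shift B \<nu> = rank_one x (shift (adjoint_op B) \<nu> f)"
    unfolding shift_adjoint_apply
    by (rule cblinfun_eqI) (simp add: cblinfun_apply_compose rank_one_apply)
  ultimately show ?thesis
    using norm_triangle_ineq4[of "rank_one (shift A \<mu> x) f" "rank_one x (shift (adjoint_op B) \<nu> f)"]
    unfolding shift_gen_derivation_apply norm_rank_one by simp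
qed

text \<open>\<open>g\<close> need not be injective on \<open>I\<close>, so the sum over the image
  may count once a functional that occurs several times; the factor \<open>card I + 1\<close>
  compensates.\<close>

lemma lower_estimate_indexed:
  fixes g :: "'i \<Rightarrow> 'a::complex_normed_vector \<Rightarrow>\<^sub>C\<^sub>L complex" and T :: "'a \<Rightarrow>\<^sub>C\<^sub>L 'b::complex_normed_vector"
  assumes I: "finite I" and C: "C \<ge> 0"
  shows "C * (t + (\<Sum>i\<in>I. cmod (g i x))) \<le> C * (real (card I) + 1) * (\<bar>t\<bar> + (\<Sum>\<psi>\<in>g ` I. cmod (cblinfun_apply \<psi> x)))"
proof -
  let ?s = "\<Sum>\<psi>\<in>g ` I. cmod (cblinfun_apply \<psi> x)"
  have s: "?s \<ge> 0" by (simp add: sum_nonneg)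
  have "cmod (g i x) \<le> ?s" if "i \<in> I" for i
    using member_le_sum[of "g i" "g ` I" "\<lambda>\<psi>. cmod (cblinfun_apply \<psi> x)"] that I by simp
  then have "(\<Sum>i\<in>I. cmod (g i x)) \<le> real (card I) * ?s"
    using sum_bounded_above[of I "\<lambda>i. cmod (g i x)" ?s] by simp
  moreover have "real (card I) * \<bar>t\<bar> \<ge> 0" by simp
  ultimately have "t + (\<Sum>i\<in>I. cmod (g i x)) \<le> (real (card I) + 1) * (\<bar>t\<bar> + ?s)"
    using s abs_ge_self[of t] by (simp only: distrib_right distrib_left mult_1)
  from mult_left_mono[OF this C] show ?thesis by (simp only: mult.assoc)
qed


text \<open>\<open>J\<close> is \<open>k\<close> times an isometry along which \<open>V\<close> is
  dominated by \<open>T\<close> up to the error \<open>c * norm x\<close>; as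
  \<open>2 * C * c < k\<close>, half of \<open>k * norm x\<close> absorbs that error. It serves to
  restrict an estimate for the derivation to rank one operators with one factor fixed.\<close>

lemma lower_estimate_pullback:
  fixes J :: "'a::complex_normed_vector \<Rightarrow>\<^sub>C\<^sub>L 'e::complex_normed_vector" and T :: "'a \<Rightarrow>\<^sub>C\<^sub>L 'b::complex_normed_vector"
    and V :: "'e \<Rightarrow>\<^sub>C\<^sub>L 'f::complex_normed_vector"
  assumes est: "lower_estimate UNIV V \<Phi> C" and C: "C > 0"
    and J: "\<And>x. norm (J x) = k * norm x" and V: "\<And>x. norm (V (J x)) \<le> k * norm (T x) + c * norm x"
    and c: "0 \<le> c" "2 * C * c < k"
  shows "\<exists>\<Psi> D. lower_estimate UNIV T \<Psi> D"
proof -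
  have "0 \<le> 2 * C * c" using C c(1) by simp
  then have k: "k > 0" using c(2) by linarith
  have fin: "finite \<Phi>" using est by (simp add: lower_estimate_def)
  define g where "g \<theta> = \<theta> o\<^sub>C\<^sub>L J" for \<theta> :: "'e \<Rightarrow>\<^sub>C\<^sub>L complex"
  define K where "K = 2 * C * (1 + 1 / k)"
  have K: "K \<ge> 0" using C k by (simp add: K_def)
  have "norm x \<le> K * (norm (T x) + (\<Sum>\<theta>\<in>\<Phi>. cmod (g \<theta> x)))" for x
  proof -
    let ?s = "\<Sum>\<theta>\<in>\<Phi>. cmod (g \<theta> x)" and ?a = "norm (T x)"
    have s: "?s \<ge> 0" by (simp add: sum_nonneg)
    have "k * norm x \<le> C * (norm (V (J x)) + ?s)"
      using est by (simp add: lower_estimate_def g_def cblinfun_apply_compose flip: J)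
    also have "\<dots> \<le> C * (k * ?a + c * norm x + ?s)"
      using V[of x] C by (intro mult_left_mono) auto
    also have "\<dots> = C * (k * ?a + ?s) + (2 * C * c) * norm x / 2" by (simp add: algebra_simps)
    also have "\<dots> \<le> C * (k * ?a + ?s) + k * norm x / 2"
      using c(2) by (intro add_left_mono divide_right_mono mult_right_mono) auto
    finally have "norm x * k \<le> 2 * C * (k * ?a + ?s)" by (simp add: algebra_simps)
    then have "norm x \<le> 2 * C * (k * ?a + ?s) / k" using k by (simp add: pos_le_divide_eq)
    also have "\<dots> = 2 * C * (?a + ?s * (1 / k))" using k by (simp add: field_simps)
    also have "\<dots> \<le> 2 * C * ((1 + 1 / k) * (?a + ?s))"
    proof (intro mult_left_mono)
      have "0 \<le> ?a * (1 / k) + ?s" using s k by simp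
      then show "?a + ?s * (1 / k) \<le> (1 + 1 / k) * (?a + ?s)"
        by (simp only: distrib_left distrib_right mult_1) (simp add: mult.commute)
    qed (use C in simp)
    finally show ?thesis by (simp only: K_def mult.assoc)
  qed
  then have "norm x \<le> K * (real (card \<Phi>) + 1) * (norm (T x) + (\<Sum>\<psi>\<in>g ` \<Phi>. cmod (cblinfun_apply \<psi> x)))" for x
    using lower_estimate_indexed[OF fin K, of "norm (T x)" g x] by (simp only: abs_norm_cancel) (rule order_trans)
  then have "lower_estimate UNIV T (g ` \<Phi>) (K * (real (card \<Phi>) + 1))"
    using fin by (simp add: lower_estimate_def)
  then show ?thesis by (intro exI)
qed


section \<open>Spectra of generalized derivations\<close>

lemma not_bounded_below_witness:
  assumes "z \<in> sigma_a T"
  obtains x where "norm x > C * norm (shift T z x)"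
  using assms unfolding sigma_a_def bounded_below_iff by (auto simp: not_le)

context
  fixes A :: "'x::complex_banach \<Rightarrow>\<^sub>C\<^sub>L 'x" and B :: "'y::complex_banach \<Rightarrow>\<^sub>C\<^sub>L 'y"
begin

lemma sigma_a_gen_derivation_supset:
  assumes \<mu>: "\<mu> \<in> sigma_a A" and \<nu>: "\<nu> \<in> sigma_a (adjoint_op B)"
  shows "\<mu> - \<nu> \<in> sigma_a (gen_derivation A B)"
proof (rule ccontr)
  assume "\<mu> - \<nu> \<notin> sigma_a (gen_derivation A B)"
  then obtain C where "\<And>U. norm U \<le> C * norm (shift (gen_derivation A B) (\<mu> - \<nu>) U)"
    unfolding sigma_a_def bounded_below_iff by blast
  then have C: "norm U \<le> \<bar>C\<bar> * norm (shift (gen_derivation A B) (\<mu> - \<nu>) U)" for U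
    by (rule order_trans) (intro mult_right_mono, auto)
  \<comment> \<open>With the factor 4 each of the two error terms is at most a quarter of
    \<open>norm x * norm f\<close>, half in total, against the full product on the left.\<close>
  obtain x where x: "norm x > 4 * \<bar>C\<bar> * norm (shift A \<mu> x)" by (rule not_bounded_below_witness[OF \<mu>]) (rule that)
  obtain f where f: "norm f > 4 * \<bar>C\<bar> * norm (shift (adjoint_op B) \<nu> f)" by (rule not_bounded_below_witness[OF \<nu>]) (rule that)
  have pos: "norm x > 0" "norm f > 0"
    using x f by (smt (verit) mult_nonneg_nonneg norm_ge_zero abs_ge_zero)+
  have "norm x * norm f \<le> \<bar>C\<bar> * (norm (shift A \<mu> x) * norm f + norm x * norm (shift (adjoint_op B) \<nu> f))"
    using C[of "rank_one x f"] mult_left_mono[OF norm_shift_gen_derivation_rank_one[of A B \<mu> \<nu> x f], of "\<bar>C\<bar>"]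
    unfolding norm_rank_one by linarith
  also have "\<dots> = (\<bar>C\<bar> * norm (shift A \<mu> x)) * norm f + norm x * (\<bar>C\<bar> * norm (shift (adjoint_op B) \<nu> f))"
    by (simp only: distrib_left mult_ac)
  also have "\<dots> \<le> (norm x / 4) * norm f + norm x * (norm f / 4)"
    using x f by (intro add_mono mult_mono) auto
  also have "\<dots> < norm x * norm f" using pos by simp
  finally show False by simp
qed

text \<open>\<open>f\<close> is chosen as an approximate eigenvector of the adjoint, good enough for
  the given constant; the operators \<open>rank_one x f\<close> then form a scaled copy of the space
  of \<open>A\<close> on which the derivation nearly acts as A - \<mu>.\<close>

lemma lower_estimate_left:
  assumes est: "lower_estimate UNIV (shift (gen_derivation A B) (\<mu> - \<nu>)) \<Phi> C"
    and \<nu>: "\<nu> \<in> sigma_a (adjoint_op B)"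
  shows "\<exists>\<Psi> D. lower_estimate UNIV (shift A \<mu>) \<Psi> D"
proof -
  obtain C where C: "C > 0" and est: "lower_estimate UNIV (shift (gen_derivation A B) (\<mu> - \<nu>)) \<Phi> C"
    by (rule lower_estimate_pos[OF est]) (rule that)
  obtain f where f: "norm f > 2 * C * norm (shift (adjoint_op B) \<nu> f)"
    by (rule not_bounded_below_witness[OF \<nu>]) (rule that)
  have J: "cblinfun_apply (rcomp f o\<^sub>C\<^sub>L vector_embedding) x = rank_one x f" for x
    by (simp add: cblinfun_apply_compose rcomp_apply vector_embedding_apply rank_one_def)
  show ?thesis
  proof (rule lower_estimate_pullback[OF est C _ _ norm_ge_zero f])
    show "norm (cblinfun_apply (rcomp f o\<^sub>C\<^sub>L vector_embedding) x) = norm f * norm x" for x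
      unfolding J norm_rank_one by (rule mult.commute)
    show "norm (shift (gen_derivation A B) (\<mu> - \<nu>) (cblinfun_apply (rcomp f o\<^sub>C\<^sub>L vector_embedding) x)) \<le>
        norm f * norm (shift A \<mu> x) + norm (shift (adjoint_op B) \<nu> f) * norm x" for x
      unfolding J using norm_shift_gen_derivation_rank_one[of A B \<mu> \<nu> x f] by (simp only: mult.commute)
  qed
qed

lemma lower_estimate_right:
  assumes est: "lower_estimate UNIV (shift (gen_derivation A B) (\<mu> - \<nu>)) \<Phi> C" and \<mu>: "\<mu> \<in> sigma_a A"
  shows "\<exists>\<Psi> D. lower_estimate UNIV (shift (adjoint_op B) \<nu>) \<Psi> D"
proof -
  obtain C where C: "C > 0" and est: "lower_estimate UNIV (shift (gen_derivation A B) (\<mu> - \<nu>)) \<Phi> C"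
    by (rule lower_estimate_pos[OF est]) (rule that)
  obtain x where x: "norm x > 2 * C * norm (shift A \<mu> x)"
    by (rule not_bounded_below_witness[OF \<mu>]) (rule that)
  have J: "cblinfun_apply (lcomp (vector_map x)) f = rank_one x f" for f :: "'y \<Rightarrow>\<^sub>C\<^sub>L complex"
    by (simp add: lcomp_apply rank_one_def)
  show ?thesis
  proof (rule lower_estimate_pullback[OF est C _ _ norm_ge_zero x])
    show "norm (cblinfun_apply (lcomp (vector_map x)) f) = norm x * norm f" for f :: "'y \<Rightarrow>\<^sub>C\<^sub>L complex"
      unfolding J by (rule norm_rank_one)
    show "norm (shift (gen_derivation A B) (\<mu> - \<nu>) (cblinfun_apply (lcomp (vector_map x)) f)) \<le>
        norm x * norm (shift (adjoint_op B) \<nu> f) + norm (shift A \<mu> x) * norm f" for f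
      unfolding J using norm_shift_gen_derivation_rank_one[of A B \<mu> \<nu> x f] by (simp only: add.commute)
  qed
qed

lemma lcomp_commute: "lcomp A (shift (gen_derivation A B) l U) = shift (gen_derivation A B) l (lcomp A U)"
  by (rule cblinfun_eqI)
    (simp add: shift_apply lcomp_apply gen_derivation_apply cblinfun_apply_compose cblinfun_linear_simps cblinfun_id_apply)

lemma norm_comp_shift_le: "norm (U o\<^sub>C\<^sub>L shift B \<nu>) \<le> norm (shift A \<mu> o\<^sub>C\<^sub>L U) + norm (shift (gen_derivation A B) (\<mu> - \<nu>) U)"
proof -
  have "U o\<^sub>C\<^sub>L shift B \<nu> = (shift A \<mu> o\<^sub>C\<^sub>L U) - shift (gen_derivation A B) (\<mu> - \<nu>) U"
    unfolding shift_gen_derivation_apply by simp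
  then show ?thesis using norm_triangle_ineq4 by metis
qed

lemma estimate_from_left:
  assumes "\<mu> \<notin> sigma_a A"
  shows "\<exists>C. \<forall>U. norm (U :: 'y \<Rightarrow>\<^sub>C\<^sub>L 'x) \<le> C * (norm (shift (lcomp A) \<mu> U) + norm (shift (gen_derivation A B) (\<mu> - \<nu>) U))"
proof -
  obtain C where "\<And>x. norm x \<le> C * norm (shift A \<mu> x)"
    using assms unfolding sigma_a_def bounded_below_iff by blast
  then have C: "norm x \<le> \<bar>C\<bar> * norm (shift A \<mu> x)" for x
    by (rule order_trans) (intro mult_right_mono, auto)
  have "norm U \<le> \<bar>C\<bar> * (norm (shift (lcomp A) \<mu> U) + norm (shift (gen_derivation A B) (\<mu> - \<nu>) U))" for U :: "'y \<Rightarrow>\<^sub>C\<^sub>L 'x"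
  proof -
    have "norm U \<le> \<bar>C\<bar> * norm (shift A \<mu> o\<^sub>C\<^sub>L U)"
    proof (rule norm_cblinfun_bound)
      fix y
      have "norm (U y) \<le> \<bar>C\<bar> * norm (shift A \<mu> (U y))" by (rule C)
      also have "\<dots> \<le> \<bar>C\<bar> * (norm (shift A \<mu> o\<^sub>C\<^sub>L U) * norm y)"
        using norm_cblinfun_le[of "shift A \<mu> o\<^sub>C\<^sub>L U" y] unfolding cblinfun_apply_compose
        by (intro mult_left_mono) auto
      finally show "norm (U y) \<le> \<bar>C\<bar> * norm (shift A \<mu> o\<^sub>C\<^sub>L U) * norm y" by (simp only: mult.assoc)
    qed simp
    also have "\<dots> \<le> \<bar>C\<bar> * (norm (shift (lcomp A) \<mu> U) + norm (shift (gen_derivation A B) (\<mu> - \<nu>) U))"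
      unfolding shift_lcomp_apply by (intro mult_left_mono) auto
    finally show ?thesis .
  qed
  then show ?thesis by blast
qed

text \<open>\<open>U\<close> composed with B - \<nu> is the difference of the two operators applied
  to \<open>U\<close>, and composing with a functional that norms \<open>U y\<close> turns the bound
  for the adjoint into one for \<open>U\<close>.\<close>

lemma estimate_from_right:
  assumes "\<nu> \<notin> sigma_a (adjoint_op B)"
  shows "\<exists>C. \<forall>U. norm (U :: 'y \<Rightarrow>\<^sub>C\<^sub>L 'x) \<le> C * (norm (shift (lcomp A) \<mu> U) + norm (shift (gen_derivation A B) (\<mu> - \<nu>) U))"
proof -
  obtain C where "\<And>f. norm f \<le> C * norm (shift (adjoint_op B) \<nu> f)"
    using assms unfolding sigma_a_def bounded_below_iff by blast
  then have C: "norm f \<le> \<bar>C\<bar> * norm (shift (adjoint_op B) \<nu> f)" for f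
    by (rule order_trans) (intro mult_right_mono, auto)
  have "norm U \<le> \<bar>C\<bar> * (norm (shift (lcomp A) \<mu> U) + norm (shift (gen_derivation A B) (\<mu> - \<nu>) U))" for U :: "'y \<Rightarrow>\<^sub>C\<^sub>L 'x"
  proof -
    have "norm U \<le> \<bar>C\<bar> * norm (U o\<^sub>C\<^sub>L shift B \<nu>)"
    proof (rule norm_cblinfun_bound)
      fix y
      obtain \<phi> :: "'x \<Rightarrow>\<^sub>C\<^sub>L complex" where \<phi>: "\<phi> (U y) = complex_of_real (norm (U y))" "norm \<phi> \<le> 1"
        by (rule exists_norming_functional) (rule that)
      have "norm (U y) = cmod ((\<phi> o\<^sub>C\<^sub>L U) y)" unfolding cblinfun_apply_compose \<phi>(1) by simp
      also have "\<dots> \<le> norm (\<phi> o\<^sub>C\<^sub>L U) * norm y" by (rule norm_cblinfun_le)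
      also have "\<dots> \<le> (\<bar>C\<bar> * norm (U o\<^sub>C\<^sub>L shift B \<nu>)) * norm y"
      proof (intro mult_right_mono)
        have "shift (adjoint_op B) \<nu> (\<phi> o\<^sub>C\<^sub>L U) = \<phi> o\<^sub>C\<^sub>L (U o\<^sub>C\<^sub>L shift B \<nu>)"
          unfolding shift_adjoint_apply by (rule cblinfun_eqI) (simp only: cblinfun_apply_compose)
        then have "norm (shift (adjoint_op B) \<nu> (\<phi> o\<^sub>C\<^sub>L U)) \<le> norm \<phi> * norm (U o\<^sub>C\<^sub>L shift B \<nu>)"
          by (simp only: norm_cblinfun_compose)
        also have "\<dots> \<le> norm (U o\<^sub>C\<^sub>L shift B \<nu>)" using \<phi>(2) by (intro mult_left_le_one_le) auto
        finally have "\<bar>C\<bar> * norm (shift (adjoint_op B) \<nu> (\<phi> o\<^sub>C\<^sub>L U)) \<le> \<bar>C\<bar> * norm (U o\<^sub>C\<^sub>L shift B \<nu>)"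
          by (rule mult_left_mono) simp
        then show "norm (\<phi> o\<^sub>C\<^sub>L U) \<le> \<bar>C\<bar> * norm (U o\<^sub>C\<^sub>L shift B \<nu>)" by (rule order_trans[OF C])
      qed simp
      finally show "norm (U y) \<le> \<bar>C\<bar> * norm (U o\<^sub>C\<^sub>L shift B \<nu>) * norm y" .
    qed simp
    also have "\<dots> \<le> \<bar>C\<bar> * (norm (shift (lcomp A) \<mu> U) + norm (shift (gen_derivation A B) (\<mu> - \<nu>) U))"
      unfolding shift_lcomp_apply using norm_comp_shift_le by (intro mult_left_mono) auto
    finally show ?thesis .
  qed
  then show ?thesis by blast
qed

lemma sigma_a_gen_derivation: "sigma_a (gen_derivation A B) = sigma_a A \<ominus> sigma_a (adjoint_op B)"
proof (intro equalityI subsetI)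
  fix l assume l: "l \<in> sigma_a (gen_derivation A B)"
  show "l \<in> sigma_a A \<ominus> sigma_a (adjoint_op B)"
  proof (rule ccontr)
    assume no: "l \<notin> sigma_a A \<ominus> sigma_a (adjoint_op B)"
    have "\<exists>\<Phi> C. finite \<Phi> \<and> \<Phi> \<subseteq> {} \<and> (\<forall>U. norm U \<le> C * (norm (shift (lcomp A) \<mu> U) + norm (shift (gen_derivation A B) l U)
        + (\<Sum>\<phi>\<in>\<Phi>. cmod (cblinfun_apply \<phi> U))))" for \<mu>
    proof -
      \<comment> \<open>For fixed \<open>l\<close> every \<open>\<mu>\<close> has the single partner
        \<open>\<mu> - l\<close>. As \<open>l\<close> is no difference of spectral points, one of
        the two operators is bounded below, and the estimate holds with the empty set of
        functionals.\<close>
      have "\<mu> \<notin> sigma_a A \<or> \<mu> - l \<notin> sigma_a (adjoint_op B)"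
      proof (rule ccontr)
        assume "\<not> ?thesis"
        moreover have "l = \<mu> - (\<mu> - l)" by simp
        ultimately show False using no unfolding set_diff_def by blast
      qed
      then have "\<exists>C. \<forall>U. norm (U :: 'y \<Rightarrow>\<^sub>C\<^sub>L 'x) \<le> C * (norm (shift (lcomp A) \<mu> U) + norm (shift (gen_derivation A B) (\<mu> - (\<mu> - l)) U))"
        using estimate_from_left estimate_from_right by blast
      then show ?thesis by (intro exI[of _ "{}"]) simp
    qed
    from commuting_estimate[of "lcomp A" "shift (gen_derivation A B) l", OF lcomp_commute this]
    obtain \<Psi> D where "\<Psi> \<subseteq> {}" "lower_estimate UNIV (shift (gen_derivation A B) l) \<Psi> D" by auto
    then have "bounded_below (shift (gen_derivation A B) l)" unfolding bounded_below_iff_estimate by auto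
    then show False using l by (simp add: sigma_a_def)
  qed
next
  fix l assume "l \<in> sigma_a A \<ominus> sigma_a (adjoint_op B)"
  then show "l \<in> sigma_a (gen_derivation A B)" unfolding set_diff_def using sigma_a_gen_derivation_supset by blast
qed

text \<open>Two stages: the estimate for A - \<mu>, applied to the vectors U y, leaves the
  functionals of \<open>\<Phi>\<close> composed with U; the estimate for the adjoint bounds these up
  to their values under \<open>\<Psi>\<close>. The functionals on the operator space are therefore
  indexed by \<open>\<Phi> \<times> \<Psi>\<close>, and \<open>norm_comp_shift_le\<close> trades
  composition with B - \<nu> for the two operators in the conclusion.\<close>

lemma estimate_from_both:
  assumes "lower_estimate UNIV (shift A \<mu>) \<Phi> C" "lower_estimate UNIV (shift (adjoint_op B) \<nu>) \<Psi> D"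
  shows "\<exists>\<Xi> K. finite \<Xi> \<and> (\<forall>U :: 'y \<Rightarrow>\<^sub>C\<^sub>L 'x. norm U \<le> K * (norm (shift (lcomp A) \<mu> U) + norm (shift (gen_derivation A B) (\<mu> - \<nu>) U)
    + (\<Sum>\<xi>\<in>\<Xi>. cmod (cblinfun_apply \<xi> U))))"
proof -
  obtain C where C: "C > 0" "lower_estimate UNIV (shift A \<mu>) \<Phi> C" by (rule lower_estimate_pos[OF assms(1)]) (rule that)
  obtain D where D: "D > 0" "lower_estimate UNIV (shift (adjoint_op B) \<nu>) \<Psi> D" by (rule lower_estimate_pos[OF assms(2)]) (rule that)
  have fin: "finite \<Phi>" "finite \<Psi>" using C D by (simp_all add: lower_estimate_def)
  define g where "g = (\<lambda>(\<phi> :: 'x \<Rightarrow>\<^sub>C\<^sub>L complex, \<psi>). \<psi> o\<^sub>C\<^sub>L lcomp \<phi> :: ('y \<Rightarrow>\<^sub>C\<^sub>L 'x) \<Rightarrow>\<^sub>C\<^sub>L complex)"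
  define M where "M = 1 + (\<Sum>\<phi>\<in>\<Phi>. norm \<phi>)"
  have M: "M \<ge> 1" by (simp add: M_def sum_nonneg)
  define K where "K = C + 2 * C * D * M"
  have K: "K \<ge> 0" using C(1) D(1) M by (simp add: K_def)
  have est: "norm U \<le> K * ((norm (shift (lcomp A) \<mu> U) + norm (shift (gen_derivation A B) (\<mu> - \<nu>) U)) + (\<Sum>i\<in>\<Phi> \<times> \<Psi>. cmod (g i U)))" for U
  proof -
    let ?a = "norm (shift A \<mu> o\<^sub>C\<^sub>L U)" and ?v = "norm (shift (gen_derivation A B) (\<mu> - \<nu>) U)"
    let ?b = "norm (U o\<^sub>C\<^sub>L shift B \<nu>)" and ?s = "\<Sum>i\<in>\<Phi> \<times> \<Psi>. cmod (g i U)"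
    have s: "?s \<ge> 0" by (simp add: sum_nonneg)
    have 1: "norm U \<le> C * (?a + (\<Sum>\<phi>\<in>\<Phi>. norm (\<phi> o\<^sub>C\<^sub>L U)))"
    proof (rule norm_cblinfun_bound)
      show "0 \<le> C * (?a + (\<Sum>\<phi>\<in>\<Phi>. norm (\<phi> o\<^sub>C\<^sub>L U)))"
        using C(1) by (intro mult_nonneg_nonneg add_nonneg_nonneg sum_nonneg) auto
      fix y
      have "norm (U y) \<le> C * (norm (shift A \<mu> (U y)) + (\<Sum>\<phi>\<in>\<Phi>. cmod (cblinfun_apply \<phi> (U y))))"
        using C(2) by (simp add: lower_estimate_def)
      also have "\<dots> \<le> C * (?a * norm y + (\<Sum>\<phi>\<in>\<Phi>. norm (\<phi> o\<^sub>C\<^sub>L U) * norm y))"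
      proof (intro mult_left_mono add_mono sum_mono)
        show "norm (shift A \<mu> (U y)) \<le> ?a * norm y"
          using norm_cblinfun_le[of "shift A \<mu> o\<^sub>C\<^sub>L U" y] by (simp only: cblinfun_apply_compose)
        show "cmod (cblinfun_apply \<phi> (U y)) \<le> norm (\<phi> o\<^sub>C\<^sub>L U) * norm y" for \<phi> :: "'x \<Rightarrow>\<^sub>C\<^sub>L complex"
          using norm_cblinfun_le[of "\<phi> o\<^sub>C\<^sub>L U" y] by (simp only: cblinfun_apply_compose)
      qed (use C in auto)
      also have "\<dots> = C * (?a + (\<Sum>\<phi>\<in>\<Phi>. norm (\<phi> o\<^sub>C\<^sub>L U))) * norm y"
        by (simp only: distrib_right sum_distrib_right mult.assoc)
      finally show "norm (U y) \<le> C * (?a + (\<Sum>\<phi>\<in>\<Phi>. norm (\<phi> o\<^sub>C\<^sub>L U))) * norm y" .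
    qed
    have 2: "norm (\<phi> o\<^sub>C\<^sub>L U) \<le> D * (norm \<phi> * ?b + (\<Sum>\<psi>\<in>\<Psi>. cmod (g (\<phi>, \<psi>) U)))" for \<phi>
    proof -
      have "norm (\<phi> o\<^sub>C\<^sub>L U) \<le> D * (norm (shift (adjoint_op B) \<nu> (\<phi> o\<^sub>C\<^sub>L U)) + (\<Sum>\<psi>\<in>\<Psi>. cmod (cblinfun_apply \<psi> (\<phi> o\<^sub>C\<^sub>L U))))"
        using D(2) by (simp add: lower_estimate_def)
      moreover have "shift (adjoint_op B) \<nu> (\<phi> o\<^sub>C\<^sub>L U) = \<phi> o\<^sub>C\<^sub>L (U o\<^sub>C\<^sub>L shift B \<nu>)"
        unfolding shift_adjoint_apply by (rule cblinfun_eqI) (simp only: cblinfun_apply_compose)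
      moreover have "norm (\<phi> o\<^sub>C\<^sub>L (U o\<^sub>C\<^sub>L shift B \<nu>)) \<le> norm \<phi> * ?b" by (rule norm_cblinfun_compose)
      moreover have "cblinfun_apply \<psi> (\<phi> o\<^sub>C\<^sub>L U) = g (\<phi>, \<psi>) U" for \<psi>
        by (simp add: g_def cblinfun_apply_compose lcomp_apply)
      ultimately show ?thesis using D(1)
        by (simp only:) (smt (verit, best) mult_left_mono)
    qed
    have "(\<Sum>\<phi>\<in>\<Phi>. norm (\<phi> o\<^sub>C\<^sub>L U)) \<le> (\<Sum>\<phi>\<in>\<Phi>. D * (norm \<phi> * ?b + (\<Sum>\<psi>\<in>\<Psi>. cmod (g (\<phi>, \<psi>) U))))"
      by (rule sum_mono[OF 2])
    also have "\<dots> = D * ((\<Sum>\<phi>\<in>\<Phi>. norm \<phi>) * ?b + ?s)"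
      by (simp only: sum_distrib_left[symmetric] sum.distrib sum_distrib_right[symmetric] sum.cartesian_product split_def prod.collapse)
    also have "\<dots> \<le> D * (M * (?b + ?s))"
    proof (intro mult_left_mono)
      have "(\<Sum>\<phi>\<in>\<Phi>. norm \<phi>) * ?b \<le> M * ?b" by (intro mult_right_mono) (auto simp: M_def)
      moreover have "1 * ?s \<le> M * ?s" by (rule mult_right_mono[OF M s])
      ultimately show "(\<Sum>\<phi>\<in>\<Phi>. norm \<phi>) * ?b + ?s \<le> M * (?b + ?s)" by (simp only: distrib_left mult_1)
    qed (use D in simp)
    also have "\<dots> \<le> D * (M * (2 * (?a + ?v + ?s)))"
    proof (intro mult_left_mono)
      have "?b + ?s \<le> ?a + ?v + ?s" by (intro add_right_mono norm_comp_shift_le)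
      moreover have "0 \<le> ?a + ?v + ?s" using s by simp
      ultimately show "?b + ?s \<le> 2 * (?a + ?v + ?s)" by simp
    qed (use D M in auto)
    finally have 3: "(\<Sum>\<phi>\<in>\<Phi>. norm (\<phi> o\<^sub>C\<^sub>L U)) \<le> D * (M * (2 * (?a + ?v + ?s)))" .
    have "?a \<le> ?a + ?v + ?s" using s by simp
    then have "?a + (\<Sum>\<phi>\<in>\<Phi>. norm (\<phi> o\<^sub>C\<^sub>L U)) \<le> (?a + ?v + ?s) + D * (M * (2 * (?a + ?v + ?s)))"
      using 3 by linarith
    then have "C * (?a + (\<Sum>\<phi>\<in>\<Phi>. norm (\<phi> o\<^sub>C\<^sub>L U))) \<le> C * ((?a + ?v + ?s) + D * (M * (2 * (?a + ?v + ?s))))"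
      using C(1) by (intro mult_left_mono) auto
    also have "\<dots> = K * (?a + ?v + ?s)" by (simp add: K_def algebra_simps)
    finally show ?thesis using 1 unfolding shift_lcomp_apply by linarith
  qed
  have "norm U \<le> K * (real (card (\<Phi> \<times> \<Psi>)) + 1) * (norm (shift (lcomp A) \<mu> U) + norm (shift (gen_derivation A B) (\<mu> - \<nu>) U)
      + (\<Sum>\<xi>\<in>g ` (\<Phi> \<times> \<Psi>). cmod (cblinfun_apply \<xi> U)))" for U
  proof -
    have abs: "\<bar>norm (shift (lcomp A) \<mu> U) + norm (shift (gen_derivation A B) (\<mu> - \<nu>) U)\<bar> = norm (shift (lcomp A) \<mu> U) + norm (shift (gen_derivation A B) (\<mu> - \<nu>) U)"
      by (intro abs_of_nonneg add_nonneg_nonneg norm_ge_zero)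
    show ?thesis
      using order_trans[OF est[of U] lower_estimate_indexed[OF finite_cartesian_product[OF fin] K]] unfolding abs .
  qed
  moreover have "finite (g ` (\<Phi> \<times> \<Psi>))" using fin by simp
  ultimately show ?thesis by blast
qed

lemma upper_semi_fredholm_gen_derivation:
  assumes pairs: "\<And>\<mu> \<nu>. \<mu> \<in> sigma_a A \<Longrightarrow> \<nu> \<in> sigma_a (adjoint_op B) \<Longrightarrow> l = \<mu> - \<nu> \<Longrightarrow>
    upper_semi_fredholm (shift A \<mu>) \<and> upper_semi_fredholm (shift (adjoint_op B) \<nu>)"
  shows "upper_semi_fredholm (shift (gen_derivation A B) l)"
proof -
  have "\<exists>\<Phi> C. finite \<Phi> \<and> \<Phi> \<subseteq> UNIV \<and> (\<forall>U. norm U \<le> C * (norm (shift (lcomp A) \<mu> U) + norm (shift (gen_derivation A B) l U)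
      + (\<Sum>\<phi>\<in>\<Phi>. cmod (cblinfun_apply \<phi> U))))" for \<mu>
  proof (cases "\<mu> \<in> sigma_a A \<and> \<mu> - l \<in> sigma_a (adjoint_op B)")
    case True
    then have "upper_semi_fredholm (shift A \<mu>)" "upper_semi_fredholm (shift (adjoint_op B) (\<mu> - l))"
      using pairs[of \<mu> "\<mu> - l"] by simp_all
    then obtain \<Phi> C \<Psi> D where "lower_estimate UNIV (shift A \<mu>) \<Phi> C" "lower_estimate UNIV (shift (adjoint_op B) (\<mu> - l)) \<Psi> D"
      unfolding upper_semi_fredholm_on_iff[OF complex_vector.subspace_UNIV closed_UNIV] by (elim exE)
    from estimate_from_both[OF this] show ?thesis by simp
  next
    case False
    then have "\<exists>C. \<forall>U. norm (U :: 'y \<Rightarrow>\<^sub>C\<^sub>L 'x) \<le> C * (norm (shift (lcomp A) \<mu> U) + norm (shift (gen_derivation A B) (\<mu> - (\<mu> - l)) U))"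
      using estimate_from_left estimate_from_right by blast
    then show ?thesis by (intro exI[of _ "{}"]) simp
  qed
  from commuting_estimate[of "lcomp A" "shift (gen_derivation A B) l", OF lcomp_commute this]
  have "\<exists>\<Psi> D. lower_estimate UNIV (shift (gen_derivation A B) l) \<Psi> D" by (elim exE conjE, intro exI)
  then show ?thesis
    unfolding upper_semi_fredholm_on_iff[OF complex_vector.subspace_UNIV closed_UNIV] .
qed

lemma upper_semi_fredholm_factors:
  assumes "upper_semi_fredholm (shift (gen_derivation A B) (\<mu> - \<nu>))" "\<mu> \<in> sigma_a A" "\<nu> \<in> sigma_a (adjoint_op B)"
  shows "upper_semi_fredholm (shift A \<mu>)" "upper_semi_fredholm (shift (adjoint_op B) \<nu>)"
proof -
  obtain \<Phi> C where est: "lower_estimate UNIV (shift (gen_derivation A B) (\<mu> - \<nu>)) \<Phi> C"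
    using assms(1) unfolding upper_semi_fredholm_on_iff[OF complex_vector.subspace_UNIV closed_UNIV] by (elim exE)
  show "upper_semi_fredholm (shift A \<mu>)" "upper_semi_fredholm (shift (adjoint_op B) \<nu>)"
    unfolding upper_semi_fredholm_on_iff[OF complex_vector.subspace_UNIV closed_UNIV]
    by (rule lower_estimate_left[OF est assms(3)] lower_estimate_right[OF est assms(2)])+
qed

end

section \<open>Accumulation points of differences\<close>

lemma acc_set_diff_supset: "(acc K \<ominus> L) \<union> (K \<ominus> acc L) \<subseteq> acc (K \<ominus> L)"
proof -
  have 1: "\<mu> - \<nu> \<in> acc (K \<ominus> L)" if \<mu>: "\<mu> \<in> acc K" and \<nu>: "\<nu> \<in> L" for \<mu> \<nu>
    unfolding acc_def islimpt_approachable mem_Collect_eq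
  proof (intro allI impI)
    fix e :: real assume "e > 0"
    then obtain y where y: "y \<in> K" "y \<noteq> \<mu>" "dist y \<mu> < e"
      using \<mu> by (auto simp: acc_def islimpt_approachable)
    then show "\<exists>x'\<in>K \<ominus> L. x' \<noteq> \<mu> - \<nu> \<and> dist x' (\<mu> - \<nu>) < e"
      using \<nu> by (intro bexI[of _ "y - \<nu>"]) (auto simp: set_diff_def dist_norm)
  qed
  have 2: "\<mu> - \<nu> \<in> acc (K \<ominus> L)" if \<mu>: "\<mu> \<in> K" and \<nu>: "\<nu> \<in> acc L" for \<mu> \<nu>
    unfolding acc_def islimpt_approachable mem_Collect_eq
  proof (intro allI impI)
    fix e :: real assume "e > 0"
    then obtain y where y: "y \<in> L" "y \<noteq> \<nu>" "dist y \<nu> < e"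
      using \<nu> by (auto simp: acc_def islimpt_approachable)
    then show "\<exists>x'\<in>K \<ominus> L. x' \<noteq> \<mu> - \<nu> \<and> dist x' (\<mu> - \<nu>) < e"
      using \<mu> by (intro bexI[of _ "\<mu> - y"]) (auto simp: set_diff_def dist_norm norm_minus_commute)
  qed
  show ?thesis using 1 2 by (auto simp: set_diff_def)
qed

lemma not_acc_eventually_eq:
  assumes "z \<notin> acc K" "\<And>n. k n \<in> K" "k \<longlonglongrightarrow> z"
  shows "\<forall>\<^sub>F n in sequentially. k n = z"
proof -
  obtain e where e: "e > 0" "\<And>y. y \<in> K \<Longrightarrow> y \<noteq> z \<Longrightarrow> \<not> dist y z < e"
    using assms(1) by (auto simp: acc_def islimpt_approachable)
  have "\<forall>\<^sub>F n in sequentially. dist (k n) z < e" by (rule tendstoD[OF assms(3) e(1)])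
  then show ?thesis by (rule eventually_mono) (use e(2) assms(2) in blast)
qed

text \<open>By compactness, points k_n - l_n approaching \<open>z\<close> have a subsequence along
  which k_n and l_n converge. If neither limit is an accumulation point, both are eventually
  constant and k_n - l_n equals \<open>z\<close>, which was excluded.\<close>

lemma acc_set_diff:
  assumes K: "compact K" and L: "compact L"
  shows "acc (K \<ominus> L) = (acc K \<ominus> L) \<union> (K \<ominus> acc L)"
proof (rule antisym[OF subsetI acc_set_diff_supset])
  fix z assume "z \<in> acc (K \<ominus> L)"
  then obtain f where f: "\<And>n. f n \<in> K \<ominus> L" "\<And>n. f n \<noteq> z" "f \<longlonglongrightarrow> z"
    by (auto simp: acc_def islimpt_sequential)
  have "\<exists>k\<in>K. \<exists>l\<in>L. f n = k - l" for n using f(1)[of n] by (auto simp: set_diff_def)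
  then obtain k l where kl: "\<And>n. k n \<in> K" "\<And>n. l n \<in> L" "\<And>n. f n = k n - l n" by metis
  obtain \<mu> r where r: "\<mu> \<in> K" "strict_mono (r::nat\<Rightarrow>nat)" "(k \<circ> r) \<longlonglongrightarrow> \<mu>"
    using compact_imp_seq_compact[OF K] kl(1) unfolding seq_compact_def by blast
  define \<nu> where "\<nu> = \<mu> - z"
  have "(\<lambda>n. (k \<circ> r) n - (f \<circ> r) n) \<longlonglongrightarrow> \<nu>"
    unfolding \<nu>_def by (intro tendsto_diff r(3) LIMSEQ_subseq_LIMSEQ[OF f(3) r(2)])
  then have lr: "(\<lambda>n. l (r n)) \<longlonglongrightarrow> \<nu>" by (simp add: kl(3))
  have \<nu>: "\<nu> \<in> L" by (rule closed_sequentially[OF compact_imp_closed[OF L] kl(2) lr])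
  have z: "z = \<mu> - \<nu>" by (simp add: \<nu>_def)
  have "\<mu> \<in> acc K \<or> \<nu> \<in> acc L"
  proof (rule ccontr)
    assume no: "\<not> ?thesis"
    then have "\<forall>\<^sub>F n in sequentially. k (r n) = \<mu>" "\<forall>\<^sub>F n in sequentially. l (r n) = \<nu>"
      using not_acc_eventually_eq[of \<mu> K "k \<circ> r"] not_acc_eventually_eq[of \<nu> L "\<lambda>n. l (r n)"] kl r(3) lr
      by auto
    then have "\<forall>\<^sub>F n in sequentially. f (r n) = z"
      by eventually_elim (simp add: kl(3) z)
    then show False using f(2) by (simp add: eventually_False)
  qed
  then show "z \<in> (acc K \<ominus> L) \<union> (K \<ominus> acc L)" using r(1) \<nu> unfolding z set_diff_def by blast
qed


section \<open>Browder's theorem for generalized derivations\<close>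

text \<open>Being semi-Fredholm and being no accumulation point are both decided for the derivation
  by all pairs of spectral points with the given difference, so the description of
  \<open>left_poles_finite\<close> by these two notions carries over. Once \<open>A\<close> and the
  adjoint satisfy a-Browder's theorem, the right side is the set in the formula for
  \<open>sigma_aw\<close> of the derivation.\<close>

lemma left_poles_finite_gen_derivation:
  fixes A :: "'x::complex_banach \<Rightarrow>\<^sub>C\<^sub>L 'x" and B :: "'y::complex_banach \<Rightarrow>\<^sub>C\<^sub>L 'y"
  defines "\<rho> \<equiv> gen_derivation A B"
  shows "sigma_a \<rho> - left_poles_finite \<rho> =
    ((sigma_a A - left_poles_finite A) \<ominus> sigma_a (adjoint_op B)) \<union>
    (sigma_a A \<ominus> (sigma_a (adjoint_op B) - left_poles_finite (adjoint_op B)))"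
    (is "?lhs = ?rhs")
proof (intro equalityI subsetI)
  have sa: "sigma_a \<rho> = sigma_a A \<ominus> sigma_a (adjoint_op B)"
    unfolding \<rho>_def by (rule sigma_a_gen_derivation)
  have acc: "acc (sigma_a \<rho>) = (acc (sigma_a A) \<ominus> sigma_a (adjoint_op B)) \<union> (sigma_a A \<ominus> acc (sigma_a (adjoint_op B)))"
    unfolding sa by (rule acc_set_diff[OF compact_sigma_a compact_sigma_a])
  {
    fix l assume l: "l \<in> ?lhs"
    show "l \<in> ?rhs"
    proof (rule ccontr)
      assume no: "l \<notin> ?rhs"
      have pairs: "\<mu> \<in> left_poles_finite A \<and> \<nu> \<in> left_poles_finite (adjoint_op B)"
        if "\<mu> \<in> sigma_a A" "\<nu> \<in> sigma_a (adjoint_op B)" "l = \<mu> - \<nu>" for \<mu> \<nu>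
        using no that unfolding set_diff_def by blast
      have "upper_semi_fredholm (shift \<rho> l)"
        unfolding \<rho>_def
        by (rule upper_semi_fredholm_gen_derivation) (use pairs in \<open>auto simp: left_poles_finite_iff\<close>)
      moreover have "l \<notin> acc (sigma_a \<rho>)"
      proof
        assume "l \<in> acc (sigma_a \<rho>)"
        then obtain \<mu> \<nu> where "l = \<mu> - \<nu>" "\<mu> \<in> sigma_a A" "\<nu> \<in> sigma_a (adjoint_op B)"
          "\<mu> \<in> acc (sigma_a A) \<or> \<nu> \<in> acc (sigma_a (adjoint_op B))"
          using acc_sigma_a_subset[of A] acc_sigma_a_subset[of "adjoint_op B"] unfolding acc set_diff_def by blast
        then show False using pairs[of \<mu> \<nu>] by (auto simp: left_poles_finite_iff)
      qed
      ultimately show False using l by (simp add: left_poles_finite_iff)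
    qed
  next
    fix l assume "l \<in> ?rhs"
    then obtain \<mu> \<nu> where l: "l = \<mu> - \<nu>" "\<mu> \<in> sigma_a A" "\<nu> \<in> sigma_a (adjoint_op B)"
      "\<mu> \<notin> left_poles_finite A \<or> \<nu> \<notin> left_poles_finite (adjoint_op B)"
      unfolding set_diff_def by blast
    have "l \<in> sigma_a \<rho>" unfolding sa set_diff_def using l by blast
    moreover have "l \<notin> left_poles_finite \<rho>"
    proof
      assume "l \<in> left_poles_finite \<rho>"
      then have *: "upper_semi_fredholm (shift \<rho> (\<mu> - \<nu>))" "\<mu> - \<nu> \<notin> acc (sigma_a \<rho>)"
        by (auto simp: left_poles_finite_iff l(1))
      have "upper_semi_fredholm (shift A \<mu>)" "upper_semi_fredholm (shift (adjoint_op B) \<nu>)"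
        using upper_semi_fredholm_factors *(1) l(2,3) unfolding \<rho>_def by blast+
      then have "\<mu> \<in> acc (sigma_a A) \<or> \<nu> \<in> acc (sigma_a (adjoint_op B))"
        using l by (auto simp: left_poles_finite_iff)
      then have "\<mu> - \<nu> \<in> acc (sigma_a \<rho>)" unfolding acc set_diff_def using l(2,3) by blast
      then show False using *(2) by simp
    qed
    ultimately show "l \<in> ?lhs" by simp
  }
qed

theorem theorem4p2:
  fixes A :: "'x::complex_banach \<Rightarrow>\<^sub>C\<^sub>L 'x"
    and B :: "'y::complex_banach \<Rightarrow>\<^sub>C\<^sub>L 'y"
    and \<rho> :: "('y \<Rightarrow>\<^sub>C\<^sub>L 'x) \<Rightarrow>\<^sub>C\<^sub>L ('y \<Rightarrow>\<^sub>C\<^sub>L 'x)"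
  assumes "\<not> cfinite_dim (UNIV :: 'x set)" and "\<not> cfinite_dim (UNIV :: 'y set)"
    and "a_browder A \<or> generalized_a_browder A"
    and "a_browder (adjoint_op B) \<or> generalized_a_browder (adjoint_op B)"
    and "\<rho> = gen_derivation A B"
  shows "(a_browder \<rho> \<longleftrightarrow> generalized_a_browder \<rho>)
    \<and> (a_browder \<rho> \<longleftrightarrow>
        (acc (sigma_a A) \<ominus> sigma_a (adjoint_op B)) \<union> (sigma_a A \<ominus> acc (sigma_a (adjoint_op B)))
          \<subseteq> sigma_aw \<rho>)
    \<and> (a_browder \<rho> \<longleftrightarrow>
        sigma_aw \<rho> =
          (sigma_aw A \<ominus> sigma_a (adjoint_op B)) \<union> (sigma_a A \<ominus> sigma_aw (adjoint_op B)))
    \<and> (a_browder \<rho> \<longleftrightarrow>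
        (acc (sigma_a A) \<ominus> sigma_a (adjoint_op B)) \<union> (sigma_a A \<ominus> acc (sigma_a (adjoint_op B)))
          \<subseteq> sigma_SBF \<rho>)
    \<and> (a_browder \<rho> \<longleftrightarrow>
        (\<forall>l \<in> sigma_a \<rho> - sigma_aw \<rho>. \<forall>\<mu> \<in> sigma_a A. \<forall>\<nu> \<in> sigma_a (adjoint_op B).
          l = \<mu> - \<nu> \<longrightarrow>
            \<mu> \<in> Phi_plus A \<and> \<nu> \<in> Phi_plus (adjoint_op B)
              \<and> svep_at A \<mu> \<and> svep_at (adjoint_op B) \<nu>))"
proof (intro conjI)
  let ?B = "adjoint_op B"
  note \<rho> = assms(5)
  have sa: "sigma_a \<rho> = sigma_a A \<ominus> sigma_a ?B" unfolding \<rho> by (rule sigma_a_gen_derivation)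
  have acc: "acc (sigma_a \<rho>) = (acc (sigma_a A) \<ominus> sigma_a ?B) \<union> (sigma_a A \<ominus> acc (sigma_a ?B))"
    unfolding sa by (rule acc_set_diff[OF compact_sigma_a compact_sigma_a])
  show "a_browder \<rho> \<longleftrightarrow> generalized_a_browder \<rho>" by (rule a_browder_iff_generalized)
  show ii: "a_browder \<rho> \<longleftrightarrow>
      (acc (sigma_a A) \<ominus> sigma_a ?B) \<union> (sigma_a A \<ominus> acc (sigma_a ?B)) \<subseteq> sigma_aw \<rho>"
    unfolding acc[symmetric] by (rule a_browder_iff)
  show "a_browder \<rho> \<longleftrightarrow>
      (acc (sigma_a A) \<ominus> sigma_a ?B) \<union> (sigma_a A \<ominus> acc (sigma_a ?B)) \<subseteq> sigma_SBF \<rho>"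
    unfolding acc[symmetric] a_browder_iff_generalized by (rule generalized_a_browder_iff)
  \<comment> \<open>The hypotheses on \<open>A\<close> and the adjoint turn their Weyl spectra into
    complements of finite left poles, so that the formula for \<open>sigma_aw \<rho>\<close> becomes
    the definition of a-Browder's theorem for \<open>\<rho>\<close>.\<close>
  have "a_browder A" "a_browder ?B" using assms(3,4) a_browder_iff_generalized by blast+
  then have aw: "sigma_aw A = sigma_a A - left_poles_finite A" "sigma_aw ?B = sigma_a ?B - left_poles_finite ?B"
    by (simp_all add: a_browder_def)
  show "a_browder \<rho> \<longleftrightarrow> sigma_aw \<rho> = (sigma_aw A \<ominus> sigma_a ?B) \<union> (sigma_a A \<ominus> sigma_aw ?B)"
    unfolding a_browder_def aw \<rho> left_poles_finite_gen_derivation ..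
  show "a_browder \<rho> \<longleftrightarrow>
      (\<forall>l \<in> sigma_a \<rho> - sigma_aw \<rho>. \<forall>\<mu> \<in> sigma_a A. \<forall>\<nu> \<in> sigma_a ?B. l = \<mu> - \<nu> \<longrightarrow>
        \<mu> \<in> Phi_plus A \<and> \<nu> \<in> Phi_plus ?B \<and> svep_at A \<mu> \<and> svep_at ?B \<nu>)" (is "_ \<longleftrightarrow> ?v")
  proof
    assume ab: "a_browder \<rho>"
    show ?v
    proof (intro ballI impI)
      fix l \<mu> \<nu> assume l: "l \<in> sigma_a \<rho> - sigma_aw \<rho>" and \<mu>: "\<mu> \<in> sigma_a A" and \<nu>: "\<nu> \<in> sigma_a ?B" and eq: "l = \<mu> - \<nu>"
      \<comment> \<open>Off the accumulation points of the derivation no pair involves an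
        accumulation point, and the SVEP holds at points that are none. The converse below rests on
        the fact that a semi-Fredholm point with the SVEP is no accumulation point.\<close>
      have "l \<notin> acc (sigma_a \<rho>)" using ab l unfolding a_browder_iff by blast
      then have "\<mu> \<notin> acc (sigma_a A)" "\<nu> \<notin> acc (sigma_a ?B)"
        unfolding acc set_diff_def eq using \<mu> \<nu> by blast+
      moreover have "upper_semi_fredholm (shift (gen_derivation A B) (\<mu> - \<nu>))"
        using l unfolding eq \<rho> by (simp add: sigma_aw_def)
      ultimately show "\<mu> \<in> Phi_plus A \<and> \<nu> \<in> Phi_plus ?B \<and> svep_at A \<mu> \<and> svep_at ?B \<nu>"
        using upper_semi_fredholm_factors[OF _ \<mu> \<nu>] not_acc_imp_svep[of \<mu> A] not_acc_imp_svep[of \<nu> ?B]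
        by (simp add: Phi_plus_def)
    qed
  next
    assume v: ?v
    show "a_browder \<rho>"
      unfolding a_browder_iff
    proof
      fix l assume l: "l \<in> acc (sigma_a \<rho>)"
      then obtain \<mu> \<nu> where \<mu>\<nu>: "l = \<mu> - \<nu>" "\<mu> \<in> sigma_a A" "\<nu> \<in> sigma_a ?B"
        "\<mu> \<in> acc (sigma_a A) \<or> \<nu> \<in> acc (sigma_a ?B)"
        using acc_sigma_a_subset[of A] acc_sigma_a_subset[of ?B] unfolding acc set_diff_def by blast
      show "l \<in> sigma_aw \<rho>"
      proof (rule ccontr)
        assume "l \<notin> sigma_aw \<rho>"
        then have "l \<in> sigma_a \<rho> - sigma_aw \<rho>" using l acc_sigma_a_subset by blast
        then have "\<mu> \<in> Phi_plus A \<and> \<nu> \<in> Phi_plus ?B \<and> svep_at A \<mu> \<and> svep_at ?B \<nu>"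
          using v \<mu>\<nu> by blast
        then show False
          using \<mu>\<nu>(4) svep_imp_not_acc[of A \<mu>] svep_imp_not_acc[of ?B \<nu>] by (auto simp: Phi_plus_def)
      qed
    qed
  qed
qed

end
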